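(* Let $G$ be a pro-oligomorphic group, let $\mathcal{E}$ be an order in $\mathbf{S}(G)$, and let $\mathcal{C}$ be the order associated to $\mathcal{E}$ as in the context. Let $k$ be a ring and let $\mu$ be a regular $k$-valued measure on $\mathcal{C}$. Then $\mu$ is either $\alpha_k$ or $\beta_k$.
   Context: Rings are commutative. **Pro-oligomorphic groups and orders.** A pro-oligomorphic group is a Hausdorff topological group $G$ whose open subgroups form a neighborhood basis of the identity and such that $U\backslash G/V$ is finite for all open subgroups $U,V$. $\mathbf{S}(G)$ is the category of $G$-sets with open point stabilizers and finitely many orbits. An order in $\mathbf{S}(G)$ is a full subcategory that contains the one-point set $\mathbf 1$, is closed under finite products, finite coproducts and subobjects, and is such that every object of $\mathbf{S}(G)$ is a quotient of one of its objects. Atoms are the transitive $G$-sets. $\rho(X)$ denotes the number of atoms (orbits) in $X$. **The category $\mathcal{C}$.** Let $\mathcal{E}^s_1$ be the category whose objects are the non-empty objects of $\mathcal{E}$ and whose morphisms are the surjective $G$-maps. There is a pro-object $\Omega$ of $\mathcal{E}^s_1$ that is universal (it admits a map to every object $X$) and homogeneous ($\mathrm{Aut}(\Omega)$ acts transitively on $\mathrm{Hom}(\Omega,X)$ for every $X$). Let $\mathfrak{G}=\mathrm{Aut}(\Omega)$ and let $\mathfrak{B}(X)$ be the $\mathfrak{G}$-set of maps $\Omega\to X$ in the pro-category of $\mathcal{E}^s_1$. With the topology generated by the stabilizers of elements of the $\mathfrak{B}(X)$, $\mathfrak{G}$ is pro-oligomorphic and each $\mathfrak{B}(X)$ is transitive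 and smooth. $\mathcal{C}$ is the order in $\mathbf{S}(\mathfrak{G})$ consisting of the objects all of whose atoms have the form $\mathfrak{B}(X)$ with $X\in\mathcal{E}$ non-empty. Maps $\mathfrak{B}(Y)\to\mathfrak{B}(X)$ correspond bijectively to surjections $Y\to X$. **Measures.** A measure for $\mathcal{C}$ valued in a ring $k$ assigns to each morphism $f\colon Y\to X$ of atoms of $\mathcal{C}$ an element $\mu(f)\in k$ such that: $\mu(f)=1$ if $f$ is an isomorphism; $\mu(g\circ f)=\mu(g)\mu(f)$ when defined; and, if $X'\to X$ is a morphism of atoms and $Y\times_X X'=\bigsqcup_i Y'_i$ is the decomposition into atoms with induced maps $f'_i\colon Y'_i\to X'$, then $\mu(f)=\sum_i\mu(f'_i)$. For an atom $X$ put $\mu(X)=\mu(X\to\mathbf 1)$. The measure $\mu$ is regular if $\mu(X)$ is a unit of $k$ for every atom $X$ of $\mathcal{C}$; a regular measure is determined by its values on atoms, since $\mu(Y\to X)=\mu(Y)\mu(X)^{-1}$. **The measures $\alpha_k$ and $\beta_k$.** $\alpha$ is the $\mathbf{Z}$-valued measure on $\mathcal{C}$ with $\alpha(\mathfrak{B}(X))=(-1)^{\rho(X)-1}$ for all non-empty $X$ in $\mathcal{E}$; it always exists. $\mathcal{E}$ is called odd if for all morphisms of atoms $Y\to X$ and $X'\to X$ in $\mathcal{E}$ the fiber product $X'\times_X Y$ contains an odd number of atoms. When $\mathcal{E}$ is odd, $\beta$ is the $\mathbf{Z}$-valued measure on $\mathcal{C}$ with $\beta(\mathfrak{B}(X))=(-2)^{\rho(X)-1}$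 for all non-empty $X$ in $\mathcal{E}$ ($\beta$ is defined only in this case). For a ring $k$, $\alpha_k$ and $\beta_k$ are the $k$-valued measures obtained from $\alpha$ and $\beta$ by extension of scalars along $\mathbf{Z}\to k$.
   Formalization: "μ is either α_k or β_k" is proved when k ≠ 0 has no idempotents but 0 and 1; it fails e.g. for k=Q×Q, μ=(α,β). For general nonzero k: μ=α_k, or E is odd and μ=e·α_k+(1−e)·β_k for some idempotent e of k. *)

theory Defs
  imports "HOL-Analysis.Analysis" "HOL-Algebra.Group_Action"
begin

section \<open>Topological groups and pro-oligomorphic groups\<close>

definition topological_grp :: "('g, 'm) monoid_scheme \<Rightarrow> 'g topology \<Rightarrow> bool" where
  "topological_grp G T \<longleftrightarrow>
     group G \<and> topspace T = carrier G \<and>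
     continuous_map (prod_topology T T) T (\<lambda>(x, y). x \<otimes>\<^bsub>G\<^esub> y) \<and>
     continuous_map T T (\<lambda>x. inv\<^bsub>G\<^esub> x)"

definition open_subgroup :: "('g, 'm) monoid_scheme \<Rightarrow> 'g topology \<Rightarrow> 'g set \<Rightarrow> bool" where
  "open_subgroup G T U \<longleftrightarrow> subgroup U G \<and> openin T U"

definition pro_oligomorphic :: "('g, 'm) monoid_scheme \<Rightarrow> 'g topology \<Rightarrow> bool" where
  "pro_oligomorphic G T \<longleftrightarrow>
     topological_grp G T \<and> Hausdorff_space T \<and>
     (\<forall>W. openin T W \<and> \<one>\<^bsub>G\<^esub> \<in> W \<longrightarrow> (\<exists>U. open_subgroup G T U \<and> U \<subseteq> W)) \<and>
     (\<forall>U V. open_subgroup G T U \<and> open_subgroup G T V \<longrightarrow>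
        finite {(U #>\<^bsub>G\<^esub> g) <#>\<^bsub>G\<^esub> V | g. g \<in> carrier G})"

section \<open>G-sets\<close>

text \<open>The action is constrained only at group elements; there it is an extensional bijection
  of the underlying set, as required by \<^const>\<open>group_action\<close>.\<close>

datatype ('g, 'x) gset = GSet (pts: "'x set") (act: "'g \<Rightarrow> 'x \<Rightarrow> 'x")

definition gmaps ::
  "('g, 'm) monoid_scheme \<Rightarrow> ('g, 'x) gset \<Rightarrow> ('g, 'y) gset \<Rightarrow> ('x \<Rightarrow> 'y) set" where
  "gmaps G X Y = {f \<in> pts X \<rightarrow>\<^sub>E pts Y.
     \<forall>g\<in>carrier G. \<forall>x\<in>pts X. f (act X g x) = act Y g (f x)}"

definition surj_gmaps ::
  "('g, 'm) monoid_scheme \<Rightarrow> ('g, 'x) gset \<Rightarrow> ('g, 'y) gset \<Rightarrow> ('x \<Rightarrow> 'y) set" where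
  "surj_gmaps G X Y = {f \<in> gmaps G X Y. f ` pts X = pts Y}"

definition gisos ::
  "('g, 'm) monoid_scheme \<Rightarrow> ('g, 'x) gset \<Rightarrow> ('g, 'y) gset \<Rightarrow> ('x \<Rightarrow> 'y) set" where
  "gisos G X Y = {f \<in> gmaps G X Y. bij_betw f (pts X) (pts Y)}"

definition gset_iso :: "('g, 'm) monoid_scheme \<Rightarrow> ('g, 'x) gset \<Rightarrow> ('g, 'y) gset \<Rightarrow> bool" where
  "gset_iso G X Y \<longleftrightarrow> gisos G X Y \<noteq> {}"

definition sub_gset :: "('g, 'x) gset \<Rightarrow> 'x set \<Rightarrow> ('g, 'x) gset" where
  "sub_gset X A = GSet A (\<lambda>g. restrict (act X g) A)"

definition prod_gset :: "('g, 'x) gset \<Rightarrow> ('g, 'y) gset \<Rightarrow> ('g, 'x \<times> 'y) gset" where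
  "prod_gset X Y =
     GSet (pts X \<times> pts Y) (\<lambda>g. restrict (map_prod (act X g) (act Y g)) (pts X \<times> pts Y))"

definition coprod_gset :: "('g, 'x) gset \<Rightarrow> ('g, 'y) gset \<Rightarrow> ('g, 'x + 'y) gset" where
  "coprod_gset X Y =
     GSet (pts X <+> pts Y) (\<lambda>g. restrict (map_sum (act X g) (act Y g)) (pts X <+> pts Y))"

definition fiber_prod ::
  "('g, 'x) gset \<Rightarrow> ('x \<Rightarrow> 'z) \<Rightarrow> ('g, 'y) gset \<Rightarrow> ('y \<Rightarrow> 'z) \<Rightarrow> ('g, 'x \<times> 'y) gset" where
  "fiber_prod X f Y h = sub_gset (prod_gset X Y) {(x, y). x \<in> pts X \<and> y \<in> pts Y \<and> f x = h y}"

definition rho :: "('g, 'm) monoid_scheme \<Rightarrow> ('g, 'x) gset \<Rightarrow> nat" where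
  "rho G X = card (orbits G (pts X) (act X))"

section \<open>The category S(G) and orders\<close>

definition finitary_smooth ::
  "('g, 'm) monoid_scheme \<Rightarrow> 'g topology \<Rightarrow> ('g, 'x) gset \<Rightarrow> bool" where
  "finitary_smooth G T X \<longleftrightarrow>
     group_action G (pts X) (act X) \<and>
     (\<forall>x\<in>pts X. openin T (stabilizer G (act X) x)) \<and>
     finite (orbits G (pts X) (act X))"

text \<open>Every finitary smooth G-set is isomorphic to a finite disjoint union of coset spaces
  \<open>{i} \<times> G/U\<^sub>i\<close>, so the G-sets whose points lie in the following type form a category
  equivalent to that of all finitary smooth G-sets.\<close>

type_synonym 'g univ = "nat \<times> 'g set"

definition SG :: "('g, 'm) monoid_scheme \<Rightarrow> 'g topology \<Rightarrow> ('g, 'g univ) gset set" where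
  "SG G T = {X. finitary_smooth G T X}"

text \<open>Products and coproducts are determined up to isomorphism, so the closure conditions range
  over all their representatives in \<^const>\<open>SG\<close>. The nullary cases are the one-point set and
  the empty set.\<close>

definition is_order ::
  "('g, 'm) monoid_scheme \<Rightarrow> 'g topology \<Rightarrow> ('g, 'g univ) gset set \<Rightarrow> bool" where
  "is_order G T E \<longleftrightarrow>
     E \<subseteq> SG G T \<and>
     (\<forall>Z\<in>SG G T. is_singleton (pts Z) \<longrightarrow> Z \<in> E) \<and>
     (\<forall>X\<in>E. \<forall>Y\<in>E. \<forall>Z\<in>SG G T. gset_iso G Z (prod_gset X Y) \<longrightarrow> Z \<in> E) \<and>
     (\<forall>Z\<in>SG G T. pts Z = {} \<longrightarrow> Z \<in> E) \<and>
     (\<forall>X\<in>E. \<forall>Y\<in>E. \<forall>Z\<in>SG G T. gset_iso G Z (coprod_gset X Y) \<longrightarrow> Z \<in> E) \<and>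
     (\<forall>X\<in>E. \<forall>Y\<in>SG G T. (\<exists>f\<in>gmaps G Y X. inj_on f (pts Y)) \<longrightarrow> Y \<in> E) \<and>
     (\<forall>X\<in>SG G T. \<exists>Y\<in>E. surj_gmaps G Y X \<noteq> {})"

definition atoms ::
  "('g, 'm) monoid_scheme \<Rightarrow> ('g, 'x) gset set \<Rightarrow> ('g, 'x) gset set" where
  "atoms G C = {X \<in> C. rho G X = 1}"

definition odd_order :: "('g, 'm) monoid_scheme \<Rightarrow> ('g, 'x) gset set \<Rightarrow> bool" where
  "odd_order G E \<longleftrightarrow>
     (\<forall>X\<in>atoms G E. \<forall>Y\<in>atoms G E. \<forall>X'\<in>atoms G E. \<forall>f\<in>gmaps G Y X. \<forall>h\<in>gmaps G X' X.
        odd (rho G (fiber_prod X' h Y f)))"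

section \<open>Pro-objects of the category of non-empty objects and surjections\<close>

text \<open>A pro-object is presented as an inverse system over a non-empty directed preorder;
  \<open>ptr P i j\<close> is the transition map from \<open>pob P j\<close> to \<open>pob P i\<close> for \<open>i \<le> j\<close>.\<close>

record ('i, 'g, 'x) pro_obj =
  pidx :: "'i set"
  ple  :: "'i \<Rightarrow> 'i \<Rightarrow> bool"
  pob  :: "'i \<Rightarrow> ('g, 'x) gset"
  ptr  :: "'i \<Rightarrow> 'i \<Rightarrow> 'x \<Rightarrow> 'x"

definition is_pro_object ::
  "('g, 'm) monoid_scheme \<Rightarrow> ('g, 'x) gset set \<Rightarrow> ('i, 'g, 'x) pro_obj \<Rightarrow> bool" where
  "is_pro_object G E P \<longleftrightarrow>
     pidx P \<noteq> {} \<and>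
     (\<forall>i\<in>pidx P. ple P i i) \<and>
     (\<forall>i\<in>pidx P. \<forall>j\<in>pidx P. \<forall>k\<in>pidx P. ple P i j \<and> ple P j k \<longrightarrow> ple P i k) \<and>
     (\<forall>i\<in>pidx P. \<forall>j\<in>pidx P. \<exists>k\<in>pidx P. ple P i k \<and> ple P j k) \<and>
     (\<forall>i\<in>pidx P. pob P i \<in> E \<and> pts (pob P i) \<noteq> {}) \<and>
     (\<forall>i\<in>pidx P. \<forall>j\<in>pidx P. ple P i j \<longrightarrow> ptr P i j \<in> surj_gmaps G (pob P j) (pob P i)) \<and>
     (\<forall>i\<in>pidx P. ptr P i i = (\<lambda>x\<in>pts (pob P i). x)) \<and>
     (\<forall>i\<in>pidx P. \<forall>j\<in>pidx P. \<forall>k\<in>pidx P. ple P i j \<and> ple P j k \<longrightarrow>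
        ptr P i k = compose (pts (pob P k)) (ptr P i j) (ptr P j k))"

text \<open>Maps in the pro-category from \<open>P\<close> to an object \<open>X\<close>: the filtered colimit over \<open>i\<close> of the
  sets of surjections from \<open>pob P i\<close> to \<open>X\<close>.\<close>

definition pro_rel ::
  "('g, 'm) monoid_scheme \<Rightarrow> ('i, 'g, 'x) pro_obj \<Rightarrow> ('g, 'x) gset \<Rightarrow> ('i \<times> ('x \<Rightarrow> 'x)) rel" where
  "pro_rel G P X = {((i, f), (j, h)).
     i \<in> pidx P \<and> f \<in> surj_gmaps G (pob P i) X \<and>
     j \<in> pidx P \<and> h \<in> surj_gmaps G (pob P j) X \<and>
     (\<exists>k\<in>pidx P. ple P i k \<and> ple P j k \<and>
        compose (pts (pob P k)) f (ptr P i k) = compose (pts (pob P k)) h (ptr P j k))}"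

definition pro_hom ::
  "('g, 'm) monoid_scheme \<Rightarrow> ('i, 'g, 'x) pro_obj \<Rightarrow> ('g, 'x) gset \<Rightarrow> ('i \<times> ('x \<Rightarrow> 'x)) set set" where
  "pro_hom G P X = (SIGMA i:pidx P. surj_gmaps G (pob P i) X) // pro_rel G P X"

text \<open>In the next definition and in \<open>pro_comp\<close> below, all members of the union coincide.
  \<open>pro_post G P X Y h u\<close> is the composite \<open>P \<rightarrow> X \<rightarrow> Y\<close> of \<open>u\<close> with the surjection \<open>h\<close>.\<close>

definition pro_post ::
  "('g, 'm) monoid_scheme \<Rightarrow> ('i, 'g, 'x) pro_obj \<Rightarrow> ('g, 'x) gset \<Rightarrow> ('g, 'x) gset \<Rightarrow>
   ('x \<Rightarrow> 'x) \<Rightarrow> ('i \<times> ('x \<Rightarrow> 'x)) set \<Rightarrow> ('i \<times> ('x \<Rightarrow> 'x)) set" where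
  "pro_post G P X Y h u =
     (\<Union>(i, f)\<in>u. pro_rel G P Y `` {(i, compose (pts (pob P i)) h f)})"

text \<open>An endomorphism of \<open>P\<close> is an element of the limit over \<open>j\<close> of the sets of maps from \<open>P\<close> to
  \<open>pob P j\<close>; \<open>pro_comp G P X u \<sigma>\<close> is the composite \<open>P \<rightarrow> P \<rightarrow> X\<close> of the endomorphism \<open>\<sigma>\<close>
  with \<open>u\<close>.\<close>

type_synonym ('i, 'x) pro_endo = "'i \<Rightarrow> ('i \<times> ('x \<Rightarrow> 'x)) set"

definition pro_comp ::
  "('g, 'm) monoid_scheme \<Rightarrow> ('i, 'g, 'x) pro_obj \<Rightarrow> ('g, 'x) gset \<Rightarrow>
   ('i \<times> ('x \<Rightarrow> 'x)) set \<Rightarrow> ('i, 'x) pro_endo \<Rightarrow> ('i \<times> ('x \<Rightarrow> 'x)) set" where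
  "pro_comp G P X u \<sigma> = (\<Union>(i, f)\<in>u. pro_post G P (pob P i) X f (\<sigma> i))"

definition pro_End ::
  "('g, 'm) monoid_scheme \<Rightarrow> ('i, 'g, 'x) pro_obj \<Rightarrow> ('i, 'x) pro_endo monoid" where
  "pro_End G P =
     \<lparr>carrier = {\<sigma> \<in> (\<Pi>\<^sub>E i\<in>pidx P. pro_hom G P (pob P i)).
        \<forall>i\<in>pidx P. \<forall>j\<in>pidx P. ple P i j \<longrightarrow>
          pro_post G P (pob P j) (pob P i) (ptr P i j) (\<sigma> j) = \<sigma> i},
      monoid.mult = (\<lambda>\<sigma> \<tau>. \<lambda>i\<in>pidx P. pro_comp G P (pob P i) (\<sigma> i) \<tau>),
      one = (\<lambda>i\<in>pidx P. pro_rel G P (pob P i) `` {(i, \<lambda>x\<in>pts (pob P i). x)})\<rparr>"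

definition pro_Aut ::
  "('g, 'm) monoid_scheme \<Rightarrow> ('i, 'g, 'x) pro_obj \<Rightarrow> ('i, 'x) pro_endo monoid" where
  "pro_Aut G P = units_of (pro_End G P)"

definition universal_pro ::
  "('g, 'm) monoid_scheme \<Rightarrow> ('g, 'x) gset set \<Rightarrow> ('i, 'g, 'x) pro_obj \<Rightarrow> bool" where
  "universal_pro G E P \<longleftrightarrow> (\<forall>X\<in>E. pts X \<noteq> {} \<longrightarrow> pro_hom G P X \<noteq> {})"

definition homogeneous_pro ::
  "('g, 'm) monoid_scheme \<Rightarrow> ('g, 'x) gset set \<Rightarrow> ('i, 'g, 'x) pro_obj \<Rightarrow> bool" where
  "homogeneous_pro G E P \<longleftrightarrow>
     (\<forall>X\<in>E. pts X \<noteq> {} \<longrightarrow>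
        (\<forall>u\<in>pro_hom G P X. \<forall>v\<in>pro_hom G P X. \<exists>\<sigma>\<in>carrier (pro_Aut G P). pro_comp G P X u \<sigma> = v))"

section \<open>The order associated to E\<close>

text \<open>Precomposition is a right action, hence the inverse.\<close>

definition BB ::
  "('g, 'm) monoid_scheme \<Rightarrow> ('i, 'g, 'x) pro_obj \<Rightarrow> ('g, 'x) gset \<Rightarrow>
   (('i, 'x) pro_endo, ('i \<times> ('x \<Rightarrow> 'x)) set) gset" where
  "BB G P X = GSet (pro_hom G P X)
     (\<lambda>\<sigma>. \<lambda>u\<in>pro_hom G P X. pro_comp G P X u (inv\<^bsub>pro_Aut G P\<^esub> \<sigma>))"

text \<open>Left cosets of the stabilizers are taken, so that finite intersections of stabilizers form a
  neighborhood basis of the identity.\<close>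

definition Aut_topology ::
  "('g, 'm) monoid_scheme \<Rightarrow> ('g, 'x) gset set \<Rightarrow> ('i, 'g, 'x) pro_obj \<Rightarrow>
   ('i, 'x) pro_endo topology" where
  "Aut_topology G E P = topology_generated_by
     {\<sigma> <#\<^bsub>pro_Aut G P\<^esub> stabilizer (pro_Aut G P) (act (BB G P X)) u | \<sigma> X u.
        \<sigma> \<in> carrier (pro_Aut G P) \<and> X \<in> E \<and> pts X \<noteq> {} \<and> u \<in> pro_hom G P X}"

definition assoc_order ::
  "('g, 'm) monoid_scheme \<Rightarrow> ('g, 'x) gset set \<Rightarrow> ('i, 'g, 'x) pro_obj \<Rightarrow>
   (('i, 'x) pro_endo, ('i, 'x) pro_endo univ) gset set" where
  "assoc_order G E P = {Z \<in> SG (pro_Aut G P) (Aut_topology G E P).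
     \<forall>A\<in>orbits (pro_Aut G P) (pts Z) (act Z).
       \<exists>X\<in>E. pts X \<noteq> {} \<and> gset_iso (pro_Aut G P) (sub_gset Z A) (BB G P X)}"

section \<open>Measures\<close>

text \<open>A measure takes the source, the target and the underlying function of a morphism of atoms;
  its values at other arguments are irrelevant.\<close>

type_synonym ('h, 'y, 'k) gmeasure = "('h, 'y) gset \<Rightarrow> ('h, 'y) gset \<Rightarrow> ('y \<Rightarrow> 'y) \<Rightarrow> 'k"

text \<open>In the last clause \<open>A i\<close> are the atoms of the fiber product of \<open>Y\<close> and \<open>X'\<close> over \<open>X\<close>, with
  projections \<open>p i\<close> to \<open>Y\<close> and \<open>q i\<close> to \<open>X'\<close>.\<close>

definition orbit_measure ::
  "('h, 'm) monoid_scheme \<Rightarrow> ('h, 'y) gset set \<Rightarrow> ('h, 'y, 'k::comm_ring_1) gmeasure \<Rightarrow> bool" where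
  "orbit_measure H C \<mu> \<longleftrightarrow>
     (\<forall>Y\<in>atoms H C. \<forall>X\<in>atoms H C. \<forall>f\<in>gisos H Y X. \<mu> Y X f = 1) \<and>
     (\<forall>Z\<in>atoms H C. \<forall>Y\<in>atoms H C. \<forall>X\<in>atoms H C. \<forall>f\<in>gmaps H Z Y. \<forall>g\<in>gmaps H Y X.
        \<mu> Z X (compose (pts Z) g f) = \<mu> Y X g * \<mu> Z Y f) \<and>
     (\<forall>Y\<in>atoms H C. \<forall>X\<in>atoms H C. \<forall>X'\<in>atoms H C. \<forall>f\<in>gmaps H Y X. \<forall>h\<in>gmaps H X' X.
        \<forall>(I::nat set) A p q.
          finite I \<and>
          (\<forall>i\<in>I. A i \<in> atoms H C \<and> p i \<in> gmaps H (A i) Y \<and> q i \<in> gmaps H (A i) X') \<and>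
          bij_betw (\<lambda>(i, a). (p i a, q i a)) (SIGMA i:I. pts (A i)) (pts (fiber_prod Y f X' h))
          \<longrightarrow> \<mu> Y X f = (\<Sum>i\<in>I. \<mu> (A i) X' (q i)))"

definition one_gset :: "('h, 'h univ) gset" where
  "one_gset = GSet {(0, {})} (\<lambda>g. \<lambda>x\<in>{(0, {})}. x)"

definition atom_measure :: "('h, 'h univ, 'k) gmeasure \<Rightarrow> ('h, 'h univ) gset \<Rightarrow> 'k" where
  "atom_measure \<mu> X = \<mu> X one_gset (\<lambda>x\<in>pts X. (0, {}))"

definition regular_measure ::
  "('h, 'm) monoid_scheme \<Rightarrow> ('h, 'h univ) gset set \<Rightarrow>
   ('h, 'h univ, 'k::comm_ring_1) gmeasure \<Rightarrow> bool" where
  "regular_measure H C \<mu> \<longleftrightarrow> orbit_measure H C \<mu> \<and> (\<forall>X\<in>atoms H C. atom_measure \<mu> X dvd 1)"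

definition measure_eq ::
  "('h, 'm) monoid_scheme \<Rightarrow> ('h, 'y) gset set \<Rightarrow>
   ('h, 'y, 'k) gmeasure \<Rightarrow> ('h, 'y, 'k) gmeasure \<Rightarrow> bool" where
  "measure_eq H C \<mu> \<nu> \<longleftrightarrow> (\<forall>Y\<in>atoms H C. \<forall>X\<in>atoms H C. \<forall>f\<in>gmaps H Y X. \<mu> Y X f = \<nu> Y X f)"

definition extend_scalars ::
  "('h, 'y, int) gmeasure \<Rightarrow> ('h, 'y, 'k::comm_ring_1) gmeasure" where
  "extend_scalars \<mu> = (\<lambda>Y X f. of_int (\<mu> Y X f))"

text \<open>The integral measure with value \<open>c ^ (\<rho>(X) - 1)\<close> at the atom given by each non-empty \<open>X\<close>;
  for \<open>c\<close> non-zero this determines it up to \<^const>\<open>measure_eq\<close>.\<close>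

definition is_power_measure ::
  "int \<Rightarrow> ('g, 'm) monoid_scheme \<Rightarrow> ('g, 'x) gset set \<Rightarrow> ('i, 'g, 'x) pro_obj \<Rightarrow>
   (('i, 'x) pro_endo, ('i, 'x) pro_endo univ, int) gmeasure \<Rightarrow> bool" where
  "is_power_measure c G E P \<mu> \<longleftrightarrow>
     orbit_measure (pro_Aut G P) (assoc_order G E P) \<mu> \<and>
     (\<forall>X\<in>E. pts X \<noteq> {} \<longrightarrow>
        (\<forall>A\<in>atoms (pro_Aut G P) (assoc_order G E P).
           gset_iso (pro_Aut G P) A (BB G P X) \<longrightarrow> atom_measure \<mu> A = c ^ (rho G X - 1)))"

definition is_alpha_k ::
  "('g, 'm) monoid_scheme \<Rightarrow> ('g, 'x) gset set \<Rightarrow> ('i, 'g, 'x) pro_obj \<Rightarrow>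
   (('i, 'x) pro_endo, ('i, 'x) pro_endo univ, 'k::comm_ring_1) gmeasure \<Rightarrow> bool" where
  "is_alpha_k G E P \<mu> \<longleftrightarrow>
     (\<exists>\<alpha>. is_power_measure (-1) G E P \<alpha> \<and>
        measure_eq (pro_Aut G P) (assoc_order G E P) \<mu> (extend_scalars \<alpha>))"

definition is_beta_k ::
  "('g, 'm) monoid_scheme \<Rightarrow> ('g, 'x) gset set \<Rightarrow> ('i, 'g, 'x) pro_obj \<Rightarrow>
   (('i, 'x) pro_endo, ('i, 'x) pro_endo univ, 'k::comm_ring_1) gmeasure \<Rightarrow> bool" where
  "is_beta_k G E P \<mu> \<longleftrightarrow>
     odd_order G E \<and>
     (\<exists>\<beta>. is_power_measure (-2) G E P \<beta> \<and>
        measure_eq (pro_Aut G P) (assoc_order G E P) \<mu> (extend_scalars \<beta>))"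

end

theory Submission
  imports Defs
begin

text \<open>
  A regular measure assigns a unit \<open>m(X)\<close> to every non-empty object \<open>X\<close> of \<open>E\<close>. Since the atoms of the
  fiber product of \<open>B(Y)\<close> and \<open>B(X')\<close> over \<open>B(X)\<close> are the \<open>B(D)\<close>, where \<open>D\<close> runs over the subobjects
  of the fiber product of \<open>Y\<close> and \<open>X'\<close> over \<open>X\<close> that surject onto both factors, it satisfies
  \<open>m(Y) m(X') = m(X) \<Sum>\<^sub>D m(D)\<close>. Squares with only one such \<open>D\<close> show that \<open>m(X)\<close> depends only on the
  number of orbits of \<open>X\<close> and is a geometric progression from the two-point set on; the squares
  obtained by doubling a point of a one-point and of a two-point set then give \<open>m(X) = s\<^bsup>\<rho>(X)-1\<^esup>\<close> with
  \<open>(s + 1)(s + 2) = 0\<close>. So \<open>s + 2\<close> is an idempotent that splits \<open>m\<close> into an \<open>\<alpha>\<close>-part and a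
  \<open>\<beta>\<close>-part. A fiber product of atoms with an even number of orbits forces \<open>s = -1\<close>.
  That \<open>\<alpha>\<close> and \<open>\<beta>\<close> are measures is a signed count of the edge covers of a bipartite graph.
\<close>

section \<open>G-sets\<close>

text \<open>The alternative cannot be literal over every ring. If \<open>E\<close> is odd and k is a
  product of nonzero rings k1 and k2 with 2 invertible in k2, the measure that is \<alpha> in k1 and
  \<beta> in k2 is regular and is neither. Hence the two clauses: the plain alternative when 0 and 1
  are the only idempotents of k, and in general a combination weighted by an idempotent. The
  obstacle is that the measure lives on abstract atoms, while every relation used comes from a
  square in \<open>E\<close>. The bridge is that every map from \<open>B Y\<close> to
  \<open>B X\<close> comes from a surjection of Y onto X, and that every decomposition of a fiber
  product into atoms comes from subobjects. Both rest on one fact: a non-injective surjection W -> Y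
  identifies two distinct maps from the pro-object to W. To compare X with its set of orbits,
  several indexed copies of each are put side by side (\<open>blow\<close>), and squares are formed
  in which no index carries X on both sides. The second term and the ratio of the progression are a
  priori two unknowns, which is why two doublings are needed: together they force the two to be
  equal.\<close>

definition is_gset :: "('g, 'm) monoid_scheme \<Rightarrow> ('g, 'x) gset \<Rightarrow> bool" where
  "is_gset G X \<longleftrightarrow> group_action G (pts X) (act X)"

abbreviation orb :: "('g, 'm) monoid_scheme \<Rightarrow> ('g, 'x) gset \<Rightarrow> 'x \<Rightarrow> 'x set" where
  "orb G X \<equiv> orbit G (act X)"

definition orbs :: "('g, 'm) monoid_scheme \<Rightarrow> ('g, 'x) gset \<Rightarrow> 'x set set" where
  "orbs G X = orb G X ` pts X"

definition invariant_set :: "('g, 'm) monoid_scheme \<Rightarrow> ('g, 'x) gset \<Rightarrow> 'x set \<Rightarrow> bool" where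
  "invariant_set G X A \<longleftrightarrow> A \<subseteq> pts X \<and> (\<forall>g\<in>carrier G. \<forall>x\<in>A. act X g x \<in> A)"

lemma orbits_eq_orbs: "orbits G (pts X) (act X) = orbs G X"
  by (auto simp: orbs_def orbits_def)

lemma rho_eq_card: "rho G X = card (orbs G X)"
  by (simp add: rho_def orbits_eq_orbs)

lemma finitary_smooth_iff: "finitary_smooth G T X \<longleftrightarrow>
  is_gset G X \<and> (\<forall>x\<in>pts X. openin T (stabilizer G (act X) x)) \<and> finite (orbs G X)"
  by (simp add: finitary_smooth_def is_gset_def orbits_eq_orbs)

lemma is_gset_group: "is_gset G X \<Longrightarrow> group G"
  by (simp add: is_gset_def group_action_def group_hom_def)

lemma act_closed: "is_gset G X \<Longrightarrow> g \<in> carrier G \<Longrightarrow> x \<in> pts X \<Longrightarrow> act X g x \<in> pts X"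
  unfolding is_gset_def by (meson group_action.element_image)

lemma act_one: "is_gset G X \<Longrightarrow> x \<in> pts X \<Longrightarrow> act X \<one>\<^bsub>G\<^esub> x = x"
  unfolding is_gset_def by (metis group_action.id_eq_one restrict_apply')

lemma act_mult: "is_gset G X \<Longrightarrow> x \<in> pts X \<Longrightarrow> g \<in> carrier G \<Longrightarrow> h \<in> carrier G \<Longrightarrow>
  act X (g \<otimes>\<^bsub>G\<^esub> h) x = act X g (act X h x)"
  unfolding is_gset_def by (rule group_action.composition_rule)

lemma act_inv_act: "is_gset G X \<Longrightarrow> x \<in> pts X \<Longrightarrow> g \<in> carrier G \<Longrightarrow>
  act X (inv\<^bsub>G\<^esub> g) (act X g x) = x"
  unfolding is_gset_def by (rule group_action.orbit_sym_aux) auto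

lemma act_act_inv: "is_gset G X \<Longrightarrow> x \<in> pts X \<Longrightarrow> g \<in> carrier G \<Longrightarrow>
  act X g (act X (inv\<^bsub>G\<^esub> g) x) = x"
  by (metis act_inv_act group.inv_closed group.inv_inv is_gset_group)

text \<open>Acting by g and by its inverse are mutually inverse, so closure, unit and
  multiplicativity already give the bijections that \<open>group_action\<close> asks for;
  extensionality is what places them in \<open>BijGroup\<close>.\<close>

lemma is_gsetI:
  assumes "group G"
    and cl: "\<And>g x. g \<in> carrier G \<Longrightarrow> x \<in> pts X \<Longrightarrow> act X g x \<in> pts X"
    and ext: "\<And>g. g \<in> carrier G \<Longrightarrow> act X g \<in> extensional (pts X)"
    and one: "\<And>x. x \<in> pts X \<Longrightarrow> act X \<one>\<^bsub>G\<^esub> x = x"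
    and mult: "\<And>g h x. g \<in> carrier G \<Longrightarrow> h \<in> carrier G \<Longrightarrow> x \<in> pts X \<Longrightarrow>
      act X (g \<otimes>\<^bsub>G\<^esub> h) x = act X g (act X h x)"
  shows "is_gset G X"
proof -
  interpret group G by fact
  have inv1: "act X (inv\<^bsub>G\<^esub> g) (act X g x) = x" if "g \<in> carrier G" "x \<in> pts X" for g x
    using that mult[of "inv\<^bsub>G\<^esub> g" g x] one by simp
  have inv2: "act X g (act X (inv\<^bsub>G\<^esub> g) x) = x" if "g \<in> carrier G" "x \<in> pts X" for g x
    using that mult[of g "inv\<^bsub>G\<^esub> g" x] one by simp
  have bij: "act X g \<in> Bij (pts X)" if "g \<in> carrier G" for g
  proof -
    have "bij_betw (act X g) (pts X) (pts X)"
      by (rule bij_betw_byWitness[where f' = "act X (inv\<^bsub>G\<^esub> g)"])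
        (use that inv1 inv2 cl in auto)
    then show ?thesis
      using ext that by (simp add: Bij_def)
  qed
  have "act X (g \<otimes>\<^bsub>G\<^esub> h) = compose (pts X) (act X g) (act X h)"
    if "g \<in> carrier G" "h \<in> carrier G" for g h
    using that mult ext by (intro extensionalityI[of _ "pts X"]) (auto simp: compose_eq)
  then have "act X \<in> hom G (BijGroup (pts X))"
    using bij by (auto simp: hom_def BijGroup_def)
  then show ?thesis
    by (simp add: is_gset_def group_action_def group_hom_def group_hom_axioms_def group_BijGroup assms(1))
qed

section \<open>Orbits and invariant subsets\<close>

lemma orb_refl: "is_gset G X \<Longrightarrow> x \<in> pts X \<Longrightarrow> x \<in> orb G X x"
  unfolding is_gset_def by (rule group_action.orbit_refl)

lemma orb_subset: "is_gset G X \<Longrightarrow> x \<in> pts X \<Longrightarrow> orb G X x \<subseteq> pts X"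
  by (auto simp: orbit_def act_closed)

lemma orb_act:
  assumes X: "is_gset G X" and x: "x \<in> pts X" and g: "g \<in> carrier G"
  shows "orb G X (act X g x) = orb G X x"
proof -
  interpret group G using X by (rule is_gset_group)
  have "act X h x \<in> orb G X (act X g x)" if h: "h \<in> carrier G" for h
  proof -
    have "act X h x = act X (h \<otimes>\<^bsub>G\<^esub> inv\<^bsub>G\<^esub> g) (act X g x)"
      using x g h X by (simp add: act_mult act_closed act_inv_act)
    then show ?thesis
      using g h by (auto simp: orbit_def)
  qed
  moreover have "act X h (act X g x) \<in> orb G X x" if h: "h \<in> carrier G" for h
  proof -
    have "act X h (act X g x) = act X (h \<otimes>\<^bsub>G\<^esub> g) x"
      using x g h X by (simp add: act_mult)
    then show ?thesis
      using g h by (auto simp: orbit_def)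
  qed
  ultimately show ?thesis
    by (auto simp: orbit_def)
qed

lemma orb_eqI: "is_gset G X \<Longrightarrow> x \<in> pts X \<Longrightarrow> y \<in> orb G X x \<Longrightarrow> orb G X y = orb G X x"
  by (subst (asm) orbit_def) (auto simp: orb_act)

lemma orb_eq_iff:
  assumes "is_gset G X" "x \<in> pts X" "y \<in> pts X"
  shows "orb G X x = orb G X y \<longleftrightarrow> (\<exists>g\<in>carrier G. y = act X g x)"
proof
  assume "orb G X x = orb G X y"
  then have "y \<in> orb G X x"
    using assms orb_refl by metis
  then show "\<exists>g\<in>carrier G. y = act X g x"
    by (auto simp: orbit_def)
next
  assume "\<exists>g\<in>carrier G. y = act X g x"
  then show "orb G X x = orb G X y"
    using assms by (auto simp: orb_act)
qed

lemma orbs_mem_eq: "is_gset G X \<Longrightarrow> A \<in> orbs G X \<Longrightarrow> x \<in> A \<Longrightarrow> x \<in> pts X \<and> A = orb G X x"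
  unfolding orbs_def using orb_eqI[of G X] orb_subset[of G X] by blast

lemma orb_in_orbs: "x \<in> pts X \<Longrightarrow> orb G X x \<in> orbs G X"
  by (auto simp: orbs_def)

lemma Union_orbs: "is_gset G X \<Longrightarrow> \<Union>(orbs G X) = pts X"
  unfolding orbs_def using orb_refl orb_subset by fast

lemma invariant_orbs_Union: "is_gset G X \<Longrightarrow> Q \<subseteq> orbs G X \<Longrightarrow> invariant_set G X (\<Union>Q)"
  unfolding invariant_set_def
proof (intro conjI ballI)
  assume X: "is_gset G X" and Q: "Q \<subseteq> orbs G X"
  show "\<Union>Q \<subseteq> pts X"
    using Union_orbs[OF X] Q by blast
  fix g x assume g: "g \<in> carrier G" and "x \<in> \<Union>Q"
  then obtain A where A: "A \<in> Q" "x \<in> A"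
    by blast
  then have "x \<in> pts X" "A = orb G X x"
    using orbs_mem_eq[OF X] Q by blast+
  then show "act X g x \<in> \<Union>Q"
    using A(1) g by (intro UnionI[of A]) (auto simp: orbit_def)
qed

lemma invariant_orb_subset: "invariant_set G X A \<Longrightarrow> x \<in> A \<Longrightarrow> orb G X x \<subseteq> A"
  by (auto simp: invariant_set_def orbit_def)

section \<open>Morphisms\<close>

lemma gmaps_mem: "f \<in> gmaps G X Y \<Longrightarrow> x \<in> pts X \<Longrightarrow> f x \<in> pts Y"
  by (auto simp: gmaps_def)

lemma gmaps_act: "f \<in> gmaps G X Y \<Longrightarrow> g \<in> carrier G \<Longrightarrow> x \<in> pts X \<Longrightarrow>
  f (act X g x) = act Y g (f x)"
  by (auto simp: gmaps_def)

lemma gmaps_ext: "f \<in> gmaps G X Y \<Longrightarrow> f \<in> extensional (pts X)"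
  by (auto simp: gmaps_def PiE_def)

lemma gmaps_eqI: "f \<in> gmaps G X Y \<Longrightarrow> h \<in> gmaps G X Z \<Longrightarrow> (\<And>x. x \<in> pts X \<Longrightarrow> f x = h x) \<Longrightarrow> f = h"
  by (meson extensionalityI gmaps_ext)

lemma gmapsI:
  assumes "is_gset G X" "\<And>x. x \<in> pts X \<Longrightarrow> f x \<in> pts Y"
    "\<And>g x. g \<in> carrier G \<Longrightarrow> x \<in> pts X \<Longrightarrow> f (act X g x) = act Y g (f x)"
  shows "restrict f (pts X) \<in> gmaps G X Y"
  using assms by (auto simp: gmaps_def act_closed)

lemma gmaps_compose:
  "is_gset G X \<Longrightarrow> f \<in> gmaps G X Y \<Longrightarrow> h \<in> gmaps G Y Z \<Longrightarrow> compose (pts X) h f \<in> gmaps G X Z"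
  unfolding compose_def by (rule gmapsI) (auto simp: gmaps_mem gmaps_act)

lemma surj_gmaps_gmaps: "f \<in> surj_gmaps G X Y \<Longrightarrow> f \<in> gmaps G X Y"
  by (auto simp: surj_gmaps_def)

lemma surj_gmaps_image: "f \<in> surj_gmaps G X Y \<Longrightarrow> f ` pts X = pts Y"
  by (auto simp: surj_gmaps_def)

lemma surj_gmaps_compose:
  "is_gset G X \<Longrightarrow> f \<in> surj_gmaps G X Y \<Longrightarrow> h \<in> surj_gmaps G Y Z \<Longrightarrow>
    compose (pts X) h f \<in> surj_gmaps G X Z"
  using gmaps_compose[of G X f Y h Z] by (simp add: surj_gmaps_def surj_compose)

lemma id_surj_gmaps: "is_gset G X \<Longrightarrow> (\<lambda>x\<in>pts X. x) \<in> surj_gmaps G X X"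
  by (auto simp: surj_gmaps_def gmaps_def act_closed)

lemma gisos_surj_gmaps: "f \<in> gisos G X Y \<Longrightarrow> f \<in> surj_gmaps G X Y"
  by (auto simp: gisos_def surj_gmaps_def bij_betw_def)

lemma gisos_gmaps: "f \<in> gisos G X Y \<Longrightarrow> f \<in> gmaps G X Y"
  by (auto simp: gisos_def)

lemma gisos_bij: "f \<in> gisos G X Y \<Longrightarrow> bij_betw f (pts X) (pts Y)"
  by (auto simp: gisos_def)

lemma gisosI: "f \<in> surj_gmaps G X Y \<Longrightarrow> inj_on f (pts X) \<Longrightarrow> f \<in> gisos G X Y"
  by (auto simp: gisos_def surj_gmaps_def bij_betw_def)

lemma id_gisos: "is_gset G X \<Longrightarrow> (\<lambda>x\<in>pts X. x) \<in> gisos G X X"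
  by (rule gisosI[OF id_surj_gmaps]) (auto simp: inj_on_def)

lemma gisos_compose:
  "is_gset G X \<Longrightarrow> f \<in> gisos G X Y \<Longrightarrow> h \<in> gisos G Y Z \<Longrightarrow> compose (pts X) h f \<in> gisos G X Z"
  using gmaps_compose[of G X f Y h Z] by (auto simp: gisos_def intro: bij_betw_compose)

lemma gisos_inv:
  assumes X: "is_gset G X" and Y: "is_gset G Y" and f: "f \<in> gisos G X Y"
  shows "restrict (inv_into (pts X) f) (pts Y) \<in> gisos G Y X"
proof -
  have b: "bij_betw f (pts X) (pts Y)" and m: "f \<in> gmaps G X Y"
    using f by (auto simp: gisos_def)
  have "restrict (inv_into (pts X) f) (pts Y) \<in> gmaps G Y X"
  proof (rule gmapsI[OF Y])
    show "inv_into (pts X) f y \<in> pts X" if "y \<in> pts Y" for y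
      using that b by (metis bij_betw_def inv_into_into)
    show "inv_into (pts X) f (act Y g y) = act X g (inv_into (pts X) f y)"
      if g: "g \<in> carrier G" and y: "y \<in> pts Y" for g y
    proof -
      obtain x where x: "x \<in> pts X" "y = f x"
        using b y by (auto simp: bij_betw_def)
      have "act Y g y = f (act X g x)"
        using x g m by (simp add: gmaps_act)
      then show ?thesis
        using b x g X by (simp add: bij_betw_inv_into_left act_closed)
    qed
  qed
  moreover have "bij_betw (restrict (inv_into (pts X) f) (pts Y)) (pts Y) (pts X)"
    using bij_betw_inv_into[OF b] by simp
  ultimately show ?thesis
    by (simp add: gisos_def)
qed

lemma gset_iso_refl: "is_gset G X \<Longrightarrow> gset_iso G X X"
  using id_gisos by (auto simp: gset_iso_def)

lemma gset_iso_sym: "is_gset G X \<Longrightarrow> is_gset G Y \<Longrightarrow> gset_iso G X Y \<Longrightarrow> gset_iso G Y X"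
  using gisos_inv by (fastforce simp: gset_iso_def)

lemma gset_iso_trans: "is_gset G X \<Longrightarrow> gset_iso G X Y \<Longrightarrow> gset_iso G Y Z \<Longrightarrow> gset_iso G X Z"
  using gisos_compose by (fastforce simp: gset_iso_def)

section \<open>Effect of morphisms on orbits and stabilizers\<close>

lemma gmaps_orb: "f \<in> gmaps G X Y \<Longrightarrow> x \<in> pts X \<Longrightarrow> f ` orb G X x = orb G Y (f x)"
  unfolding orbit_def by (force simp: gmaps_act image_iff)

lemma surj_gmaps_orbs: "f \<in> surj_gmaps G X Y \<Longrightarrow> orbs G Y = (`) f ` orbs G X"
proof -
  assume f: "f \<in> surj_gmaps G X Y"
  have "orbs G Y = (\<lambda>x. orb G Y (f x)) ` pts X"
    unfolding orbs_def surj_gmaps_image[OF f, symmetric] by (simp add: image_image)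
  also have "\<dots> = (\<lambda>x. f ` orb G X x) ` pts X"
    using gmaps_orb[OF surj_gmaps_gmaps[OF f]] by (auto intro!: image_cong)
  finally show ?thesis
    by (simp add: orbs_def image_image)
qed

lemma rho_surj_le: "f \<in> surj_gmaps G X Y \<Longrightarrow> finite (orbs G X) \<Longrightarrow> rho G Y \<le> rho G X"
  by (simp add: rho_eq_card surj_gmaps_orbs card_image_le)

lemma gset_iso_rho:
  assumes X: "is_gset G X" and "gset_iso G X Y" shows "rho G X = rho G Y"
proof -
  obtain f where f: "f \<in> gisos G X Y"
    using assms by (auto simp: gset_iso_def)
  have "inj_on ((`) f) (orbs G X)"
    by (rule inj_on_image) (simp add: Union_orbs[OF X] bij_betw_imp_inj_on[OF gisos_bij[OF f]])
  then show ?thesis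
    by (simp add: rho_eq_card surj_gmaps_orbs[OF gisos_surj_gmaps[OF f]] card_image)
qed

lemma gset_iso_finite_orbs: "gset_iso G X Y \<Longrightarrow> finite (orbs G X) \<Longrightarrow> finite (orbs G Y)"
  using surj_gmaps_orbs gisos_surj_gmaps by (fastforce simp: gset_iso_def)

lemma gisos_stabilizer:
  assumes "is_gset G X" "f \<in> gisos G X Y" "x \<in> pts X"
  shows "stabilizer G (act Y) (f x) = stabilizer G (act X) x"
  using assms gisos_bij[OF assms(2)]
  by (auto simp: stabilizer_def gmaps_act[OF gisos_gmaps, symmetric] act_closed bij_betw_def
      inj_on_eq_iff)

lemma finitary_smooth_gset: "finitary_smooth G T X \<Longrightarrow> is_gset G X"
  by (simp add: finitary_smooth_iff)

lemma finitary_smooth_finite: "finitary_smooth G T X \<Longrightarrow> finite (orbs G X)"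
  by (simp add: finitary_smooth_iff)

lemma finitary_smooth_iso:
  assumes X: "finitary_smooth G T X" and Y: "is_gset G Y" and "gset_iso G X Y"
  shows "finitary_smooth G T Y"
proof -
  obtain f where f: "f \<in> gisos G X Y"
    using assms by (auto simp: gset_iso_def)
  have "openin T (stabilizer G (act Y) y)" if y: "y \<in> pts Y" for y
  proof -
    obtain x where "x \<in> pts X" "y = f x"
      using gisos_bij[OF f] y by (auto simp: bij_betw_def)
    then show ?thesis
      using X f gisos_stabilizer[of G X f Y x] by (auto simp: finitary_smooth_iff)
  qed
  then show ?thesis
    using assms gset_iso_finite_orbs by (auto simp: finitary_smooth_iff)
qed

section \<open>Constructions\<close>

lemma pts_sub_gset [simp]: "pts (sub_gset X A) = A"
  by (simp add: sub_gset_def)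

lemma act_sub_gset [simp]: "x \<in> A \<Longrightarrow> act (sub_gset X A) g x = act X g x"
  by (simp add: sub_gset_def)

lemma pts_prod_gset [simp]: "pts (prod_gset X Y) = pts X \<times> pts Y"
  by (simp add: prod_gset_def)

lemma act_prod_gset [simp]: "x \<in> pts X \<Longrightarrow> y \<in> pts Y \<Longrightarrow>
  act (prod_gset X Y) g (x, y) = (act X g x, act Y g y)"
  by (simp add: prod_gset_def)

lemma pts_coprod_gset [simp]: "pts (coprod_gset X Y) = pts X <+> pts Y"
  by (simp add: coprod_gset_def)

lemma act_coprod_gset [simp]:
  "x \<in> pts X \<Longrightarrow> act (coprod_gset X Y) g (Inl x) = Inl (act X g x)"
  "y \<in> pts Y \<Longrightarrow> act (coprod_gset X Y) g (Inr y) = Inr (act Y g y)"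
  by (auto simp: coprod_gset_def)

definition trivial_gset :: "'x set \<Rightarrow> ('g, 'x) gset" where
  "trivial_gset S = GSet S (\<lambda>g. \<lambda>x\<in>S. x)"

lemma pts_trivial_gset [simp]: "pts (trivial_gset S) = S"
  by (simp add: trivial_gset_def)

lemma act_trivial_gset [simp]: "x \<in> S \<Longrightarrow> act (trivial_gset S) g x = x"
  by (simp add: trivial_gset_def)

lemma is_gset_trivial: "group G \<Longrightarrow> is_gset G (trivial_gset S)"
  by (rule is_gsetI) (auto simp: trivial_gset_def)

lemma is_gset_sub:
  assumes X: "is_gset G X" and A: "invariant_set G X A"
  shows "is_gset G (sub_gset X A)"
proof -
  interpret group G using X by (rule is_gset_group)
  have *: "x \<in> pts X" "\<And>g. g \<in> carrier G \<Longrightarrow> act X g x \<in> A" if "x \<in> A" for x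
    using A that by (auto simp: invariant_set_def)
  show ?thesis
    by (rule is_gsetI) (use X * in \<open>auto simp: act_one act_mult sub_gset_def\<close>)
qed

lemma is_gset_prod:
  assumes X: "is_gset G X" and Y: "is_gset G Y"
  shows "is_gset G (prod_gset X Y)"
proof -
  interpret group G using X by (rule is_gset_group)
  show ?thesis
    by (rule is_gsetI) (use X Y in \<open>auto simp: act_one act_mult act_closed prod_gset_def\<close>)
qed

lemma is_gset_coprod:
  assumes X: "is_gset G X" and Y: "is_gset G Y"
  shows "is_gset G (coprod_gset X Y)"
proof -
  interpret group G using X by (rule is_gset_group)
  show ?thesis
    by (rule is_gsetI) (use X Y in \<open>auto simp: act_one act_mult act_closed coprod_gset_def\<close>)
qed

lemma orb_sub: "invariant_set G X A \<Longrightarrow> x \<in> A \<Longrightarrow> orb G (sub_gset X A) x = orb G X x"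
  by (auto simp: orbit_def)

lemma orbs_sub: "invariant_set G X A \<Longrightarrow> orbs G (sub_gset X A) = orb G X ` A"
  unfolding orbs_def by (auto simp: orb_sub)

lemma orbs_sub_subset: "invariant_set G X A \<Longrightarrow> orbs G (sub_gset X A) \<subseteq> orbs G X"
  by (simp add: orbs_sub) (auto simp: orbs_def invariant_set_def)

lemma finitary_smooth_sub:
  assumes X: "finitary_smooth G T X" and A: "invariant_set G X A"
  shows "finitary_smooth G T (sub_gset X A)"
proof -
  have "stabilizer G (act (sub_gset X A)) x = stabilizer G (act X) x" if "x \<in> A" for x
    using that by (auto simp: stabilizer_def)
  then show ?thesis
    using X A orbs_sub_subset[OF A] is_gset_sub[of G X A]
    by (auto simp: finitary_smooth_iff invariant_set_def finite_subset subset_eq)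
qed

lemma finitary_smooth_coprod:
  assumes X: "finitary_smooth G T X" and Y: "finitary_smooth G T Y"
  shows "finitary_smooth G T (coprod_gset X Y)"
proof -
  have s: "stabilizer G (act (coprod_gset X Y)) (Inl x) = stabilizer G (act X) x" if "x \<in> pts X" for x
    using that by (auto simp: stabilizer_def)
  have s': "stabilizer G (act (coprod_gset X Y)) (Inr y) = stabilizer G (act Y) y" if "y \<in> pts Y" for y
    using that by (auto simp: stabilizer_def)
  have o: "orb G (coprod_gset X Y) (Inl x) = Inl ` orb G X x" if "x \<in> pts X" for x
    using that by (auto simp: orbit_def)
  have o': "orb G (coprod_gset X Y) (Inr y) = Inr ` orb G Y y" if "y \<in> pts Y" for y
    using that by (auto simp: orbit_def)
  have "orbs G (coprod_gset X Y) \<subseteq> (`) Inl ` orbs G X \<union> (`) Inr ` orbs G Y"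
    by (auto simp: orbs_def o o')
  then have "finite (orbs G (coprod_gset X Y))"
    using finitary_smooth_finite[OF X] finitary_smooth_finite[OF Y] by (meson finite_UnI finite_imageI finite_subset)
  then show ?thesis
    using X Y by (auto simp: finitary_smooth_iff is_gset_coprod s s')
qed

lemma finitary_smooth_trivial:
  assumes "group G" "openin T (carrier G)" "finite S"
  shows "finitary_smooth G T (trivial_gset S)"
proof -
  have "stabilizer G (act (trivial_gset S)) x = carrier G" if "x \<in> S" for x
    using that by (auto simp: stabilizer_def)
  then show ?thesis
    using assms by (auto simp: finitary_smooth_iff is_gset_trivial orbs_def)
qed

text \<open>Transport of structure along an injection; its purpose is to move a G-set to another
  point type.\<close>

lemma gset_transport:
  fixes X :: "('g, 'x) gset" and \<psi> :: "'x \<Rightarrow> 'y"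
  assumes X: "is_gset G X" and inj: "inj_on \<psi> (pts X)"
  shows "\<exists>Z::('g, 'y) gset. is_gset G Z \<and> gset_iso G Z X"
proof -
  interpret group G using X by (rule is_gset_group)
  define Z where
    "Z = GSet (\<psi> ` pts X) (\<lambda>g. \<lambda>z\<in>\<psi> ` pts X. \<psi> (act X g (inv_into (pts X) \<psi> z)))"
  have a: "act Z g (\<psi> x) = \<psi> (act X g x)" if "x \<in> pts X" for g x
    using that inj by (simp add: Z_def)
  have p: "pts Z = \<psi> ` pts X"
    by (simp add: Z_def)
  have Z: "is_gset G Z"
  proof (rule is_gsetI)
    show "act Z g \<in> extensional (pts Z)" for g
      by (simp add: Z_def)
  qed (use X in \<open>auto simp: p a act_closed act_one act_mult\<close>)
  have "restrict \<psi> (pts X) \<in> gmaps G X Z"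
    by (rule gmapsI[OF X]) (auto simp: p a)
  then have "restrict \<psi> (pts X) \<in> gisos G X Z"
    using inj by (auto simp: gisos_def p bij_betw_def inj_on_def)
  then show ?thesis
    using gset_iso_sym[OF X Z] Z unfolding gset_iso_def by blast
qed

text \<open>A point x is coded by a number for its orbit and by the coset of group elements that
  carry the base point of the orbit to x. Finiteness of the set of orbits allows the numbering, and
  the coset, being nonempty, determines x. This code lives in \<open>'g univ\<close>.\<close>

lemma SG_representative:
  fixes X :: "('g, 'x) gset"
  assumes X: "finitary_smooth G T X"
  shows "\<exists>Z\<in>SG G T. gset_iso G Z X"
proof -
  have gX: "is_gset G X"
    using X by (rule finitary_smooth_gset)
  obtain n :: "'x set \<Rightarrow> nat" where n: "inj_on n (orbs G X)"
    using finite_imp_inj_to_nat_seg[OF finitary_smooth_finite[OF X]] by blast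
  define c where "c A = (SOME x. x \<in> A)" for A :: "'x set"
  define \<psi> where "\<psi> x = (n (orb G X x), {g \<in> carrier G. act X g (c (orb G X x)) = x})" for x
  have c: "\<exists>g\<in>carrier G. act X g (c (orb G X x)) = x" if x: "x \<in> pts X" for x
  proof -
    have "c (orb G X x) \<in> orb G X x"
      unfolding c_def using orb_refl[OF gX x] by (rule someI)
    then show ?thesis
      using x orb_eqI[OF gX x] orb_subset[OF gX x] orb_eq_iff[OF gX _ x, of "c (orb G X x)"]
      by (metis subsetD)
  qed
  have "inj_on \<psi> (pts X)"
  proof (rule inj_onI)
    fix x y assume x: "x \<in> pts X" and y: "y \<in> pts X" and e: "\<psi> x = \<psi> y"
    have "orb G X x = orb G X y"
      using n e x y by (auto simp: \<psi>_def orb_in_orbs inj_on_eq_iff)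
    moreover obtain g where "g \<in> carrier G" "act X g (c (orb G X x)) = x"
      using c[OF x] by blast
    ultimately show "x = y"
      using e by (auto simp: \<psi>_def)
  qed
  then obtain Z :: "('g, 'g univ) gset" where Z: "is_gset G Z" "gset_iso G Z X"
    using gset_transport[OF gX] by blast
  then have "finitary_smooth G T Z"
    using finitary_smooth_iso[OF X Z(1)] gX gset_iso_sym by blast
  then show ?thesis
    using Z by (auto simp: SG_def)
qed

text \<open>The orbits inside a product of two orbits correspond to double cosets of the stabilizers
  of two base points x0 and y0, and a pro-oligomorphic group has finitely many of these. Running
  over the finitely many pairs of base points bounds all orbits of the product.\<close>

lemma finitary_smooth_prod:
  fixes X :: "('g, 'x) gset" and Y :: "('g, 'y) gset"
  assumes po: "pro_oligomorphic G T" and X: "finitary_smooth G T X" and Y: "finitary_smooth G T Y"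
  shows "finitary_smooth G T (prod_gset X Y)"
proof -
  have gX: "is_gset G X" and gY: "is_gset G Y"
    using X Y by (auto simp: finitary_smooth_gset)
  interpret group G using gX by (rule is_gset_group)
  have gXY: "is_gset G (prod_gset X Y)"
    by (rule is_gset_prod[OF gX gY])
  have st: "stabilizer G (act (prod_gset X Y)) (x, y) =
      stabilizer G (act X) x \<inter> stabilizer G (act Y) y" if "x \<in> pts X" "y \<in> pts Y" for x y
    using that by (auto simp: stabilizer_def)
  define c where "c A = (SOME x. x \<in> A)" for A :: "'x set"
  define d where "d A = (SOME x. x \<in> A)" for A :: "'y set"
  define dc where "dc x y k = (stabilizer G (act X) x #>\<^bsub>G\<^esub> k) <#>\<^bsub>G\<^esub> stabilizer G (act Y) y"
    for x y k
  have fin: "finite {dc x y k | k. k \<in> carrier G}" if "x \<in> pts X" "y \<in> pts Y" for x y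
  proof -
    have "open_subgroup G T (stabilizer G (act X) x)" "open_subgroup G T (stabilizer G (act Y) y)"
      using that X Y by (auto simp: open_subgroup_def finitary_smooth_iff is_gset_def group_action.stabilizer_subgroup)
    then show ?thesis
      using po unfolding pro_oligomorphic_def dc_def by blast
  qed
  \<comment> \<open>The orbit attached to a double coset is read off from an arbitrary element of
    it. The proof of \<open>mem\<close> shows that the choice is harmless: the left factor moves
    (x0, k y0) inside its orbit, and the right factor fixes y0.\<close>
  define F where "F x y D = orb G (prod_gset X Y) (x, act Y (SOME k. k \<in> D) y)" for x y D
  have mem: "\<exists>x0\<in>c ` orbs G X. \<exists>y0\<in>d ` orbs G Y. x0 \<in> pts X \<and> y0 \<in> pts Y \<and>
     orb G (prod_gset X Y) (x, y) \<in> F x0 y0 ` {dc x0 y0 k | k. k \<in> carrier G}"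
    if x: "x \<in> pts X" and y: "y \<in> pts Y" for x y
  proof -
    define x0 where "x0 = c (orb G X x)"
    define y0 where "y0 = d (orb G Y y)"
    have x0: "x0 \<in> orb G X x"
      unfolding x0_def c_def using orb_refl[OF gX x] by (rule someI)
    have y0: "y0 \<in> orb G Y y"
      unfolding y0_def d_def using orb_refl[OF gY y] by (rule someI)
    have x0p: "x0 \<in> pts X" and y0p: "y0 \<in> pts Y"
      using orb_subset[OF gX x] orb_subset[OF gY y] x0 y0 by auto
    obtain g where g: "g \<in> carrier G" "x = act X g x0"
      using orb_eqI[OF gX x x0] orb_eq_iff[OF gX x0p x] by metis
    obtain h where h: "h \<in> carrier G" "y = act Y h y0"
      using orb_eqI[OF gY y y0] orb_eq_iff[OF gY y0p y] by metis
    \<comment> \<open>Translating (x, y) by the inverse of g brings the first coordinate back to x0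
      and turns the second into k y0.\<close>
    define k where "k = inv\<^bsub>G\<^esub> g \<otimes>\<^bsub>G\<^esub> h"
    have k: "k \<in> carrier G"
      using g h by (simp add: k_def)
    have "act (prod_gset X Y) g (x0, act Y k y0) = (x, y)"
      using g h k x0p y0p gY by (simp add: k_def act_closed act_mult act_act_inv)
    then have o1: "orb G (prod_gset X Y) (x, y) = orb G (prod_gset X Y) (x0, act Y k y0)"
      using orb_act[OF gXY, of "(x0, act Y k y0)" g] g x0p y0p k gY by (simp add: act_closed)
    define k' where "k' = (SOME k'. k' \<in> dc x0 y0 k)"
    have st1: "\<one>\<^bsub>G\<^esub> \<in> stabilizer G (act X) x0" "\<one>\<^bsub>G\<^esub> \<in> stabilizer G (act Y) y0"
      using gX gY x0p y0p by (auto simp: stabilizer_def act_one)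
    have "k = \<one>\<^bsub>G\<^esub> \<otimes>\<^bsub>G\<^esub> k \<otimes>\<^bsub>G\<^esub> \<one>\<^bsub>G\<^esub>"
      using k by simp
    then have "k \<in> dc x0 y0 k"
      using st1 unfolding dc_def r_coset_def set_mult_def by blast
    then have "k' \<in> dc x0 y0 k"
      unfolding k'_def by (rule someI)
    then obtain u v where uv: "u \<in> stabilizer G (act X) x0" "v \<in> stabilizer G (act Y) y0"
      "k' = u \<otimes>\<^bsub>G\<^esub> k \<otimes>\<^bsub>G\<^esub> v"
      by (auto simp: dc_def r_coset_def set_mult_def)
    have uvc: "u \<in> carrier G" "v \<in> carrier G" "act X u x0 = x0" "act Y v y0 = y0"
      using uv by (auto simp: stabilizer_def)
    have "(x0, act Y k' y0) = act (prod_gset X Y) u (x0, act Y k y0)"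
      unfolding uv(3) using uvc(1,2) k x0p y0p gX gY by (simp add: act_mult act_closed uvc(3,4))
    then have "orb G (prod_gset X Y) (x0, act Y k' y0) = orb G (prod_gset X Y) (x0, act Y k y0)"
      using orb_act[OF gXY, of "(x0, act Y k y0)" u] uvc x0p y0p k gY by (simp add: act_closed)
    then have "orb G (prod_gset X Y) (x, y) = F x0 y0 (dc x0 y0 k)"
      using o1 by (simp add: F_def k'_def)
    then show ?thesis
      using x0p y0p k x y unfolding x0_def y0_def
      by (intro bexI[of _ "c (orb G X x)"] bexI[of _ "d (orb G Y y)"]) (auto simp: orb_in_orbs)
  qed
  let ?R = "\<Union>x0\<in>c ` orbs G X \<inter> pts X. \<Union>y0\<in>d ` orbs G Y \<inter> pts Y.
      F x0 y0 ` {dc x0 y0 k | k. k \<in> carrier G}"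
  have "orbs G (prod_gset X Y) \<subseteq> ?R"
  proof
    fix A assume "A \<in> orbs G (prod_gset X Y)"
    then obtain x y where xy: "x \<in> pts X" "y \<in> pts Y" "A = orb G (prod_gset X Y) (x, y)"
      by (auto simp: orbs_def)
    then show "A \<in> ?R"
      using mem[OF xy(1,2)] by blast
  qed
  moreover have "finite ?R"
    using finitary_smooth_finite[OF X] finitary_smooth_finite[OF Y] fin by auto
  ultimately have "finite (orbs G (prod_gset X Y))"
    by (rule finite_subset)
  then show ?thesis
    using X Y gXY by (auto simp: finitary_smooth_iff st)
qed

lemma prod_gisos:
  assumes Y: "is_gset G Y" and X': "is_gset G X'" and \<eta>: "\<eta> \<in> gisos G Y Y2" and \<zeta>: "\<zeta> \<in> gisos G X' X2"
  shows "restrict (map_prod \<eta> \<zeta>) (pts Y \<times> pts X') \<in> gisos G (prod_gset Y X') (prod_gset Y2 X2)"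
proof -
  have "restrict (map_prod \<eta> \<zeta>) (pts (prod_gset Y X')) \<in> gmaps G (prod_gset Y X') (prod_gset Y2 X2)"
    by (rule gmapsI[OF is_gset_prod[OF Y X']])
      (use gmaps_mem[OF gisos_gmaps[OF \<eta>]] gmaps_mem[OF gisos_gmaps[OF \<zeta>]]
        gmaps_act[OF gisos_gmaps[OF \<eta>]] gmaps_act[OF gisos_gmaps[OF \<zeta>]] in auto)
  then show ?thesis
    using bij_betw_map_prod[OF gisos_bij[OF \<eta>] gisos_bij[OF \<zeta>]] by (simp add: gisos_def)
qed

text \<open>A jointly injective pair identifies W with its image in the product, so the pair (f, h)
  factors through W by inverting (p, q) on that image. Equality of the two images makes the factor
  surjective.\<close>

lemma factor_through_pair:
  assumes V: "is_gset G V" and W: "is_gset G W"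
    and p: "p \<in> gmaps G W X" and q: "q \<in> gmaps G W Y" and inj: "inj_on (\<lambda>x. (p x, q x)) (pts W)"
    and f: "f \<in> gmaps G V X" and h: "h \<in> gmaps G V Y"
    and im: "(\<lambda>x. (p x, q x)) ` pts W = (\<lambda>x. (f x, h x)) ` pts V"
  obtains g where "g \<in> surj_gmaps G V W" "\<And>x. x \<in> pts V \<Longrightarrow> p (g x) = f x \<and> q (g x) = h x"
proof -
  define g where "g = (\<lambda>x\<in>pts V. inv_into (pts W) (\<lambda>x. (p x, q x)) (f x, h x))"
  have g: "g x \<in> pts W \<and> p (g x) = f x \<and> q (g x) = h x" if x: "x \<in> pts V" for x
  proof -
    have *: "(f x, h x) \<in> (\<lambda>x. (p x, q x)) ` pts W"
      unfolding im using x by (rule imageI)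
    show ?thesis
      using inv_into_into[OF *] f_inv_into_f[OF *] x unfolding g_def by simp
  qed
  have "g (act V a x) = act W a (g x)" if a: "a \<in> carrier G" and x: "x \<in> pts V" for a x
  proof (rule inj_onD[OF inj])
    have ax: "act V a x \<in> pts V"
      using act_closed[OF V a x] .
    show "(p (g (act V a x)), q (g (act V a x))) = (p (act W a (g x)), q (act W a (g x)))"
      using g[OF ax] g[OF x] gmaps_act[OF p a] gmaps_act[OF q a] gmaps_act[OF f a x] gmaps_act[OF h a x]
      by simp
    show "g (act V a x) \<in> pts W" "act W a (g x) \<in> pts W"
      using g[OF ax] g[OF x] act_closed[OF W a] by auto
  qed
  moreover have "restrict g (pts V) = g"
    by (simp add: g_def)
  ultimately have "g \<in> gmaps G V W"
    using gmapsI[OF V, of g W] g by simp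
  moreover have "y \<in> g ` pts V" if y: "y \<in> pts W" for y
  proof -
    have "(p y, q y) \<in> (\<lambda>x. (f x, h x)) ` pts V"
      unfolding im[symmetric] using y by (rule imageI)
    then obtain x where x: "x \<in> pts V" "p y = f x" "q y = h x"
      by auto
    then have "y = g x"
      using inj_onD[OF inj, of y "g x"] g[OF x(1)] y by simp
    then show ?thesis
      using x by simp
  qed
  ultimately have "g \<in> surj_gmaps G V W"
    using g by (auto simp: surj_gmaps_def)
  then show ?thesis
    using that g by blast
qed

section \<open>Objects of the order E\<close>

locale order_with_pro =
  fixes G :: "('g, 'm) monoid_scheme"
    and T :: "'g topology"
    and E :: "('g, 'g univ) gset set"
    and \<Omega> :: "('i, 'g, 'g univ) pro_obj"
  assumes pro_oligo: "pro_oligomorphic G T"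
    and order: "is_order G T E"
    and pro_object: "is_pro_object G E \<Omega>"
    and universal: "universal_pro G E \<Omega>"
    and homogeneous: "homogeneous_pro G E \<Omega>"
begin

lemma group_G: "group G"
  using pro_oligo by (simp add: pro_oligomorphic_def topological_grp_def)

lemma openin_carrier: "openin T (carrier G)"
  using pro_oligo openin_topspace[of T] by (simp add: pro_oligomorphic_def topological_grp_def)

text \<open>\<open>E\<close> only contains G-sets on the type \<open>'g univ\<close>, whereas
  products, coproducts and sets of orbits have other point types. This is the isomorphism closure of
  \<open>E\<close> over all point types, so that constructions need not be coded back each
  time.\<close>

definition inE :: "('g, 'x) gset \<Rightarrow> bool" where
  "inE X \<longleftrightarrow> is_gset G X \<and> (\<exists>Z\<in>E. gset_iso G Z X)"

lemma E_SG: "X \<in> E \<Longrightarrow> X \<in> SG G T"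
  using order[unfolded is_order_def, THEN conjunct1] by (rule subsetD)

lemmas order_closure = order[unfolded is_order_def, THEN conjunct2]

lemma E_singleton: "Z \<in> SG G T \<Longrightarrow> is_singleton (pts Z) \<Longrightarrow> Z \<in> E"
  using order_closure[THEN conjunct1] by blast

lemma E_prod: "X \<in> E \<Longrightarrow> Y \<in> E \<Longrightarrow> Z \<in> SG G T \<Longrightarrow> gset_iso G Z (prod_gset X Y) \<Longrightarrow> Z \<in> E"
  using order_closure[THEN conjunct2, THEN conjunct1] by blast

lemma E_empty: "Z \<in> SG G T \<Longrightarrow> pts Z = {} \<Longrightarrow> Z \<in> E"
  using order_closure[THEN conjunct2, THEN conjunct2, THEN conjunct1] by blast

lemma E_coprod: "X \<in> E \<Longrightarrow> Y \<in> E \<Longrightarrow> Z \<in> SG G T \<Longrightarrow> gset_iso G Z (coprod_gset X Y) \<Longrightarrow> Z \<in> E"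
  using order_closure[THEN conjunct2, THEN conjunct2, THEN conjunct2, THEN conjunct1] by blast

lemma E_subobject: "X \<in> E \<Longrightarrow> Y \<in> SG G T \<Longrightarrow> f \<in> gmaps G Y X \<Longrightarrow> inj_on f (pts Y) \<Longrightarrow> Y \<in> E"
  using order_closure[THEN conjunct2, THEN conjunct2, THEN conjunct2, THEN conjunct2, THEN conjunct1]
  by blast

lemma E_smooth: "X \<in> E \<Longrightarrow> finitary_smooth G T X"
  using E_SG by (auto simp: SG_def)

lemma E_gset: "X \<in> E \<Longrightarrow> is_gset G X"
  using E_smooth finitary_smooth_gset by blast

lemma inE_gset: "inE X \<Longrightarrow> is_gset G X"
  by (simp add: inE_def)

lemma inE_smooth: "inE X \<Longrightarrow> finitary_smooth G T X"
  unfolding inE_def using E_smooth finitary_smooth_iso by blast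

lemma inE_finite: "inE X \<Longrightarrow> finite (orbs G X)"
  using inE_smooth finitary_smooth_finite by blast

lemma E_inE: "X \<in> E \<Longrightarrow> inE X"
  using E_gset gset_iso_refl by (auto simp: inE_def)

lemma inE_iso: "inE X \<Longrightarrow> is_gset G Y \<Longrightarrow> gset_iso G X Y \<Longrightarrow> inE Y"
  unfolding inE_def using E_gset gset_iso_trans by blast

lemma inE_rep: "inE X \<Longrightarrow> \<exists>Z\<in>E. \<exists>\<phi>. \<phi> \<in> gisos G Z X"
  by (auto simp: inE_def gset_iso_def)

text \<open>An isomorphism is an embedding, so closure under subobjects makes \<open>E\<close>
  closed under isomorphism on its own point type.\<close>

lemma inE_E:
  assumes "inE X" shows "X \<in> E"
proof -
  obtain Z where Z: "Z \<in> E" "gset_iso G Z X"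
    using assms by (auto simp: inE_def)
  obtain f where f: "f \<in> gisos G X Z"
    using gset_iso_sym[OF E_gset[OF Z(1)] inE_gset[OF assms] Z(2)] by (auto simp: gset_iso_def)
  show ?thesis
    using E_subobject[OF Z(1) _ gisos_gmaps[OF f]] inE_smooth[OF assms] gisos_bij[OF f]
    by (auto simp: SG_def bij_betw_def)
qed

text \<open>The subobject axiom speaks of \<open>'g univ\<close> only. Both G-sets are replaced by
  representatives there, and the embedding is conjugated by the isomorphisms.\<close>

lemma inE_embed:
  assumes X: "inE X" and Y: "finitary_smooth G T Y"
    and f: "f \<in> gmaps G Y X" "inj_on f (pts Y)"
  shows "inE Y"
proof -
  have gY: "is_gset G Y" and gX: "is_gset G X"
    using X Y by (auto simp: finitary_smooth_gset inE_gset)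
  obtain X0 where X0: "X0 \<in> E" "gset_iso G X0 X"
    using X by (auto simp: inE_def)
  obtain \<phi> where \<phi>: "\<phi> \<in> gisos G X X0"
    using gset_iso_sym[OF E_gset[OF X0(1)] gX X0(2)] by (auto simp: gset_iso_def)
  obtain Y0 \<psi> where Y0: "Y0 \<in> SG G T" "\<psi> \<in> gisos G Y0 Y"
    using SG_representative[OF Y] by (auto simp: gset_iso_def)
  have gY0: "is_gset G Y0"
    using Y0 by (simp add: SG_def finitary_smooth_gset)
  let ?h = "compose (pts Y0) (compose (pts Y) \<phi> f) \<psi>"
  have "?h \<in> gmaps G Y0 X0"
    using Y0 \<phi> f gY0 gY by (meson gisos_gmaps gmaps_compose)
  moreover have "inj_on ?h (pts Y0)"
    by (rule inj_on_compose[OF gisos_bij[OF Y0(2)]], rule inj_onI)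
      (metis bij_betw_def compose_eq f gisos_bij[OF \<phi>] gmaps_mem inj_on_eq_iff)
  ultimately have "Y0 \<in> E"
    using E_subobject X0 Y0 by blast
  then show ?thesis
    using gY Y0 by (auto simp: inE_def gset_iso_def)
qed

lemma inE_sub:
  assumes X: "inE X" and A: "invariant_set G X A"
  shows "inE (sub_gset X A)"
proof (rule inE_embed[OF X])
  show fs: "finitary_smooth G T (sub_gset X A)"
    using X A by (simp add: finitary_smooth_sub inE_smooth)
  have "restrict (\<lambda>x. x) (pts (sub_gset X A)) \<in> gmaps G (sub_gset X A) X"
    by (rule gmapsI) (use fs A finitary_smooth_gset in \<open>auto simp: invariant_set_def\<close>)
  then show "(\<lambda>x\<in>A. x) \<in> gmaps G (sub_gset X A) X"
    by simp
qed (auto simp: inj_on_def)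

lemma gset_iso_coprod:
  assumes X: "is_gset G X" and Y: "is_gset G Y" and "gset_iso G X X'" "gset_iso G Y Y'"
  shows "gset_iso G (coprod_gset X Y) (coprod_gset X' Y')"
proof -
  obtain f h where f: "f \<in> gisos G X X'" and h: "h \<in> gisos G Y Y'"
    using assms by (auto simp: gset_iso_def)
  have "restrict (map_sum f h) (pts (coprod_gset X Y)) \<in> gmaps G (coprod_gset X Y) (coprod_gset X' Y')"
    by (rule gmapsI[OF is_gset_coprod[OF X Y]])
      (use f h X Y gmaps_mem[OF gisos_gmaps[OF f]] gmaps_mem[OF gisos_gmaps[OF h]]
        gmaps_act[OF gisos_gmaps[OF f]] gmaps_act[OF gisos_gmaps[OF h]] in auto)
  moreover have "bij_betw (map_sum f h) (pts X <+> pts Y) (pts X' <+> pts Y')"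
  proof -
    have "inj_on (map_sum f h) (pts X <+> pts Y)"
      using bij_betw_imp_inj_on[OF gisos_bij[OF f]] bij_betw_imp_inj_on[OF gisos_bij[OF h]]
      by (intro inj_onI) (auto simp: inj_on_eq_iff elim!: PlusE)
    moreover have "map_sum f h ` (pts X <+> pts Y) = f ` pts X <+> h ` pts Y"
      by (auto simp: Plus_def image_Un image_image)
    ultimately show ?thesis
      using gisos_bij[OF f] gisos_bij[OF h] by (auto simp: bij_betw_def)
  qed
  ultimately show ?thesis
    by (auto simp: gset_iso_def gisos_def)
qed

lemma inE_prod:
  assumes X: "inE X" and Y: "inE Y"
  shows "inE (prod_gset X Y)"
proof -
  have gX: "is_gset G X" and gY: "is_gset G Y"
    using X Y by (auto simp: inE_gset)
  obtain X0 \<phi> where X0: "X0 \<in> E" "\<phi> \<in> gisos G X X0"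
    using X gX E_gset gset_iso_sym unfolding inE_def gset_iso_def by blast
  obtain Y0 \<psi> where Y0: "Y0 \<in> E" "\<psi> \<in> gisos G Y Y0"
    using Y gY E_gset gset_iso_sym unfolding inE_def gset_iso_def by blast
  obtain Z where Z: "Z \<in> SG G T" "gset_iso G Z (prod_gset X Y)"
    using SG_representative[OF finitary_smooth_prod[OF pro_oligo inE_smooth[OF X] inE_smooth[OF Y]]]
    by blast
  then have "gset_iso G Z (prod_gset X0 Y0)"
    using gset_iso_trans[of G Z] prod_gisos[OF gX gY X0(2) Y0(2)] finitary_smooth_gset[of G T Z]
    unfolding SG_def gset_iso_def by blast
  then have "Z \<in> E"
    using E_prod[OF X0(1) Y0(1) Z(1)] by blast
  then show ?thesis
    using Z is_gset_prod[OF gX gY] by (auto simp: inE_def)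
qed

lemma inE_coprod:
  assumes X: "inE X" and Y: "inE Y"
  shows "inE (coprod_gset X Y)"
proof -
  have gX: "is_gset G X" and gY: "is_gset G Y"
    using X Y by (auto simp: inE_gset)
  obtain X0 where X0: "X0 \<in> E" "gset_iso G X X0"
    using X gX E_gset gset_iso_sym unfolding inE_def by metis
  obtain Y0 where Y0: "Y0 \<in> E" "gset_iso G Y Y0"
    using Y gY E_gset gset_iso_sym unfolding inE_def by metis
  obtain Z where Z: "Z \<in> SG G T" "gset_iso G Z (coprod_gset X Y)"
    using SG_representative[OF finitary_smooth_coprod[OF inE_smooth[OF X] inE_smooth[OF Y]]]
    by blast
  then have "gset_iso G Z (coprod_gset X0 Y0)"
    using gset_iso_trans[of G Z] gset_iso_coprod[OF gX gY X0(2) Y0(2)] finitary_smooth_gset[of G T Z]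
    unfolding SG_def by blast
  then have "Z \<in> E"
    using E_coprod[OF X0(1) Y0(1) Z(1)] by blast
  then show ?thesis
    using Z is_gset_coprod[OF gX gY] by (auto simp: inE_def)
qed

lemma trivial_iso:
  assumes "bij_betw f S S'"
  shows "gset_iso G (trivial_gset S) (trivial_gset S')"
proof -
  have "restrict f (pts (trivial_gset S :: ('g, 'a) gset)) \<in> gmaps G (trivial_gset S) (trivial_gset S')"
    by (rule gmapsI) (use assms is_gset_trivial[OF group_G] in \<open>auto simp: bij_betw_def\<close>)
  then show ?thesis
    using assms by (auto simp: gset_iso_def gisos_def)
qed

text \<open>Adding a point is a coproduct with a one-point set, so induction starts from the nullary
  axioms of an order.\<close>

lemma inE_trivial:
  assumes "finite S" shows "inE (trivial_gset S)"
  using assms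
proof (induction S)
  case empty
  obtain Z :: "('g, 'g univ) gset" where Z: "Z \<in> SG G T" "gset_iso G Z (trivial_gset ({}::'a set))"
    using SG_representative[OF finitary_smooth_trivial[OF group_G openin_carrier, of "{}"]] by auto
  then have "pts Z = {}"
    by (auto simp: gset_iso_def gisos_def bij_betw_def)
  then have "Z \<in> E"
    using E_empty Z by blast
  then show ?case
    using Z is_gset_trivial[OF group_G] by (auto simp: inE_def)
next
  case (insert x S)
  obtain Z :: "('g, 'g univ) gset" where Z: "Z \<in> SG G T" "gset_iso G Z (trivial_gset {x})"
    using SG_representative[OF finitary_smooth_trivial[OF group_G openin_carrier, of "{x}"]] by auto
  then obtain f where "bij_betw f (pts Z) {x}"
    by (auto simp: gset_iso_def gisos_def)
  then have "is_singleton (pts Z)"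
    by (metis bij_betw_same_card is_singleton_altdef is_singletonI)
  then have "Z \<in> E"
    using E_singleton Z by blast
  then have x: "inE (trivial_gset {x})"
    using Z is_gset_trivial[OF group_G] by (auto simp: inE_def)
  have "inE (coprod_gset (trivial_gset {x}) (trivial_gset S))"
    using x insert.IH by (rule inE_coprod)
  moreover have "gset_iso G (coprod_gset (trivial_gset {x}) (trivial_gset S)) (trivial_gset (insert x S))"
  proof -
    let ?C = "coprod_gset (trivial_gset {x}) (trivial_gset S) :: ('g, 'a + 'a) gset"
    have g: "is_gset G ?C"
      by (intro is_gset_coprod is_gset_trivial group_G)
    have "restrict (case_sum (\<lambda>x. x) (\<lambda>x. x)) (pts ?C) \<in> gmaps G ?C (trivial_gset (insert x S))"
      by (rule gmapsI[OF g]) auto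
    moreover have "bij_betw (case_sum (\<lambda>x. x) (\<lambda>x. x)) ({x} <+> S) (insert x S)"
      using insert.hyps by (auto simp: bij_betw_def inj_on_def image_iff Plus_def)
    ultimately show ?thesis
      by (auto simp: gset_iso_def gisos_def)
  qed
  ultimately show ?case
    using inE_iso is_gset_trivial[OF group_G] by blast
qed

section \<open>Maps out of the pro-object\<close>

abbreviation "I \<equiv> pidx \<Omega>"
abbreviation "Ob \<equiv> pob \<Omega>"
abbreviation "tr \<equiv> ptr \<Omega>"
abbreviation "ile \<equiv> ple \<Omega>"
abbreviation "Hom X \<equiv> pro_hom G \<Omega> X"
abbreviation "post X Y h u \<equiv> pro_post G \<Omega> X Y h u"
abbreviation "pcomp X u \<sigma> \<equiv> pro_comp G \<Omega> X u \<sigma>"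

definition cls :: "('g, 'g univ) gset \<Rightarrow> 'i \<Rightarrow> ('g univ \<Rightarrow> 'g univ) \<Rightarrow> ('i \<times> ('g univ \<Rightarrow> 'g univ)) set" where
  "cls X i f = pro_rel G \<Omega> X `` {(i, f)}"

lemma Ob_E: "i \<in> I \<Longrightarrow> Ob i \<in> E" and Ob_nonempty: "i \<in> I \<Longrightarrow> pts (Ob i) \<noteq> {}"
  using pro_object by (auto simp: is_pro_object_def)

lemma Ob_gset: "i \<in> I \<Longrightarrow> is_gset G (Ob i)"
  using Ob_E E_gset by blast

lemma idx_refl: "i \<in> I \<Longrightarrow> ile i i"
  using pro_object by (auto simp: is_pro_object_def)

lemma idx_trans: "i \<in> I \<Longrightarrow> j \<in> I \<Longrightarrow> k \<in> I \<Longrightarrow> ile i j \<Longrightarrow> ile j k \<Longrightarrow> ile i k"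
  using pro_object unfolding is_pro_object_def by blast

lemma directed: "i \<in> I \<Longrightarrow> j \<in> I \<Longrightarrow> \<exists>k\<in>I. ile i k \<and> ile j k"
  using pro_object unfolding is_pro_object_def by blast

lemma tr_surj: "i \<in> I \<Longrightarrow> j \<in> I \<Longrightarrow> ile i j \<Longrightarrow> tr i j \<in> surj_gmaps G (Ob j) (Ob i)"
  using pro_object unfolding is_pro_object_def by blast

lemma tr_mem: "i \<in> I \<Longrightarrow> j \<in> I \<Longrightarrow> ile i j \<Longrightarrow> x \<in> pts (Ob j) \<Longrightarrow> tr i j x \<in> pts (Ob i)"
  using gmaps_mem[OF surj_gmaps_gmaps[OF tr_surj]] by blast

lemma tr_ex: "i \<in> I \<Longrightarrow> j \<in> I \<Longrightarrow> ile i j \<Longrightarrow> y \<in> pts (Ob i) \<Longrightarrow> \<exists>x\<in>pts (Ob j). y = tr i j x"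
  using surj_gmaps_image[OF tr_surj] by blast

lemma tr_id: "i \<in> I \<Longrightarrow> tr i i = (\<lambda>x\<in>pts (Ob i). x)"
  using pro_object unfolding is_pro_object_def by blast

lemma tr_tr:
  assumes "i \<in> I" "j \<in> I" "k \<in> I" "ile i j" "ile j k" "x \<in> pts (Ob k)"
  shows "tr i j (tr j k x) = tr i k x"
proof -
  have "tr i k = compose (pts (Ob k)) (tr i j) (tr j k)"
    using pro_object assms(1-5) unfolding is_pro_object_def by blast
  then show ?thesis
    using assms by (simp add: compose_eq)
qed

lemma pro_rel_iff: "((i, f), (j, h)) \<in> pro_rel G \<Omega> X \<longleftrightarrow>
  i \<in> I \<and> f \<in> surj_gmaps G (Ob i) X \<and> j \<in> I \<and> h \<in> surj_gmaps G (Ob j) X \<and>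
  (\<exists>k\<in>I. ile i k \<and> ile j k \<and> (\<forall>x\<in>pts (Ob k). f (tr i k x) = h (tr j k x)))"
  unfolding pro_rel_def by (auto simp: compose_def restrict_def fun_eq_iff)

text \<open>Transition maps are surjective and can be cancelled, so agreement at one later stage
  forces agreement at every common stage. Equality in the filtered colimit is thus as rigid as
  equality of functions.\<close>

lemma pro_rel_all:
  assumes "((i, f), (j, h)) \<in> pro_rel G \<Omega> X" "k \<in> I" "ile i k" "ile j k" "x \<in> pts (Ob k)"
  shows "f (tr i k x) = h (tr j k x)"
proof -
  obtain l where l: "l \<in> I" "ile i l" "ile j l" "\<And>x. x \<in> pts (Ob l) \<Longrightarrow> f (tr i l x) = h (tr j l x)"
    and ij: "i \<in> I" "j \<in> I"
    using assms(1) unfolding pro_rel_iff by blast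
  obtain m where m: "m \<in> I" "ile k m" "ile l m"
    using directed l assms by blast
  obtain z where z: "z \<in> pts (Ob m)" "x = tr k m z"
    using tr_ex assms m by blast
  have "f (tr i l (tr l m z)) = h (tr j l (tr l m z))"
    using l m z tr_mem by blast
  then show ?thesis
    using tr_tr ij assms l m z by metis
qed

lemma pro_rel_equiv: "equiv (SIGMA i:I. surj_gmaps G (Ob i) X) (pro_rel G \<Omega> X)"
proof (rule equivI)
  show "pro_rel G \<Omega> X \<subseteq> (SIGMA i:I. surj_gmaps G (Ob i) X) \<times> (SIGMA i:I. surj_gmaps G (Ob i) X)"
    by (auto simp: pro_rel_def)
  show "refl_on (SIGMA i:I. surj_gmaps G (Ob i) X) (pro_rel G \<Omega> X)"
    using idx_refl by (auto simp: refl_on_def pro_rel_iff)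
  show "sym (pro_rel G \<Omega> X)"
    by (rule symI) (auto simp: pro_rel_iff; metis)
  show "trans (pro_rel G \<Omega> X)"
  proof (rule transI)
    fix a b c assume ab: "(a, b) \<in> pro_rel G \<Omega> X" and bc: "(b, c) \<in> pro_rel G \<Omega> X"
    obtain i f j h k l where abc: "a = (i, f)" "b = (j, h)" "c = (k, l)"
      by (metis surj_pair)
    have *: "i \<in> I" "j \<in> I" "k \<in> I" "f \<in> surj_gmaps G (Ob i) X" "l \<in> surj_gmaps G (Ob k) X"
      using ab bc by (auto simp: abc pro_rel_iff)
    obtain m where m: "m \<in> I" "ile i m" "ile j m"
      using directed * by blast
    obtain n where n: "n \<in> I" "ile m n" "ile k n"
      using directed * m by blast
    have n': "ile i n" "ile j n"
      using n m idx_trans * by blast+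
    have "f (tr i n x) = l (tr k n x)" if "x \<in> pts (Ob n)" for x
      using pro_rel_all[OF ab[unfolded abc] n(1) n' that] pro_rel_all[OF bc[unfolded abc] n(1) n'(2) n(3) that]
      by simp
    then show "(a, c) \<in> pro_rel G \<Omega> X"
      using * n n' by (auto simp: abc pro_rel_iff)
  qed
qed

lemma cls_mem: "(j, h) \<in> cls X i f \<longleftrightarrow> ((i, f), (j, h)) \<in> pro_rel G \<Omega> X"
  by (simp add: cls_def)

lemma cls_self: "i \<in> I \<Longrightarrow> f \<in> surj_gmaps G (Ob i) X \<Longrightarrow> (i, f) \<in> cls X i f"
  using idx_refl by (auto simp: cls_mem pro_rel_iff)

lemma cls_Hom: "i \<in> I \<Longrightarrow> f \<in> surj_gmaps G (Ob i) X \<Longrightarrow> cls X i f \<in> Hom X"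
  by (auto simp: cls_def pro_hom_def intro: quotientI)

lemma cls_eqI: "(j, h) \<in> cls X i f \<Longrightarrow> cls X j h = cls X i f"
  unfolding cls_def by (metis Image_singleton_iff equiv_class_eq pro_rel_equiv)

lemma cls_eq_iff:
  assumes "i \<in> I" "f \<in> surj_gmaps G (Ob i) X" "j \<in> I" "h \<in> surj_gmaps G (Ob j) X"
  shows "cls X i f = cls X j h \<longleftrightarrow> ((i, f), (j, h)) \<in> pro_rel G \<Omega> X"
  using cls_eqI[of j h X i f] cls_self[OF assms(3,4)] by (metis cls_mem)

text \<open>\<open>pro_rel_all\<close> at the stage i itself, where the transition map is the
  identity.\<close>

lemma cls_eq_same:
  assumes "i \<in> I" "f \<in> surj_gmaps G (Ob i) X" "h \<in> surj_gmaps G (Ob i) X"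
  shows "cls X i f = cls X i h \<longleftrightarrow> f = h"
proof
  assume "cls X i f = cls X i h"
  then have "((i, f), (i, h)) \<in> pro_rel G \<Omega> X"
    using assms by (simp add: cls_eq_iff)
  then have "f (tr i i x) = h (tr i i x)" if "x \<in> pts (Ob i)" for x
    using pro_rel_all[of i f i h X i x] assms idx_refl that by blast
  then show "f = h"
    using assms by (intro gmaps_eqI[OF surj_gmaps_gmaps surj_gmaps_gmaps]) (auto simp: tr_id)
qed auto

lemma cls_tr:
  assumes "i \<in> I" "f \<in> surj_gmaps G (Ob i) X" "k \<in> I" "ile i k"
  shows "compose (pts (Ob k)) f (tr i k) \<in> surj_gmaps G (Ob k) X"
    and "cls X k (compose (pts (Ob k)) f (tr i k)) = cls X i f"
proof -
  show *: "compose (pts (Ob k)) f (tr i k) \<in> surj_gmaps G (Ob k) X"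
    using surj_gmaps_compose[OF Ob_gset tr_surj] assms by blast
  have "f (tr i k x) = compose (pts (Ob k)) f (tr i k) (tr k k x)" if "x \<in> pts (Ob k)" for x
    using that assms by (simp add: tr_id compose_eq)
  then have "(k, compose (pts (Ob k)) f (tr i k)) \<in> cls X i f"
    using assms * idx_refl unfolding cls_mem pro_rel_iff by blast
  then show "cls X k (compose (pts (Ob k)) f (tr i k)) = cls X i f"
    by (rule cls_eqI)
qed

lemma Hom_cases:
  assumes "u \<in> Hom X"
  obtains i f where "i \<in> I" "f \<in> surj_gmaps G (Ob i) X" "u = cls X i f"
  using assms unfolding pro_hom_def cls_def by (auto elim!: quotientE)

text \<open>Directedness gives a stage at which both maps are represented. Arguments about pairs of
  maps are carried out there, as statements about functions.\<close>

lemma Hom_cases2: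
  assumes "u \<in> Hom X" "v \<in> Hom Y"
  obtains i f h where "i \<in> I" "f \<in> surj_gmaps G (Ob i) X" "u = cls X i f"
    "h \<in> surj_gmaps G (Ob i) Y" "v = cls Y i h"
proof -
  obtain i f where i: "i \<in> I" "f \<in> surj_gmaps G (Ob i) X" "u = cls X i f"
    using assms(1) by (rule Hom_cases)
  obtain j h where j: "j \<in> I" "h \<in> surj_gmaps G (Ob j) Y" "v = cls Y j h"
    using assms(2) by (rule Hom_cases)
  obtain k where "k \<in> I" "ile i k" "ile j k"
    using directed i j by blast
  then show ?thesis
    using that[of k] cls_tr[OF i(1,2)] cls_tr[OF j(1,2)] i(3) j(3) by metis
qed

text \<open>\<open>pro_post\<close> is a union over all representatives of the class. Each of them
  contributes the same class, so any one may be used to compute.\<close>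

lemma post_cls:
  assumes i: "i \<in> I" "f \<in> surj_gmaps G (Ob i) X" and h: "h \<in> surj_gmaps G X Y"
  shows "post X Y h (cls X i f) = cls Y i (compose (pts (Ob i)) h f)"
proof -
  have "cls Y j (compose (pts (Ob j)) h f') = cls Y i (compose (pts (Ob i)) h f)"
    if jf: "(j, f') \<in> cls X i f" for j f'
  proof -
    obtain k where j: "j \<in> I" "f' \<in> surj_gmaps G (Ob j) X" and
      k: "k \<in> I" "ile i k" "ile j k" "\<And>x. x \<in> pts (Ob k) \<Longrightarrow> f (tr i k x) = f' (tr j k x)"
      using jf unfolding cls_mem pro_rel_iff by blast
    have s: "compose (pts (Ob i)) h f \<in> surj_gmaps G (Ob i) Y"
      "compose (pts (Ob j)) h f' \<in> surj_gmaps G (Ob j) Y"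
      using surj_gmaps_compose[OF Ob_gset] i j h by blast+
    have "\<forall>x\<in>pts (Ob k). compose (pts (Ob i)) h f (tr i k x) = compose (pts (Ob j)) h f' (tr j k x)"
      using k i j by (simp add: compose_eq tr_mem)
    then show ?thesis
      unfolding cls_eq_iff[OF j(1) s(2) i(1) s(1)] pro_rel_iff using s i j k by fastforce
  qed
  then have "(case p of (j, f') \<Rightarrow> pro_rel G \<Omega> Y `` {(j, compose (pts (Ob j)) h f')}) =
      cls Y i (compose (pts (Ob i)) h f)" if "p \<in> cls X i f" for p
    using that by (auto simp: cls_def split: prod.split)
  moreover have "cls X i f \<noteq> {}"
    using cls_self[OF i] by blast
  ultimately show ?thesis
    unfolding pro_post_def by (simp add: SUP_eq_const)
qed

lemma post_Hom:
  assumes "u \<in> Hom X" "h \<in> surj_gmaps G X Y" shows "post X Y h u \<in> Hom Y"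
  using assms(1) by (rule Hom_cases)
    (use assms surj_gmaps_compose[OF Ob_gset] in \<open>auto simp: post_cls intro!: cls_Hom\<close>)

lemma post_post:
  assumes "u \<in> Hom X" "f \<in> surj_gmaps G X Y" "h \<in> surj_gmaps G Y Z" and X: "is_gset G X"
  shows "post Y Z h (post X Y f u) = post X Z (compose (pts X) h f) u"
proof -
  obtain i a where i: "i \<in> I" "a \<in> surj_gmaps G (Ob i) X" "u = cls X i a"
    using assms(1) by (rule Hom_cases)
  have a: "a x \<in> pts X" if "x \<in> pts (Ob i)" for x
    using that by (rule gmaps_mem[OF surj_gmaps_gmaps[OF i(2)]])
  have fa: "compose (pts (Ob i)) f a \<in> surj_gmaps G (Ob i) Y"
    using surj_gmaps_compose[OF Ob_gset] i assms by blast
  have "compose (pts (Ob i)) h (compose (pts (Ob i)) f a) =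
      compose (pts (Ob i)) (compose (pts X) h f) a"
    using a by (auto simp: compose_def)
  moreover have "post X Z (compose (pts X) h f) u = cls Z i (compose (pts (Ob i)) (compose (pts X) h f) a)"
    unfolding i(3) using i(1,2) surj_gmaps_compose[OF X assms(2,3)] by (rule post_cls)
  ultimately show ?thesis
    using i fa assms by (simp add: post_cls)
qed

lemma post_id:
  assumes "u \<in> Hom X" and X: "is_gset G X" shows "post X X (\<lambda>x\<in>pts X. x) u = u"
proof -
  obtain i a where i: "i \<in> I" "a \<in> surj_gmaps G (Ob i) X" "u = cls X i a"
    using assms(1) by (rule Hom_cases)
  have a: "a x \<in> pts X" if "x \<in> pts (Ob i)" for x
    using that by (rule gmaps_mem[OF surj_gmaps_gmaps[OF i(2)]])
  have "(\<lambda>x\<in>pts X. x) \<in> surj_gmaps G X X"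
    using X by (rule id_surj_gmaps)
  moreover have "compose (pts (Ob i)) (\<lambda>x\<in>pts X. x) a = a"
    using a gmaps_ext[OF surj_gmaps_gmaps[OF i(2)]] by (auto simp: compose_def extensional_def fun_eq_iff)
  ultimately show ?thesis
    using i by (simp add: post_cls)
qed

text \<open>Every map from the pro-object is represented by a surjection and is therefore an
  epimorphism.\<close>

lemma post_epi:
  assumes "u \<in> Hom X" "f \<in> surj_gmaps G X Y" "h \<in> surj_gmaps G X Y" "post X Y f u = post X Y h u"
  shows "f = h"
proof -
  obtain i a where i: "i \<in> I" "a \<in> surj_gmaps G (Ob i) X" "u = cls X i a"
    using assms(1) by (rule Hom_cases)
  have e: "compose (pts (Ob i)) f a = compose (pts (Ob i)) h a"
    using assms i surj_gmaps_compose[OF Ob_gset[OF i(1)] i(2), of _ Y]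
    by (auto simp: post_cls cls_eq_same)
  have "f (a x) = h (a x)" if "x \<in> pts (Ob i)" for x
    using that fun_cong[OF e, of x] by (simp add: compose_eq)
  then have "f x = h x" if "x \<in> pts X" for x
    using that unfolding surj_gmaps_image[OF i(2), symmetric] by auto
  then show ?thesis
    by (rule gmaps_eqI[OF surj_gmaps_gmaps[OF assms(2)] surj_gmaps_gmaps[OF assms(3)]])
qed

section \<open>The automorphism group of the pro-object\<close>

abbreviation "EndO \<equiv> pro_End G \<Omega>"
abbreviation "H \<equiv> pro_Aut G \<Omega>"
abbreviation "B X \<equiv> BB G \<Omega> X"

section \<open>Composition of endomorphisms of the pro-object\<close>

lemma End_iff: "\<sigma> \<in> carrier EndO \<longleftrightarrow> \<sigma> \<in> (\<Pi>\<^sub>E i\<in>I. Hom (Ob i)) \<and>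
    (\<forall>i\<in>I. \<forall>j\<in>I. ile i j \<longrightarrow> post (Ob j) (Ob i) (tr i j) (\<sigma> j) = \<sigma> i)"
  by (auto simp: pro_End_def)

lemma End_Hom: "\<sigma> \<in> carrier EndO \<Longrightarrow> i \<in> I \<Longrightarrow> \<sigma> i \<in> Hom (Ob i)"
  by (auto simp: End_iff)

lemma End_tr: "\<sigma> \<in> carrier EndO \<Longrightarrow> i \<in> I \<Longrightarrow> j \<in> I \<Longrightarrow> ile i j \<Longrightarrow>
    post (Ob j) (Ob i) (tr i j) (\<sigma> j) = \<sigma> i"
  by (auto simp: End_iff)

lemma cls_compose_eq:
  assumes i: "i \<in> I" and f: "f \<in> surj_gmaps G (Ob i) W" and h: "h \<in> surj_gmaps G (Ob i) V"
    and p: "p \<in> surj_gmaps G W X" and q: "q \<in> surj_gmaps G V X"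
  shows "post W X p (cls W i f) = post V X q (cls V i h) \<longleftrightarrow> (\<forall>x\<in>pts (Ob i). p (f x) = q (h x))"
  unfolding post_cls[OF i f p] post_cls[OF i h q]
    cls_eq_same[OF i surj_gmaps_compose[OF Ob_gset[OF i] f p] surj_gmaps_compose[OF Ob_gset[OF i] h q]]
  by (auto simp: compose_def restrict_def fun_eq_iff)

text \<open>Compatibility of the family \<sigma> with the transition maps keeps the contribution of
  a representative unchanged when it is moved to a later stage; hence the union defining
  \<open>pro_comp\<close> has a single value.\<close>

lemma pcomp_cls:
  assumes i: "i \<in> I" "f \<in> surj_gmaps G (Ob i) X" and \<sigma>: "\<sigma> \<in> carrier EndO"
  shows "pcomp X (cls X i f) \<sigma> = post (Ob i) X f (\<sigma> i)"
proof -
  have *: "post (Ob j) X f' (\<sigma> j) = post (Ob k) X (compose (pts (Ob k)) f' (tr j k)) (\<sigma> k)"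
    if "j \<in> I" "k \<in> I" "ile j k" "f' \<in> surj_gmaps G (Ob j) X" for j k f'
    using post_post[OF End_Hom[OF \<sigma>] tr_surj] that Ob_gset End_tr[OF \<sigma>] by metis
  have "post (Ob j) X f' (\<sigma> j) = post (Ob i) X f (\<sigma> i)" if jf: "(j, f') \<in> cls X i f" for j f'
  proof -
    obtain k where j: "j \<in> I" "f' \<in> surj_gmaps G (Ob j) X" and
      k: "k \<in> I" "ile i k" "ile j k" "\<And>x. x \<in> pts (Ob k) \<Longrightarrow> f (tr i k x) = f' (tr j k x)"
      using jf unfolding cls_mem pro_rel_iff by blast
    have "compose (pts (Ob k)) f (tr i k) = compose (pts (Ob k)) f' (tr j k)"
      using k by (auto simp: compose_def)
    then show ?thesis
      using *[of j k f'] *[of i k f] i j k by simp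
  qed
  then have "(case p of (j, f') \<Rightarrow> post (Ob j) X f' (\<sigma> j)) = post (Ob i) X f (\<sigma> i)"
    if "p \<in> cls X i f" for p
    using that by (auto split: prod.split)
  moreover have "cls X i f \<noteq> {}"
    using cls_self[OF i] by blast
  ultimately show ?thesis
    unfolding pro_comp_def by (simp add: SUP_eq_const)
qed

lemma pcomp_Hom: "u \<in> Hom X \<Longrightarrow> \<sigma> \<in> carrier EndO \<Longrightarrow> pcomp X u \<sigma> \<in> Hom X"
  by (erule Hom_cases) (simp add: pcomp_cls post_Hom End_Hom)

lemma pcomp_post:
  assumes "u \<in> Hom X" "h \<in> surj_gmaps G X Y" "\<sigma> \<in> carrier EndO"
  shows "pcomp Y (post X Y h u) \<sigma> = post X Y h (pcomp X u \<sigma>)"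
proof -
  obtain i f where i: "i \<in> I" "f \<in> surj_gmaps G (Ob i) X" "u = cls X i f"
    using assms(1) by (rule Hom_cases)
  have "compose (pts (Ob i)) h f \<in> surj_gmaps G (Ob i) Y"
    using surj_gmaps_compose[OF Ob_gset] i assms by blast
  then show ?thesis
    using i assms by (simp add: post_cls pcomp_cls post_post End_Hom Ob_gset)
qed

lemma End_mult: "\<sigma> \<otimes>\<^bsub>EndO\<^esub> \<tau> = (\<lambda>i\<in>I. pcomp (Ob i) (\<sigma> i) \<tau>)"
  by (simp add: pro_End_def)

lemma End_one: "\<one>\<^bsub>EndO\<^esub> = (\<lambda>i\<in>I. cls (Ob i) i (\<lambda>x\<in>pts (Ob i). x))"
  by (simp add: pro_End_def cls_def)

lemma End_mult_closed:
  assumes "\<sigma> \<in> carrier EndO" "\<tau> \<in> carrier EndO"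
  shows "\<sigma> \<otimes>\<^bsub>EndO\<^esub> \<tau> \<in> carrier EndO"
  unfolding End_iff End_mult
proof (intro conjI ballI impI)
  show "(\<lambda>i\<in>I. pcomp (Ob i) (\<sigma> i) \<tau>) \<in> (\<Pi>\<^sub>E i\<in>I. Hom (Ob i))"
    using assms by (auto simp: pcomp_Hom End_Hom)
  fix i j assume ij: "i \<in> I" "j \<in> I" "ile i j"
  then have "post (Ob j) (Ob i) (tr i j) (pcomp (Ob j) (\<sigma> j) \<tau>) = pcomp (Ob i) (\<sigma> i) \<tau>"
    using pcomp_post[OF End_Hom tr_surj, of \<sigma> j i \<tau>] assms End_tr by simp
  then show "post (Ob j) (Ob i) (tr i j) ((\<lambda>i\<in>I. pcomp (Ob i) (\<sigma> i) \<tau>) j) =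
      (\<lambda>i\<in>I. pcomp (Ob i) (\<sigma> i) \<tau>) i"
    using ij by simp
qed

lemma pcomp_mult:
  assumes "u \<in> Hom X" "\<sigma> \<in> carrier EndO" "\<tau> \<in> carrier EndO"
  shows "pcomp X u (\<sigma> \<otimes>\<^bsub>EndO\<^esub> \<tau>) = pcomp X (pcomp X u \<sigma>) \<tau>"
proof -
  obtain i f where i: "i \<in> I" "f \<in> surj_gmaps G (Ob i) X" "u = cls X i f"
    using assms(1) by (rule Hom_cases)
  then have "pcomp X u (\<sigma> \<otimes>\<^bsub>EndO\<^esub> \<tau>) = post (Ob i) X f (pcomp (Ob i) (\<sigma> i) \<tau>)"
    using assms pcomp_cls[OF i(1,2) End_mult_closed] by (simp add: End_mult)
  also have "\<dots> = pcomp X (pcomp X u \<sigma>) \<tau>"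
    using i assms by (simp add: pcomp_cls pcomp_post End_Hom)
  finally show ?thesis .
qed

lemma End_one_closed: "\<one>\<^bsub>EndO\<^esub> \<in> carrier EndO"
  unfolding End_iff End_one
proof (intro conjI ballI impI)
  show "(\<lambda>i\<in>I. cls (Ob i) i (\<lambda>x\<in>pts (Ob i). x)) \<in> (\<Pi>\<^sub>E i\<in>I. Hom (Ob i))"
    by (auto intro!: cls_Hom id_surj_gmaps Ob_gset)
  fix i j assume ij: "i \<in> I" "j \<in> I" "ile i j"
  have "compose (pts (Ob j)) (tr i j) (\<lambda>x\<in>pts (Ob j). x) =
      compose (pts (Ob j)) (\<lambda>x\<in>pts (Ob i). x) (tr i j)"
    using ij by (auto simp: compose_def tr_mem)
  then have "post (Ob j) (Ob i) (tr i j) (cls (Ob j) j (\<lambda>x\<in>pts (Ob j). x)) =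
      cls (Ob i) j (compose (pts (Ob j)) (\<lambda>x\<in>pts (Ob i). x) (tr i j))"
    using ij by (simp add: post_cls id_surj_gmaps Ob_gset tr_surj)
  also have "\<dots> = cls (Ob i) i (\<lambda>x\<in>pts (Ob i). x)"
    using ij by (simp add: cls_tr id_surj_gmaps Ob_gset)
  finally show "post (Ob j) (Ob i) (tr i j) ((\<lambda>i\<in>I. cls (Ob i) i (\<lambda>x\<in>pts (Ob i). x)) j) =
      (\<lambda>i\<in>I. cls (Ob i) i (\<lambda>x\<in>pts (Ob i). x)) i"
    using ij by simp
qed

lemma pcomp_one: "u \<in> Hom X \<Longrightarrow> pcomp X u \<one>\<^bsub>EndO\<^esub> = u"
proof (erule Hom_cases)
  fix i f assume i: "i \<in> I" "f \<in> surj_gmaps G (Ob i) X" "u = cls X i f"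
  have "compose (pts (Ob i)) f (\<lambda>x\<in>pts (Ob i). x) = f"
    using gmaps_ext[OF surj_gmaps_gmaps[OF i(2)]] by (auto simp: compose_def extensional_def)
  then show ?thesis
    using i End_one_closed by (simp add: pcomp_cls End_one post_cls id_surj_gmaps Ob_gset)
qed

lemma monoid_End: "monoid EndO"
proof
  show "\<one>\<^bsub>EndO\<^esub> \<otimes>\<^bsub>EndO\<^esub> \<sigma> = \<sigma>" if \<sigma>: "\<sigma> \<in> carrier EndO" for \<sigma>
  proof (rule extensionalityI[of _ I])
    show "(\<one>\<^bsub>EndO\<^esub> \<otimes>\<^bsub>EndO\<^esub> \<sigma>) i = \<sigma> i" if i: "i \<in> I" for i
      using i \<sigma> post_id[OF End_Hom[OF \<sigma> i] Ob_gset[OF i]]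
      by (simp add: End_mult End_one pcomp_cls id_surj_gmaps Ob_gset)
  qed (use \<sigma> in \<open>auto simp: End_mult End_iff PiE_def\<close>)
  show "\<sigma> \<otimes>\<^bsub>EndO\<^esub> \<one>\<^bsub>EndO\<^esub> = \<sigma>" if \<sigma>: "\<sigma> \<in> carrier EndO" for \<sigma>
  proof (rule extensionalityI[of _ I])
    show "(\<sigma> \<otimes>\<^bsub>EndO\<^esub> \<one>\<^bsub>EndO\<^esub>) i = \<sigma> i" if i: "i \<in> I" for i
      using pcomp_one[OF End_Hom[OF \<sigma> i]] i by (simp add: End_mult)
  qed (use \<sigma> in \<open>auto simp: End_mult End_iff PiE_def\<close>)
  show "\<sigma> \<otimes>\<^bsub>EndO\<^esub> \<tau> \<otimes>\<^bsub>EndO\<^esub> \<upsilon> = \<sigma> \<otimes>\<^bsub>EndO\<^esub> (\<tau> \<otimes>\<^bsub>EndO\<^esub> \<upsilon>)"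
    if s: "\<sigma> \<in> carrier EndO" "\<tau> \<in> carrier EndO" "\<upsilon> \<in> carrier EndO" for \<sigma> \<tau> \<upsilon>
  proof (rule extensionalityI[of _ I])
    show "(\<sigma> \<otimes>\<^bsub>EndO\<^esub> \<tau> \<otimes>\<^bsub>EndO\<^esub> \<upsilon>) i = (\<sigma> \<otimes>\<^bsub>EndO\<^esub> (\<tau> \<otimes>\<^bsub>EndO\<^esub> \<upsilon>)) i" if i: "i \<in> I" for i
      using pcomp_mult[OF End_Hom[OF s(1) i] s(2,3)] i by (simp add: End_mult)
  qed (simp_all add: End_mult)
qed (simp_all add: End_mult_closed End_one_closed)

lemma group_H: "group H"
  unfolding pro_Aut_def by (rule monoid.units_group[OF monoid_End])

lemma H_End: "\<sigma> \<in> carrier H \<Longrightarrow> \<sigma> \<in> carrier EndO"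
  by (simp add: pro_Aut_def units_of_carrier monoid.Units_closed[OF monoid_End])

lemma H_mult: "\<sigma> \<otimes>\<^bsub>H\<^esub> \<tau> = \<sigma> \<otimes>\<^bsub>EndO\<^esub> \<tau>"
  by (simp add: pro_Aut_def units_of_mult)

lemma H_one: "\<one>\<^bsub>H\<^esub> = \<one>\<^bsub>EndO\<^esub>"
  by (simp add: pro_Aut_def units_of_one)

section \<open>The transitive sets of maps to a fixed object\<close>

lemma pts_B [simp]: "pts (B X) = Hom X"
  by (simp add: BB_def)

lemma act_B: "u \<in> Hom X \<Longrightarrow> act (B X) \<sigma> u = pcomp X u (inv\<^bsub>H\<^esub> \<sigma>)"
  by (simp add: BB_def)

lemma is_gset_B: "is_gset H (B X)"
proof -
  interpret H: group H by (rule group_H)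
  show ?thesis
  proof (rule is_gsetI)
    show "act (B X) (\<sigma> \<otimes>\<^bsub>H\<^esub> \<tau>) u = act (B X) \<sigma> (act (B X) \<tau> u)"
      if "\<sigma> \<in> carrier H" "\<tau> \<in> carrier H" "u \<in> pts (B X)" for \<sigma> \<tau> u
      using that by (simp add: act_B H.inv_mult_group H_mult[of "inv\<^bsub>H\<^esub> \<tau>"] pcomp_mult H_End pcomp_Hom)
    show "act (B X) \<one>\<^bsub>H\<^esub> u = u" if "u \<in> pts (B X)" for u
      using that by (simp add: act_B H_one[symmetric] pcomp_one[folded H_one])
  qed (auto simp: act_B pcomp_Hom H_End group_H BB_def)
qed

lemma gmaps_B_pcomp:
  assumes "\<phi> \<in> gmaps H (B Y) (B X)" "u \<in> Hom Y" "\<sigma> \<in> carrier H"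
  shows "\<phi> (pcomp Y u \<sigma>) = pcomp X (\<phi> u) \<sigma>"
proof -
  interpret H: group H by (rule group_H)
  show ?thesis
    using gmaps_act[OF assms(1), of "inv\<^bsub>H\<^esub> \<sigma>" u] gmaps_mem[OF assms(1), of u] assms
    by (simp add: act_B)
qed

lemma Hom_nonempty: "X \<in> E \<Longrightarrow> pts X \<noteq> {} \<Longrightarrow> Hom X \<noteq> {}"
  using universal by (simp add: universal_pro_def)

lemma Hom_homogeneous: "X \<in> E \<Longrightarrow> pts X \<noteq> {} \<Longrightarrow> u \<in> Hom X \<Longrightarrow> v \<in> Hom X \<Longrightarrow>
    \<exists>\<sigma>\<in>carrier H. pcomp X u \<sigma> = v"
  using homogeneous unfolding homogeneous_pro_def by blast

lemma Hom_pts_nonempty: "u \<in> Hom X \<Longrightarrow> pts X \<noteq> {}"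
  by (erule Hom_cases) (metis Ob_nonempty image_is_empty surj_gmaps_image)

text \<open>Transitivity is homogeneity; the inverse converts precomposition, a right action, into
  the left action of \<open>BB\<close>.\<close>

lemma B_orbit:
  assumes "X \<in> E" "u \<in> Hom X" shows "orb H (B X) u = Hom X"
proof -
  interpret H: group H by (rule group_H)
  have "v \<in> orb H (B X) u" if v: "v \<in> Hom X" for v
  proof -
    obtain \<sigma> where s: "\<sigma> \<in> carrier H" "pcomp X u \<sigma> = v"
      using Hom_homogeneous[OF assms(1) Hom_pts_nonempty[OF v] assms(2) v] by blast
    then have "act (B X) (inv\<^bsub>H\<^esub> \<sigma>) u = v"
      using assms by (simp add: act_B)
    then show ?thesis
      using s H.inv_closed by (fastforce simp: orbit_def)
  qed
  then show ?thesis
    using orb_subset[OF is_gset_B, of u X] assms by auto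
qed

lemma B_orbs: "X \<in> E \<Longrightarrow> pts X \<noteq> {} \<Longrightarrow> orbs H (B X) = {Hom X}"
  using Hom_nonempty[of X] B_orbit[of X] unfolding orbs_def pts_B by blast

definition bmap :: "('g, 'g univ) gset \<Rightarrow> ('g, 'g univ) gset \<Rightarrow> ('g univ \<Rightarrow> 'g univ) \<Rightarrow>
    ('i \<times> ('g univ \<Rightarrow> 'g univ)) set \<Rightarrow> ('i \<times> ('g univ \<Rightarrow> 'g univ)) set" where
  "bmap X Y h = (\<lambda>u\<in>Hom X. post X Y h u)"

lemma bmap_gmaps: "h \<in> surj_gmaps G X Y \<Longrightarrow> bmap X Y h \<in> gmaps H (B X) (B Y)"
  unfolding bmap_def
  using gmapsI[OF is_gset_B, of X "post X Y h" "B Y"] group.inv_closed[OF group_H]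
  by (simp add: post_Hom act_B pcomp_post H_End)

lemma bmap_gisos:
  assumes X: "is_gset G X" and Y: "is_gset G Y" and h: "h \<in> gisos G X Y"
  shows "bmap X Y h \<in> gisos H (B X) (B Y)"
proof -
  let ?k = "restrict (inv_into (pts X) h) (pts Y)"
  have k: "?k \<in> gisos G Y X"
    by (rule gisos_inv[OF X Y h])
  have b: "bij_betw h (pts X) (pts Y)"
    using h by (rule gisos_bij)
  have hm: "h x \<in> pts Y" if "x \<in> pts X" for x
    using b that by (auto simp: bij_betw_def)
  have kh: "compose (pts X) ?k h = (\<lambda>x\<in>pts X. x)"
    using b hm by (auto simp: compose_def bij_betw_inv_into_left)
  have hk: "compose (pts Y) h ?k = (\<lambda>x\<in>pts Y. x)"
    using b by (auto simp: compose_def bij_betw_inv_into_right)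
  have "bij_betw (bmap X Y h) (Hom X) (Hom Y)"
  proof (rule bij_betw_byWitness[where f' = "bmap Y X ?k"])
    show "\<forall>u\<in>Hom X. bmap Y X ?k (bmap X Y h u) = u"
      using gisos_surj_gmaps[OF h] gisos_surj_gmaps[OF k] kh X
      by (simp add: bmap_def post_post post_Hom post_id)
    show "\<forall>u\<in>Hom Y. bmap X Y h (bmap Y X ?k u) = u"
      using gisos_surj_gmaps[OF h] gisos_surj_gmaps[OF k] hk Y
      by (simp add: bmap_def post_post post_Hom post_id)
  qed (use gisos_surj_gmaps[OF h] gisos_surj_gmaps[OF k] in \<open>auto simp: bmap_def post_Hom\<close>)
  then show ?thesis
    using bmap_gmaps[OF gisos_surj_gmaps[OF h]] by (simp add: gisos_def)
qed

section \<open>Pairs of maps\<close>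

text \<open>The image of the pro-object in X x Y under the pair (u, v), collected over all stages
  that represent both. Surjectivity of the transition maps makes one stage sufficient
  (\<open>pimg_cls\<close>).\<close>

definition pimg :: "('i \<times> ('g univ \<Rightarrow> 'g univ)) set \<Rightarrow> ('i \<times> ('g univ \<Rightarrow> 'g univ)) set \<Rightarrow>
    ('g univ \<times> 'g univ) set" where
  "pimg u v = {(f x, h x) | k f h x. (k, f) \<in> u \<and> (k, h) \<in> v \<and> x \<in> pts (Ob k)}"

lemma pimg_cls:
  assumes i: "i \<in> I" and f: "f \<in> surj_gmaps G (Ob i) X" and h: "h \<in> surj_gmaps G (Ob i) Y"
  shows "pimg (cls X i f) (cls Y i h) = (\<lambda>x. (f x, h x)) ` pts (Ob i)"
proof -
  have "(f' x, h' x) \<in> (\<lambda>x. (f x, h x)) ` pts (Ob i)"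
    if j: "(j, f') \<in> cls X i f" "(j, h') \<in> cls Y i h" "x \<in> pts (Ob j)" for j f' h' x
  proof -
    have jI: "j \<in> I"
      using j by (auto simp: cls_mem pro_rel_iff)
    obtain k where k: "k \<in> I" "ile i k" "ile j k"
      using directed i jI by blast
    obtain z where z: "z \<in> pts (Ob k)" "x = tr j k z"
      using tr_ex[OF jI k(1,3) j(3)] by blast
    have "f' x = f (tr i k z)" "h' x = h (tr i k z)"
      using pro_rel_all[OF j(1)[unfolded cls_mem] k z(1)] pro_rel_all[OF j(2)[unfolded cls_mem] k z(1)] z
      by auto
    then show ?thesis
      using tr_mem[OF i k(1,2) z(1)] by auto
  qed
  moreover have "(f x, h x) \<in> pimg (cls X i f) (cls Y i h)" if "x \<in> pts (Ob i)" for x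
    unfolding pimg_def using cls_self[OF i f] cls_self[OF i h] that by blast
  ultimately show ?thesis
    by (auto simp: pimg_def)
qed

lemma pimg_post:
  assumes w: "w \<in> Hom W" and p: "p \<in> surj_gmaps G W X" and q: "q \<in> surj_gmaps G W Y"
  shows "pimg (post W X p w) (post W Y q w) = (\<lambda>x. (p x, q x)) ` pts W"
proof -
  obtain i f where i: "i \<in> I" "f \<in> surj_gmaps G (Ob i) W" "w = cls W i f"
    using w by (rule Hom_cases)
  have "pimg (post W X p w) (post W Y q w) = (\<lambda>x. (p (f x), q (f x))) ` pts (Ob i)"
    unfolding i(3) post_cls[OF i(1,2) p] post_cls[OF i(1,2) q]
      pimg_cls[OF i(1) surj_gmaps_compose[OF Ob_gset[OF i(1)] i(2) p]
        surj_gmaps_compose[OF Ob_gset[OF i(1)] i(2) q]]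
    by (rule image_cong) (simp_all add: compose_eq)
  also have "\<dots> = (\<lambda>x. (p x, q x)) ` f ` pts (Ob i)"
    by (simp add: image_image)
  finally show ?thesis
    using surj_gmaps_image[OF i(2)] by simp
qed

text \<open>An invariant subset of a product does not have its points in \<open>'g univ\<close>, so
  the pro-object has no maps to it as it stands. It is replaced by an object W of \<open>E\<close>
  that carries its two projections.\<close>

lemma graph_object:
  assumes X: "inE X" and Y: "inE Y" and A: "invariant_set G (prod_gset X Y) A"
    and A1: "fst ` A = pts X" and A2: "snd ` A = pts Y"
  obtains W p q where "W \<in> E" "p \<in> surj_gmaps G W X" "q \<in> surj_gmaps G W Y"
    "inj_on (\<lambda>x. (p x, q x)) (pts W)" "(\<lambda>x. (p x, q x)) ` pts W = A"
    "(\<lambda>x\<in>pts W. (p x, q x)) \<in> gisos G W (sub_gset (prod_gset X Y) A)"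
proof -
  have S: "inE (sub_gset (prod_gset X Y) A)"
    using X Y A by (simp add: inE_prod inE_sub)
  obtain W \<psi> where W: "W \<in> E" "\<psi> \<in> gisos G W (sub_gset (prod_gset X Y) A)"
    using inE_rep[OF S] by blast
  have gW: "is_gset G W"
    using W E_gset by blast
  have b: "bij_betw \<psi> (pts W) A"
    using gisos_bij[OF W(2)] by simp
  have m: "\<psi> x \<in> A" if "x \<in> pts W" for x
    using b that by (auto simp: bij_betw_def)
  have AXY: "a \<in> pts X" "b \<in> pts Y" if "(a, b) \<in> A" for a b
    using A that by (auto simp: invariant_set_def)
  have mm: "fst (\<psi> x) \<in> pts X" "snd (\<psi> x) \<in> pts Y" if "x \<in> pts W" for x
    using m[OF that] AXY by (cases "\<psi> x"; simp)+
  have e: "fst (\<psi> (act W g x)) = act X g (fst (\<psi> x)) \<and> snd (\<psi> (act W g x)) = act Y g (snd (\<psi> x))"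
    if "g \<in> carrier G" "x \<in> pts W" for g x
    using gmaps_act[OF gisos_gmaps[OF W(2)] that] m[OF that(2)] AXY
    by (cases "\<psi> x") simp
  let ?p = "\<lambda>x\<in>pts W. fst (\<psi> x)" and ?q = "\<lambda>x\<in>pts W. snd (\<psi> x)"
  have im: "\<psi> ` pts W = A"
    using b by (simp add: bij_betw_def)
  have p: "?p \<in> surj_gmaps G W X"
    unfolding surj_gmaps_def mem_Collect_eq
  proof
    show "?p \<in> gmaps G W X"
      by (rule gmapsI[OF gW]) (use e mm in simp_all)
    show "?p ` pts W = pts X"
      by (simp add: A1[symmetric] im[symmetric] image_image)
  qed
  have q: "?q \<in> surj_gmaps G W Y"
    unfolding surj_gmaps_def mem_Collect_eq
  proof
    show "?q \<in> gmaps G W Y"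
      by (rule gmapsI[OF gW]) (use e mm in simp_all)
    show "?q ` pts W = pts Y"
      by (simp add: A2[symmetric] im[symmetric] image_image)
  qed
  have pq: "(?p x, ?q x) = \<psi> x" if "x \<in> pts W" for x
    using that by simp
  have "inj_on (\<lambda>x. (?p x, ?q x)) (pts W)"
    using b pq by (metis (no_types, lifting) bij_betw_def inj_on_cong)
  moreover have "(\<lambda>x. (?p x, ?q x)) ` pts W = A"
    using im pq by (simp cong: image_cong)
  moreover have "(\<lambda>x\<in>pts W. (?p x, ?q x)) = \<psi>"
    using gmaps_ext[OF gisos_gmaps[OF W(2)]] by (auto simp: fun_eq_iff extensional_def)
  ultimately show ?thesis
    using that[OF W(1) p q] W(2) by simp
qed

lemma pimg_props:
  assumes X: "is_gset G X" and Y: "is_gset G Y" and u: "u \<in> Hom X" and v: "v \<in> Hom Y"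
  shows "invariant_set G (prod_gset X Y) (pimg u v)" "fst ` pimg u v = pts X" "snd ` pimg u v = pts Y"
proof -
  obtain i f h where i: "i \<in> I" "f \<in> surj_gmaps G (Ob i) X" "u = cls X i f"
    "h \<in> surj_gmaps G (Ob i) Y" "v = cls Y i h"
    using u v by (rule Hom_cases2)
  have e: "pimg u v = (\<lambda>x. (f x, h x)) ` pts (Ob i)"
    using i by (simp add: pimg_cls)
  have m: "f x \<in> pts X" "h x \<in> pts Y" if "x \<in> pts (Ob i)" for x
    using that i by (auto intro: gmaps_mem[OF surj_gmaps_gmaps])
  show "fst ` pimg u v = pts X" "snd ` pimg u v = pts Y"
    using surj_gmaps_image[OF i(2)] surj_gmaps_image[OF i(4)] by (auto simp: e image_image)
  show "invariant_set G (prod_gset X Y) (pimg u v)"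
    unfolding invariant_set_def
  proof (intro conjI ballI)
    show "pimg u v \<subseteq> pts (prod_gset X Y)"
      using m by (auto simp: e)
    fix g z assume g: "g \<in> carrier G" and "z \<in> pimg u v"
    then obtain x where x: "x \<in> pts (Ob i)" "z = (f x, h x)"
      by (auto simp: e)
    then have "act (prod_gset X Y) g z = (f (act (Ob i) g x), h (act (Ob i) g x))"
      using m g gmaps_act[OF surj_gmaps_gmaps[OF i(2)]] gmaps_act[OF surj_gmaps_gmaps[OF i(4)]]
      by simp
    then show "act (prod_gset X Y) g z \<in> pimg u v"
      using act_closed[OF Ob_gset[OF i(1)] g x(1)] by (auto simp: e)
  qed
qed

text \<open>At a common stage the pair is a function onto its image, which W parametrizes; so the
  pair factors through W.\<close>

lemma pair_lift:
  assumes u: "u \<in> Hom X" and v: "v \<in> Hom Y" and W: "W \<in> E"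
    and p: "p \<in> surj_gmaps G W X" and q: "q \<in> surj_gmaps G W Y"
    and inj: "inj_on (\<lambda>x. (p x, q x)) (pts W)" and im: "(\<lambda>x. (p x, q x)) ` pts W = pimg u v"
  obtains w where "w \<in> Hom W" "post W X p w = u" "post W Y q w = v"
proof -
  obtain i f h where i: "i \<in> I" "f \<in> surj_gmaps G (Ob i) X" "u = cls X i f"
    "h \<in> surj_gmaps G (Ob i) Y" "v = cls Y i h"
    using u v by (rule Hom_cases2)
  have e: "pimg u v = (\<lambda>x. (f x, h x)) ` pts (Ob i)"
    using i by (simp add: pimg_cls)
  obtain g where gs: "g \<in> surj_gmaps G (Ob i) W" and
    g: "\<And>x. x \<in> pts (Ob i) \<Longrightarrow> p (g x) = f x \<and> q (g x) = h x"
    using factor_through_pair[OF Ob_gset[OF i(1)] E_gset[OF W] surj_gmaps_gmaps[OF p] surj_gmaps_gmaps[OF q]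
        inj surj_gmaps_gmaps[OF i(2)] surj_gmaps_gmaps[OF i(4)] im[unfolded e]] by blast
  have "compose (pts (Ob i)) p g = f" "compose (pts (Ob i)) q g = h"
    using g gmaps_ext[OF surj_gmaps_gmaps[OF i(2)]] gmaps_ext[OF surj_gmaps_gmaps[OF i(4)]]
    by (auto simp: compose_def extensional_def fun_eq_iff)
  then show ?thesis
    using that[OF cls_Hom[OF i(1) gs]] i gs p q by (simp add: post_cls)
qed

text \<open>Joint injectivity on points passes to maps from the pro-object, by comparing
  representatives at one stage.\<close>

lemma pair_inj:
  assumes w: "w \<in> Hom W" "w' \<in> Hom W" and p: "p \<in> surj_gmaps G W X" and q: "q \<in> surj_gmaps G W Y"
    and inj: "inj_on (\<lambda>x. (p x, q x)) (pts W)"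
    and eq: "post W X p w = post W X p w'" "post W Y q w = post W Y q w'"
  shows "w = w'"
proof -
  obtain i f h where i: "i \<in> I" "f \<in> surj_gmaps G (Ob i) W" "w = cls W i f"
    "h \<in> surj_gmaps G (Ob i) W" "w' = cls W i h"
    using w by (rule Hom_cases2)
  note c = eq(1)[unfolded i(3,5) cls_compose_eq[OF i(1,2,4) p p]]
    eq(2)[unfolded i(3,5) cls_compose_eq[OF i(1,2,4) q q]]
  have "f = h"
  proof (rule gmaps_eqI[OF surj_gmaps_gmaps[OF i(2)] surj_gmaps_gmaps[OF i(4)]])
    fix x assume x: "x \<in> pts (Ob i)"
    have "p (f x) = p (h x)" "q (f x) = q (h x)"
      using c x by blast+
    then show "f x = h x"
      using inj_onD[OF inj, of "f x" "h x"] x gmaps_mem[OF surj_gmaps_gmaps[OF i(2)]]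
        gmaps_mem[OF surj_gmaps_gmaps[OF i(4)]] by simp
  qed
  then show ?thesis
    using i by simp
qed

text \<open>Universality applied to \<open>W \<times>\<^bsub>Y\<^esub> W\<close> separates the points that \<open>g\<close> identifies.\<close>

lemma noninjective_lifts:
  assumes W: "W \<in> E" and Y: "Y \<in> E" and g: "g \<in> surj_gmaps G W Y" and ni: "\<not> inj_on g (pts W)"
  obtains w w' where "w \<in> Hom W" "w' \<in> Hom W" "w \<noteq> w'" "post W Y g w = post W Y g w'"
proof -
  define A where "A = {(a, b). a \<in> pts W \<and> b \<in> pts W \<and> g a = g b}"
  have gW: "is_gset G W"
    using W by (rule E_gset)
  have "invariant_set G (prod_gset W W) A"
    using gmaps_act[OF surj_gmaps_gmaps[OF g]] act_closed[OF gW]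
    by (auto simp: invariant_set_def A_def)
  moreover have "fst ` A = pts W" "snd ` A = pts W"
    by (force simp: A_def image_iff)+
  ultimately obtain V p q where V: "V \<in> E" "p \<in> surj_gmaps G V W" "q \<in> surj_gmaps G V W"
    "inj_on (\<lambda>x. (p x, q x)) (pts V)" "(\<lambda>x. (p x, q x)) ` pts V = A"
    "(\<lambda>x\<in>pts V. (p x, q x)) \<in> gisos G V (sub_gset (prod_gset W W) A)"
    by (rule graph_object[OF E_inE[OF W] E_inE[OF W]])
  obtain a b where "a \<in> pts W" "b \<in> pts W" "g a = g b" "a \<noteq> b"
    using ni by (auto simp: inj_on_def)
  then have "(a, b) \<in> A" "a \<noteq> b"
    by (auto simp: A_def)
  then obtain c where c: "c \<in> pts V" "p c \<noteq> q c"
    using V(5) by force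
  obtain z where z: "z \<in> Hom V"
    using Hom_nonempty[OF V(1)] c by blast
  have "post V W p z \<noteq> post V W q z"
    using post_epi[OF z V(2,3)] c by auto
  moreover have "compose (pts V) g p = compose (pts V) g q"
    unfolding compose_def by (rule restrict_ext) (use V(5) in \<open>auto simp: A_def\<close>)
  then have "post W Y g (post V W p z) = post W Y g (post V W q z)"
    using V z g by (simp add: post_post E_gset)
  ultimately show ?thesis
    using that z V post_Hom by blast
qed

text \<open>Image factorization of a pair of maps from the pro-object: W is their joint
  image.\<close>

lemma pair_object:
  assumes X: "X \<in> E" and Y: "Y \<in> E" and u: "u \<in> Hom X" and v: "v \<in> Hom Y"
  obtains W p q w where "W \<in> E" "p \<in> surj_gmaps G W X" "q \<in> surj_gmaps G W Y"
    "inj_on (\<lambda>x. (p x, q x)) (pts W)" "w \<in> Hom W" "post W X p w = u" "post W Y q w = v"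
proof -
  note pp = pimg_props[OF E_gset[OF X] E_gset[OF Y] u v]
  obtain W p q where W: "W \<in> E" "p \<in> surj_gmaps G W X" "q \<in> surj_gmaps G W Y"
    "inj_on (\<lambda>x. (p x, q x)) (pts W)" "(\<lambda>x. (p x, q x)) ` pts W = pimg u v"
    "(\<lambda>x\<in>pts W. (p x, q x)) \<in> gisos G W (sub_gset (prod_gset X Y) (pimg u v))"
    by (rule graph_object[OF E_inE[OF X] E_inE[OF Y] pp])
  show ?thesis
    using u v W(1-5) by (rule pair_lift) (rule that[OF W(1-4)])
qed

text \<open>The pair (u, \<open>\<phi> u\<close>) factors through its joint image W. By equivariance
  of \<phi> the first projection of a map to W determines the second, which forces p to be injective
  on points. Then p is an isomorphism and W is the graph of a surjection Y -> X, which induces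
  \<phi>.\<close>

lemma gmaps_B_surj:
  assumes X: "X \<in> E" and Y: "Y \<in> E" "pts Y \<noteq> {}" and \<phi>: "\<phi> \<in> gmaps H (B Y) (B X)"
  obtains g where "g \<in> surj_gmaps G Y X" "\<phi> = bmap Y X g"
proof -
  obtain u where u: "u \<in> Hom Y"
    using Hom_nonempty[OF Y] by blast
  have v: "\<phi> u \<in> Hom X"
    using gmaps_mem[OF \<phi>] u by simp
  obtain W p q w where W: "W \<in> E" "p \<in> surj_gmaps G W Y" "q \<in> surj_gmaps G W X"
    "inj_on (\<lambda>x. (p x, q x)) (pts W)" and w: "w \<in> Hom W" "post W Y p w = u" "post W X q w = \<phi> u"
    by (rule pair_object[OF Y(1) X u v])
  have gW: "is_gset G W"
    using W E_gset by blast
  have "inj_on p (pts W)"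
  proof (rule ccontr)
    assume "\<not> inj_on p (pts W)"
    then obtain w1 w2 where w12: "w1 \<in> Hom W" "w2 \<in> Hom W" "w1 \<noteq> w2" "post W Y p w1 = post W Y p w2"
      by (rule noninjective_lifts[OF W(1) Y(1) W(2)])
    \<comment> \<open>At w this holds by construction. Homogeneity carries w to any other w' by an
      automorphism, and equivariance carries the equation along.\<close>
    have q: "post W X q w' = \<phi> (post W Y p w')" if w': "w' \<in> Hom W" for w'
    proof -
      obtain \<sigma> where s: "\<sigma> \<in> carrier H" "pcomp W w \<sigma> = w'"
        using Hom_homogeneous[OF W(1) Hom_pts_nonempty[OF w'] w(1) w'] by blast
      have "post W X q w' = pcomp X (\<phi> u) \<sigma>"
        using pcomp_post[OF w(1) W(3) H_End[OF s(1)]] s w by simp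
      also have "\<dots> = \<phi> (pcomp Y u \<sigma>)"
        using gmaps_B_pcomp[OF \<phi> u s(1)] by simp
      also have "pcomp Y u \<sigma> = post W Y p w'"
        using pcomp_post[OF w(1) W(2) H_End[OF s(1)]] s w by simp
      finally show ?thesis .
    qed
    have "w1 = w2"
      by (rule pair_inj[OF w12(1,2) W(2-4) w12(4)]) (use q w12 in simp)
    then show False
      using w12 by blast
  qed
  then have p: "p \<in> gisos G W Y"
    using W by (simp add: gisosI)
  let ?r = "restrict (inv_into (pts W) p) (pts Y)"
  have r: "?r \<in> gisos G Y W"
    by (rule gisos_inv[OF gW E_gset[OF Y(1)] p])
  define g where "g = compose (pts Y) q ?r"
  have g: "g \<in> surj_gmaps G Y X"
    unfolding g_def using surj_gmaps_compose[OF E_gset[OF Y(1)] gisos_surj_gmaps[OF r] W(3)] .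
  have "compose (pts W) g p = q"
  proof (rule gmaps_eqI[of _ G W X _ X])
    show "compose (pts W) g p \<in> gmaps G W X"
      using gmaps_compose[OF gW surj_gmaps_gmaps[OF W(2)] surj_gmaps_gmaps[OF g]] .
    show "q \<in> gmaps G W X"
      using W surj_gmaps_gmaps by blast
    show "compose (pts W) g p x = q x" if "x \<in> pts W" for x
      using that gisos_bij[OF p] gmaps_mem[OF gisos_gmaps[OF p]]
      by (simp add: g_def compose_eq bij_betw_inv_into_left)
  qed
  then have gu: "post Y X g u = \<phi> u"
    using post_post[OF w(1) W(2) g gW] w by simp
  have "\<phi> = bmap Y X g"
  proof (rule gmaps_eqI[OF \<phi> bmap_gmaps[OF g]])
    fix u' assume "u' \<in> pts (B Y)"
    then have u': "u' \<in> Hom Y" by simp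
    obtain \<sigma> where s: "\<sigma> \<in> carrier H" "pcomp Y u \<sigma> = u'"
      using Hom_homogeneous[OF Y u u'] by blast
    show "\<phi> u' = bmap Y X g u'"
      using gmaps_B_pcomp[OF \<phi> u s(1)] pcomp_post[OF u g H_End[OF s(1)]] s u' gu
      by (simp add: bmap_def)
  qed
  then show ?thesis
    using that g by blast
qed

text \<open>An isomorphism and its inverse come from surjections in both directions, and a
  surjection cannot increase the number of orbits.\<close>

lemma gset_iso_B_rho:
  assumes "X \<in> E" "pts X \<noteq> {}" "Y \<in> E" "pts Y \<noteq> {}" "gset_iso H (B X) (B Y)"
  shows "rho G X = rho G Y"
proof -
  have le: "rho G Y' \<le> rho G X'" if "X' \<in> E" "pts X' \<noteq> {}" "Y' \<in> E" "\<phi> \<in> gmaps H (B X') (B Y')"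
    for X' Y' \<phi>
    using gmaps_B_surj[OF that(3,1,2,4)] rho_surj_le inE_finite[OF E_inE] that by metis
  obtain \<phi> where \<phi>: "\<phi> \<in> gisos H (B X) (B Y)"
    using assms by (auto simp: gset_iso_def)
  show ?thesis
    using le[OF assms(1,2,3) gisos_gmaps[OF \<phi>]]
      le[OF assms(3,4,1) gisos_gmaps[OF gisos_inv[OF is_gset_B is_gset_B \<phi>]]] by simp
qed

section \<open>Decomposition of fiber products\<close>

text \<open>The atoms of the fiber product of \<open>B Y\<close> and \<open>B X'\<close> over \<open>B X\<close> are the \<open>B D\<close> for the
  following \<open>D\<close>.\<close>

definition ample :: "('g, 'y) gset \<Rightarrow> ('y \<Rightarrow> 'x) \<Rightarrow> ('g, 'z) gset \<Rightarrow> ('z \<Rightarrow> 'x) \<Rightarrow> ('y \<times> 'z) set set" where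
  "ample Y f X' h = {D. invariant_set G (prod_gset Y X') D \<and> (\<forall>(y, z)\<in>D. f y = h z) \<and>
     fst ` D = pts Y \<and> snd ` D = pts X'}"

definition Bfiber :: "('g, 'g univ) gset \<Rightarrow> ('g, 'g univ) gset \<Rightarrow> ('g univ \<Rightarrow> 'g univ) \<Rightarrow>
    ('g, 'g univ) gset \<Rightarrow> ('g univ \<Rightarrow> 'g univ) \<Rightarrow>
    (('i \<times> ('g univ \<Rightarrow> 'g univ)) set \<times> ('i \<times> ('g univ \<Rightarrow> 'g univ)) set) set" where
  "Bfiber X Y f X' h = {(u, v). u \<in> Hom Y \<and> v \<in> Hom X' \<and> post Y X f u = post X' X h v}"

context
  fixes X Y X' :: "('g, 'g univ) gset" and f h and J :: "'j set" and W p q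
  assumes Y: "Y \<in> E" "pts Y \<noteq> {}" and X': "X' \<in> E"
    and f: "f \<in> surj_gmaps G Y X" and h: "h \<in> surj_gmaps G X' X"
    and WE: "\<And>i. i \<in> J \<Longrightarrow> W i \<in> E" and Wne: "\<And>i. i \<in> J \<Longrightarrow> pts (W i) \<noteq> {}"
    and p: "\<And>i. i \<in> J \<Longrightarrow> p i \<in> surj_gmaps G (W i) Y"
    and q: "\<And>i. i \<in> J \<Longrightarrow> q i \<in> surj_gmaps G (W i) X'"
begin

abbreviation "Wimg i \<equiv> (\<lambda>x. (p i x, q i x)) ` pts (W i)"
abbreviation "Bpair \<equiv> (\<lambda>(i, w). (post (W i) Y (p i) w, post (W i) X' (q i) w))"

lemma Bfiber_pimg:
  assumes uv: "(u, v) \<in> Bfiber X Y f X' h"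
  shows "pimg u v \<in> ample Y f X' h"
proof -
  have u: "u \<in> Hom Y" "v \<in> Hom X'"
    using uv by (auto simp: Bfiber_def)
  obtain i a b where i: "i \<in> I" "a \<in> surj_gmaps G (Ob i) Y" "u = cls Y i a"
    "b \<in> surj_gmaps G (Ob i) X'" "v = cls X' i b"
    using u by (rule Hom_cases2)
  have "post Y X f u = post X' X h v"
    using uv by (simp add: Bfiber_def)
  then have "f (a x) = h (b x)" if "x \<in> pts (Ob i)" for x
    using that unfolding i(3,5) cls_compose_eq[OF i(1,2,4) f h] by blast
  then show ?thesis
    using pimg_props[OF E_gset[OF Y(1)] E_gset[OF X'] u] i by (auto simp: ample_def pimg_cls)
qed

lemma Bpair_Bfiber_iff:
  assumes i: "i \<in> J" and w: "w \<in> Hom (W i)"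
  shows "Bpair (i, w) \<in> Bfiber X Y f X' h \<longleftrightarrow> (\<forall>x\<in>pts (W i). f (p i x) = h (q i x))"
proof -
  have gW: "is_gset G (W i)"
    using WE[OF i] by (rule E_gset)
  note s = surj_gmaps_compose[OF gW p[OF i] f] surj_gmaps_compose[OF gW q[OF i] h]
  have "Bpair (i, w) \<in> Bfiber X Y f X' h \<longleftrightarrow>
      post (W i) X (compose (pts (W i)) f (p i)) w = post (W i) X (compose (pts (W i)) h (q i)) w"
    using i w p q f h gW by (simp add: Bfiber_def post_Hom post_post)
  also have "\<dots> \<longleftrightarrow> compose (pts (W i)) f (p i) = compose (pts (W i)) h (q i)"
    using post_epi[OF w s] by auto
  also have "\<dots> \<longleftrightarrow> (\<forall>x\<in>pts (W i). f (p i x) = h (q i x))"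
    by (auto simp: compose_def fun_eq_iff restrict_def)
  finally show ?thesis .
qed

lemma pimg_Bpair: "i \<in> J \<Longrightarrow> w \<in> Hom (W i) \<Longrightarrow>
    pimg (post (W i) Y (p i) w) (post (W i) X' (q i) w) = Wimg i"
  using p q by (simp add: pimg_post)

text \<open>A pair in the fiber product lies in the piece indexed by its joint image. All pairs
  coming from W i have the same joint image (\<open>pimg_Bpair\<close>), so pieces do not overlap;
  \<open>pair_lift\<close> and \<open>pair_inj\<close> give existence and uniqueness of the lift to
  the right piece.\<close>

lemma decompose_Bfiber:
  assumes inj: "\<And>i. i \<in> J \<Longrightarrow> inj_on (\<lambda>x. (p i x, q i x)) (pts (W i))"
    and bij: "bij_betw (\<lambda>i. Wimg i) J (ample Y f X' h)"
  shows "bij_betw Bpair (SIGMA i:J. Hom (W i)) (Bfiber X Y f X' h)"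
  unfolding bij_betw_def
proof (intro conjI inj_onI equalityI subsetI)
  fix a b assume "a \<in> (SIGMA i:J. Hom (W i))" "b \<in> (SIGMA i:J. Hom (W i))" and e: "Bpair a = Bpair b"
  then obtain i w j w' where ab: "a = (i, w)" "b = (j, w')" "i \<in> J" "j \<in> J" "w \<in> Hom (W i)" "w' \<in> Hom (W j)"
    by blast
  have "Wimg i = Wimg j"
    using pimg_Bpair[of i w] pimg_Bpair[of j w'] e ab by simp
  then have ij: "i = j"
    using inj_onD[OF bij_betw_imp_inj_on[OF bij]] ab by blast
  have "w = w'"
    by (rule pair_inj[OF ab(5) _ p[OF ab(3)] q[OF ab(3)] inj[OF ab(3)]]) (use e ab ij in auto)
  then show "a = b"
    using ab ij by simp
next
  fix z assume "z \<in> Bpair ` (SIGMA i:J. Hom (W i))"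
  then obtain i w where z: "z = Bpair (i, w)" "i \<in> J" "w \<in> Hom (W i)"
    by blast
  have "Wimg i \<in> ample Y f X' h"
    using bij z by (auto simp: bij_betw_def)
  then have "\<forall>x\<in>pts (W i). f (p i x) = h (q i x)"
    by (auto simp: ample_def)
  then show "z \<in> Bfiber X Y f X' h"
    using Bpair_Bfiber_iff[OF z(2,3)] z(1) by simp
next
  fix z assume z: "z \<in> Bfiber X Y f X' h"
  then obtain u v where uv: "z = (u, v)" "u \<in> Hom Y" "v \<in> Hom X'"
    by (auto simp: Bfiber_def)
  have "pimg u v \<in> ample Y f X' h"
    using Bfiber_pimg z uv by blast
  then obtain i where i: "i \<in> J" "Wimg i = pimg u v"
    using bij by (metis (no_types, lifting) bij_betw_def imageE)
  obtain w where w: "w \<in> Hom (W i)" "post (W i) Y (p i) w = u" "post (W i) X' (q i) w = v"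
    by (rule pair_lift[OF uv(2,3) WE[OF i(1)] p[OF i(1)] q[OF i(1)] inj[OF i(1)] i(2)])
  then show "z \<in> Bpair ` (SIGMA i:J. Hom (W i))"
    using uv i by (intro image_eqI[of _ _ "(i, w)"]) auto
qed

text \<open>The converse, needed because a measure must satisfy its sum formula for every
  decomposition into atoms and not only for the one built from ample sets.\<close>

lemma Bfiber_decompose:
  assumes bij: "bij_betw Bpair (SIGMA i:J. Hom (W i)) (Bfiber X Y f X' h)"
  shows "\<And>i. i \<in> J \<Longrightarrow> inj_on (\<lambda>x. (p i x, q i x)) (pts (W i))"
    and "bij_betw (\<lambda>i. Wimg i) J (ample Y f X' h)"
proof -
  have fib: "Bpair (i, w) \<in> Bfiber X Y f X' h" if "i \<in> J" "w \<in> Hom (W i)" for i w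
    using bij that by (auto simp: bij_betw_def)
  have same: "i = j \<and> w = w'" if "i \<in> J" "j \<in> J" "w \<in> Hom (W i)" "w' \<in> Hom (W j)" "Bpair (i, w) = Bpair (j, w')"
    for i j w w'
    using inj_onD[OF bij_betw_imp_inj_on[OF bij] that(5)] that by auto
  have ample: "Wimg i \<in> ample Y f X' h" if i: "i \<in> J" for i
  proof -
    obtain w where w: "w \<in> Hom (W i)"
      using Hom_nonempty[OF WE[OF i] Wne[OF i]] by blast
    show ?thesis
      using Bfiber_pimg[of "post (W i) Y (p i) w" "post (W i) X' (q i) w"] fib[OF i w] pimg_Bpair[OF i w]
      by simp
  qed
  show inj: "inj_on (\<lambda>x. (p i x, q i x)) (pts (W i))" if i: "i \<in> J" for i
  proof (rule ccontr)
    assume ni: "\<not> inj_on (\<lambda>x. (p i x, q i x)) (pts (W i))"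
    have A: "invariant_set G (prod_gset Y X') (Wimg i)" "fst ` Wimg i = pts Y" "snd ` Wimg i = pts X'"
      using ample[OF i] by (auto simp: ample_def)
    \<comment> \<open>V is the image of the pair. If the pair is not injective, neither is the
      induced surjection W i -> V, so two different maps to W i have the same composite to V and
      hence give the same pair.\<close>
    obtain V p' q' where V: "V \<in> E" "p' \<in> surj_gmaps G V Y" "q' \<in> surj_gmaps G V X'"
      "inj_on (\<lambda>x. (p' x, q' x)) (pts V)" "(\<lambda>x. (p' x, q' x)) ` pts V = Wimg i"
      "(\<lambda>x\<in>pts V. (p' x, q' x)) \<in> gisos G V (sub_gset (prod_gset Y X') (Wimg i))"
      by (rule graph_object[OF E_inE[OF Y(1)] E_inE[OF X'] A])
    obtain g where g: "g \<in> surj_gmaps G (W i) V"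
      "\<And>x. x \<in> pts (W i) \<Longrightarrow> p' (g x) = p i x \<and> q' (g x) = q i x"
      using factor_through_pair[OF E_gset[OF WE[OF i]] E_gset[OF V(1)] surj_gmaps_gmaps[OF V(2)]
          surj_gmaps_gmaps[OF V(3)] V(4) surj_gmaps_gmaps[OF p[OF i]] surj_gmaps_gmaps[OF q[OF i]] V(5)]
      by blast
    have "\<not> inj_on g (pts (W i))"
    proof
      assume ig: "inj_on g (pts (W i))"
      have "x = y" if "x \<in> pts (W i)" "y \<in> pts (W i)" "(p i x, q i x) = (p i y, q i y)" for x y
      proof -
        have "g x = g y"
          using inj_onD[OF V(4), of "g x" "g y"] g(2) that gmaps_mem[OF surj_gmaps_gmaps[OF g(1)]] by simp
        then show ?thesis
          using inj_onD[OF ig] that by blast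
      qed
      then show False
        using ni unfolding inj_on_def by blast
    qed
    then obtain w w' where w: "w \<in> Hom (W i)" "w' \<in> Hom (W i)" "w \<noteq> w'" "post (W i) V g w = post (W i) V g w'"
      by (rule noninjective_lifts[OF WE[OF i] V(1) g(1)])
    have c: "compose (pts (W i)) p' g = p i" "compose (pts (W i)) q' g = q i"
      using g(2) gmaps_ext[OF surj_gmaps_gmaps[OF p[OF i]]] gmaps_ext[OF surj_gmaps_gmaps[OF q[OF i]]]
      by (auto simp: compose_def extensional_def fun_eq_iff)
    have "Bpair (i, w) = Bpair (i, w')"
      using post_post[OF w(1) g(1) V(2)] post_post[OF w(1) g(1) V(3)]
        post_post[OF w(2) g(1) V(2)] post_post[OF w(2) g(1) V(3)] w(4) E_gset[OF WE[OF i]] c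
      by simp
    then show False
      using same[OF i i w(1,2)] w(3) by blast
  qed
  show "bij_betw (\<lambda>i. Wimg i) J (ample Y f X' h)"
    unfolding bij_betw_def
  proof (intro conjI inj_onI equalityI subsetI)
    fix i j assume ij: "i \<in> J" "j \<in> J" and e: "Wimg i = Wimg j"
    obtain w where w: "w \<in> Hom (W i)"
      using Hom_nonempty[OF WE[OF ij(1)] Wne[OF ij(1)]] by blast
    have uv: "post (W i) Y (p i) w \<in> Hom Y" "post (W i) X' (q i) w \<in> Hom X'"
      using w p q ij post_Hom by blast+
    have "Wimg j = pimg (post (W i) Y (p i) w) (post (W i) X' (q i) w)"
      using pimg_Bpair[OF ij(1) w] e by simp
    then obtain w' where "w' \<in> Hom (W j)" "post (W j) Y (p j) w' = post (W i) Y (p i) w"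
      "post (W j) X' (q j) w' = post (W i) X' (q i) w"
      by (rule pair_lift[OF uv WE[OF ij(2)] p[OF ij(2)] q[OF ij(2)] inj[OF ij(2)]])
    then show "i = j"
      using same[OF ij w, of w'] by simp
  next
    fix D assume "D \<in> (\<lambda>i. Wimg i) ` J"
    then show "D \<in> ample Y f X' h"
      using ample by blast
  next
    fix D assume D: "D \<in> ample Y f X' h"
    then have A: "invariant_set G (prod_gset Y X') D" "fst ` D = pts Y" "snd ` D = pts X'"
      by (auto simp: ample_def)
    obtain V p' q' where V: "V \<in> E" "p' \<in> surj_gmaps G V Y" "q' \<in> surj_gmaps G V X'"
      "inj_on (\<lambda>x. (p' x, q' x)) (pts V)" "(\<lambda>x. (p' x, q' x)) ` pts V = D"
      "(\<lambda>x\<in>pts V. (p' x, q' x)) \<in> gisos G V (sub_gset (prod_gset Y X') D)"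
      by (rule graph_object[OF E_inE[OF Y(1)] E_inE[OF X'] A])
    have "pts V \<noteq> {}"
    proof
      assume "pts V = {}"
      then show False
        using surj_gmaps_image[OF V(2)] Y(2) by simp
    qed
    \<comment> \<open>Any z gives a pair whose joint image is D; the piece that contains this pair
      must then have image D.\<close>
    then obtain z where z: "z \<in> Hom V"
      using Hom_nonempty[OF V(1)] by blast
    have "f (p' x) = h (q' x)" if "x \<in> pts V" for x
      using D V(5) that by (auto simp: ample_def)
    then have c: "compose (pts V) f p' = compose (pts V) h q'"
      by (auto simp: compose_def)
    have "(post V Y p' z, post V X' q' z) \<in> Bfiber X Y f X' h"
      using z V f h c by (simp add: Bfiber_def post_Hom post_post E_gset)
    then have "(post V Y p' z, post V X' q' z) \<in> Bpair ` (SIGMA i:J. Hom (W i))"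
      unfolding bij_betw_imp_surj_on[OF bij] .
    then obtain i w where i: "i \<in> J" "w \<in> Hom (W i)" "Bpair (i, w) = (post V Y p' z, post V X' q' z)"
    proof (rule imageE)
      fix s assume s: "(post V Y p' z, post V X' q' z) = Bpair s" "s \<in> (SIGMA i:J. Hom (W i))"
      show thesis
        using s(2) by (rule SigmaE) (rule that, use s in simp_all)
    qed
    then have "Wimg i = D"
      using pimg_Bpair[OF i(1,2)] pimg_post[OF z V(2,3)] V(5) by simp
    then show "D \<in> (\<lambda>i. Wimg i) ` J"
      using i by blast
  qed
qed

end

section \<open>Ample sets and orbits\<close>

lemma fiber_set_invariant:
  assumes "is_gset G Y" "is_gset G X'" and f: "f \<in> gmaps G Y X" and h: "h \<in> gmaps G X' X"
  shows "invariant_set G (prod_gset Y X') {(y, z). y \<in> pts Y \<and> z \<in> pts X' \<and> f y = h z}"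
  using assms by (auto simp: invariant_set_def act_closed gmaps_act)

lemma pts_fiber_prod: "pts (fiber_prod Y f X' h) = {(y, z). y \<in> pts Y \<and> z \<in> pts X' \<and> f y = h z}"
  by (simp add: fiber_prod_def)

lemma orbs_invariant_sub:
  assumes "is_gset G X" "Q \<subseteq> orbs G X"
  shows "orbs G (sub_gset X (\<Union>Q)) = Q"
proof -
  have "orb G X ` \<Union>Q = Q"
  proof (intro equalityI subsetI)
    fix A assume "A \<in> orb G X ` \<Union>Q"
    then obtain x O' where "A = orb G X x" "x \<in> O'" "O' \<in> Q"
      by blast
    then show "A \<in> Q"
      using orbs_mem_eq[OF assms(1), of O' x] assms(2) by auto
  next
    fix A assume A: "A \<in> Q"
    then obtain x where x: "x \<in> pts X" "A = orb G X x"
      using assms(2) by (auto simp: orbs_def)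
    then have "x \<in> \<Union>Q"
      using A orb_refl[OF assms(1)] by blast
    then show "A \<in> orb G X ` \<Union>Q"
      using x by blast
  qed
  then show ?thesis
    by (simp add: orbs_sub invariant_orbs_Union[OF assms])
qed

text \<open>View the orbits of the fiber product as edges of a bipartite graph, possibly with
  multiple edges, between the orbits of Y and those of X'. The sets collected here are its edge
  covers: sets of edges that leave no vertex isolated.\<close>

definition covers :: "('g, 'y) gset \<Rightarrow> ('y \<Rightarrow> 'x) \<Rightarrow> ('g, 'z) gset \<Rightarrow> ('z \<Rightarrow> 'x) \<Rightarrow> ('y \<times> 'z) set set set"
  where "covers Y f X' h = {Q. Q \<subseteq> orbs G (fiber_prod Y f X' h) \<and>
    (`) fst ` Q = orbs G Y \<and> (`) snd ` Q = orbs G X'}"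

context
  fixes Y :: "('g, 'y) gset" and X' :: "('g, 'z) gset" and X :: "('g, 'x) gset" and f h
  assumes gY: "is_gset G Y" and gX': "is_gset G X'"
    and f: "f \<in> gmaps G Y X" and h: "h \<in> gmaps G X' X"
begin

abbreviation "Fib \<equiv> fiber_prod Y f X' h"

lemma is_gset_Fib: "is_gset G Fib"
  unfolding fiber_prod_def
  by (intro is_gset_sub is_gset_prod gY gX' fiber_set_invariant[OF gY gX' f h])

lemma orb_Fib: "z \<in> pts Fib \<Longrightarrow> orb G Fib z = orb G (prod_gset Y X') z"
  unfolding fiber_prod_def
  by (rule orb_sub[OF fiber_set_invariant[OF gY gX' f h]]) simp

lemma orbs_Fib_subset: "orbs G Fib \<subseteq> orbs G (prod_gset Y X')"
  unfolding fiber_prod_def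
  by (rule orbs_sub_subset[OF fiber_set_invariant[OF gY gX' f h]])

lemma orb_Fib_fst: "(y, z) \<in> pts Fib \<Longrightarrow> fst ` orb G Fib (y, z) = orb G Y y"
  and orb_Fib_snd: "(y, z) \<in> pts Fib \<Longrightarrow> snd ` orb G Fib (y, z) = orb G X' z"
proof -
  assume yz: "(y, z) \<in> pts Fib"
  have o: "orb G Fib (y, z) = {(act Y g y, act X' g z) | g. g \<in> carrier G}"
    by (subst orb_Fib[OF yz]) (use yz in \<open>auto simp: orbit_def pts_fiber_prod\<close>)
  show "fst ` orb G Fib (y, z) = orb G Y y" "snd ` orb G Fib (y, z) = orb G X' z"
    unfolding o by (auto simp: orbit_def image_iff)
qed

lemma orbs_Fib_fst: "r \<in> orbs G Fib \<Longrightarrow> fst ` r \<in> orbs G Y"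
  and orbs_Fib_snd: "r \<in> orbs G Fib \<Longrightarrow> snd ` r \<in> orbs G X'"
  by (auto simp: orbs_def orb_Fib_fst orb_Fib_snd pts_fiber_prod)

lemma orbs_eqI:
  assumes "is_gset G Z" "\<And>r. r \<in> Q \<Longrightarrow> k r \<in> orbs G Z"
  shows "k ` Q = orbs G Z \<longleftrightarrow> \<Union>(k ` Q) = pts Z"
proof
  assume "k ` Q = orbs G Z"
  then show "\<Union>(k ` Q) = pts Z"
    using Union_orbs[OF assms(1)] by simp
next
  assume U: "\<Union>(k ` Q) = pts Z"
  show "k ` Q = orbs G Z"
  proof (intro equalityI subsetI)
    fix A assume "A \<in> orbs G Z"
    then obtain x where x: "x \<in> pts Z" "A = orb G Z x"
      by (auto simp: orbs_def)
    then obtain r where r: "r \<in> Q" "x \<in> k r"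
      using U by blast
    then have "k r = A"
      using orbs_mem_eq[OF assms(1) assms(2)[OF r(1)] r(2)] x by simp
    then show "A \<in> k ` Q"
      using r by blast
  qed (use assms in auto)
qed

text \<open>An invariant subset is the union of the orbits it contains, and it surjects onto a
  factor exactly when these orbits reach every orbit of that factor.\<close>

lemma Union_covers: "bij_betw Union (covers Y f X' h) (ample Y f X' h)"
proof (rule bij_betw_imageI)
  show "inj_on Union (covers Y f X' h)"
  proof (rule inj_onI)
  fix Q Q' assume Q: "Q \<in> covers Y f X' h" "Q' \<in> covers Y f X' h" and e: "\<Union>Q = \<Union>Q'"
  have "Q \<subseteq> orbs G Fib" "Q' \<subseteq> orbs G Fib"
    using Q by (auto simp: covers_def)
  then show "Q = Q'"
    using orbs_invariant_sub[OF is_gset_Fib] e by metis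
  qed
  show "Union ` covers Y f X' h = ample Y f X' h"
  proof (intro equalityI subsetI)
  fix D assume "D \<in> Union ` covers Y f X' h"
  then obtain Q where D: "D = \<Union>Q" and Q: "Q \<subseteq> orbs G Fib"
    "(`) fst ` Q = orbs G Y" "(`) snd ` Q = orbs G X'"
    by (auto simp: covers_def)
  have "invariant_set G (prod_gset Y X') D"
    unfolding D
    by (rule invariant_orbs_Union[OF is_gset_prod[OF gY gX'] subset_trans[OF Q(1) orbs_Fib_subset]])
  moreover have "\<Union>Q \<subseteq> pts Fib"
    using Q(1) Union_orbs[OF is_gset_Fib] by auto
  moreover have "fst ` \<Union>Q = pts Y" "snd ` \<Union>Q = pts X'"
    using Q Union_orbs[OF gY] Union_orbs[OF gX'] by (simp_all add: image_Union)
  ultimately show "D \<in> ample Y f X' h"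
    by (auto simp: ample_def D pts_fiber_prod)
next
  fix D assume D: "D \<in> ample Y f X' h"
  then have inv: "invariant_set G (prod_gset Y X') D" and D': "fst ` D = pts Y" "snd ` D = pts X'"
    by (auto simp: ample_def)
  have DF: "D \<subseteq> pts Fib"
    using D unfolding ample_def invariant_set_def by (auto simp: pts_fiber_prod)
  define Q where "Q = orb G Fib ` D"
  have QR: "Q \<subseteq> orbs G Fib"
    unfolding Q_def using DF by (auto simp: orb_in_orbs)
  have DQ: "\<Union>Q = D"
  proof (intro equalityI subsetI)
    fix z assume "z \<in> \<Union>Q"
    then show "z \<in> D"
      using invariant_orb_subset[OF inv] DF orb_Fib unfolding Q_def by blast
  next
    fix z assume "z \<in> D"
    then show "z \<in> \<Union>Q"
      using orb_refl[OF is_gset_Fib, of z] DF unfolding Q_def by blast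
  qed
  have "(`) fst ` Q = orbs G Y"
    using orbs_eqI[OF gY, of Q "(`) fst", OF orbs_Fib_fst[OF subsetD[OF QR]]] DQ D' by (simp flip: image_Union)
  moreover have "(`) snd ` Q = orbs G X'"
    using orbs_eqI[OF gX', of Q "(`) snd", OF orbs_Fib_snd[OF subsetD[OF QR]]] DQ D' by (simp flip: image_Union)
  ultimately have "Q \<in> covers Y f X' h"
    using QR by (auto simp: covers_def)
  then show "D \<in> Union ` covers Y f X' h"
    using DQ by blast
qed
qed

lemma rho_covers: "Q \<in> covers Y f X' h \<Longrightarrow> rho G (sub_gset (prod_gset Y X') (\<Union>Q)) = card Q"
  unfolding rho_eq_card covers_def
  by (subst orbs_invariant_sub[OF is_gset_prod[OF gY gX']]) (use orbs_Fib_subset in auto)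

text \<open>Once the summand depends only on the number of orbits, the sum over subobjects is a
  count of edge covers by size.\<close>

lemma sum_ample: "(\<Sum>D\<in>ample Y f X' h. F (rho G (sub_gset (prod_gset Y X') D))) = (\<Sum>Q\<in>covers Y f X' h. F (card Q))"
  by (rule sum.reindex_bij_betw[OF Union_covers, symmetric, THEN trans]) (simp add: rho_covers)

lemma finite_ample: "finite (orbs G Fib) \<Longrightarrow> finite (ample Y f X' h)"
  using bij_betw_finite[OF Union_covers] by (auto simp: covers_def)

end

section \<open>The associated order\<close>

abbreviation "TH \<equiv> Aut_topology G E \<Omega>"
abbreviation "C \<equiv> assoc_order G E \<Omega>"
abbreviation "At \<equiv> atoms H C"

text \<open>A stabilizer is its own coset by the identity, hence one of the generating open sets;
  homogeneity leaves a single orbit.\<close>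

lemma B_smooth:
  assumes X: "X \<in> E" "pts X \<noteq> {}" shows "finitary_smooth H TH (B X)"
proof -
  interpret H: group H by (rule group_H)
  have "openin TH (stabilizer H (act (B X)) u)" if u: "u \<in> Hom X" for u
  proof -
    have "stabilizer H (act (B X)) u = \<one>\<^bsub>H\<^esub> <#\<^bsub>H\<^esub> stabilizer H (act (B X)) u"
      by (rule H.lcos_mult_one[symmetric]) (auto simp: stabilizer_def)
    then show ?thesis
      unfolding Aut_topology_def using u X H.one_closed by (intro topology_generated_by_Basis) blast
  qed
  then show ?thesis
    using B_orbs[OF X] is_gset_B by (auto simp: finitary_smooth_iff)
qed

lemma SG_gset: "A \<in> SG H TH \<Longrightarrow> is_gset H A"
  using finitary_smooth_gset by (auto simp: SG_def)

lemma atom_gset: "A \<in> At \<Longrightarrow> is_gset H A"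
  by (auto simp: atoms_def assoc_order_def SG_gset)

lemma atomE:
  assumes "A \<in> At"
  obtains X \<phi> where "X \<in> E" "pts X \<noteq> {}" "\<phi> \<in> gisos H A (B X)"
proof -
  have gA: "is_gset H A"
    using assms by (rule atom_gset)
  have "card (orbs H A) = 1"
    using assms by (simp add: atoms_def rho_eq_card)
  then obtain O' where O': "orbs H A = {O'}"
    by (auto simp: card_1_singleton_iff)
  then have pA: "pts A = O'"
    using Union_orbs[OF gA] by simp
  obtain X where X: "X \<in> E" "pts X \<noteq> {}" "gset_iso H (sub_gset A (pts A)) (B X)"
    using assms O' unfolding atoms_def assoc_order_def orbits_eq_orbs pA by auto
  have inv: "invariant_set H A (pts A)"
    using act_closed[OF gA] by (auto simp: invariant_set_def)
  have "restrict (\<lambda>x. x) (pts A) \<in> gmaps H A (sub_gset A (pts A))"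
    by (rule gmapsI[OF gA]) auto
  then have "(\<lambda>x\<in>pts A. x) \<in> gisos H A (sub_gset A (pts A))"
    by (auto simp: gisos_def bij_betw_def inj_on_def)
  then have "gset_iso H A (B X)"
    using gset_iso_trans[OF gA _ X(3)] by (auto simp: gset_iso_def)
  then show ?thesis
    using that X by (auto simp: gset_iso_def)
qed

lemma atomI:
  assumes A: "A \<in> SG H TH" and X: "X \<in> E" "pts X \<noteq> {}" and iso: "gset_iso H A (B X)"
  shows "A \<in> At"
proof -
  have gA: "is_gset H A"
    using A by (rule SG_gset)
  have r: "rho H A = 1"
    using gset_iso_rho[OF gA iso] B_orbs[OF X] by (simp add: rho_eq_card)
  then obtain O' where O': "orbs H A = {O'}"
    by (auto simp: rho_eq_card card_1_singleton_iff)
  then have pA: "pts A = O'"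
    using Union_orbs[OF gA] by simp
  have inv: "invariant_set H A (pts A)"
    using act_closed[OF gA] by (auto simp: invariant_set_def)
  have "restrict (\<lambda>x. x) (pts (sub_gset A (pts A))) \<in> gmaps H (sub_gset A (pts A)) A"
    by (rule gmapsI[OF is_gset_sub[OF gA inv]]) auto
  then have "(\<lambda>x\<in>pts A. x) \<in> gisos H (sub_gset A (pts A)) A"
    by (auto simp: gisos_def bij_betw_def inj_on_def)
  then have "gset_iso H (sub_gset A O') (B X)"
    using gset_iso_trans[OF is_gset_sub[OF gA inv] _ iso] pA by (auto simp: gset_iso_def)
  then show ?thesis
    using A X O' r by (auto simp: atoms_def assoc_order_def orbits_eq_orbs)
qed

lemma atom_exists:
  assumes X: "X \<in> E" "pts X \<noteq> {}"
  obtains A \<phi> where "A \<in> At" "\<phi> \<in> gisos H A (B X)"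
  using SG_representative[OF B_smooth[OF X]] atomI[OF _ X] unfolding gset_iso_def by blast

text \<open>All maps from the pro-object to a one-point set agree, so \<open>B X\<close> is a
  point.\<close>

lemma one_gset_iso:
  assumes X: "X \<in> E" and s: "is_singleton (pts X)"
  shows "gset_iso H one_gset (B X)"
proof -
  have ne: "pts X \<noteq> {}"
    using s by (auto simp: is_singleton_def)
  have "u = v" if uv: "u \<in> Hom X" "v \<in> Hom X" for u v
  proof -
    obtain i f h where i: "i \<in> I" "f \<in> surj_gmaps G (Ob i) X" "u = cls X i f"
      "h \<in> surj_gmaps G (Ob i) X" "v = cls X i h"
      using uv by (rule Hom_cases2)
    have "f = h"
    proof (rule gmaps_eqI[OF surj_gmaps_gmaps[OF i(2)] surj_gmaps_gmaps[OF i(4)]])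
      fix x assume "x \<in> pts (Ob i)"
      then have "f x \<in> pts X" "h x \<in> pts X"
        using gmaps_mem[OF surj_gmaps_gmaps[OF i(2)]] gmaps_mem[OF surj_gmaps_gmaps[OF i(4)]] by auto
      then show "f x = h x"
        using s by (auto simp: is_singleton_def)
    qed
    then show ?thesis
      using i by simp
  qed
  then obtain u where u: "Hom X = {u}"
    using Hom_nonempty[OF X ne] by blast
  have g: "is_gset H (one_gset :: (('i, 'g univ) pro_endo, ('i, 'g univ) pro_endo univ) gset)"
    using is_gset_trivial[OF group_H, of "{(0, {})}"] by (simp add: one_gset_def trivial_gset_def)
  have a: "act (B X) \<sigma> u = u" if "\<sigma> \<in> carrier H" for \<sigma>
    using act_closed[OF is_gset_B that, of u X] u by simp
  have "restrict (\<lambda>_. u) (pts (one_gset :: (('i, 'g univ) pro_endo, ('i, 'g univ) pro_endo univ) gset))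
      \<in> gmaps H one_gset (B X)"
    by (rule gmapsI[OF g]) (simp_all add: u a)
  then have "(\<lambda>x\<in>{(0, {})}. u) \<in> gisos H one_gset (B X)"
    by (auto simp: gisos_def one_gset_def u bij_betw_def)
  then show ?thesis
    by (auto simp: gset_iso_def)
qed

lemma singleton_object: obtains X where "X \<in> E" "is_singleton (pts X)" "rho G X = 1"
proof -
  obtain X where X: "X \<in> E" "gset_iso G X (trivial_gset {0::nat})"
    using inE_trivial[of "{0::nat}"] by (auto simp: inE_def)
  then obtain f where "bij_betw f (pts X) {0::nat}"
    by (auto simp: gset_iso_def gisos_def)
  then have s: "is_singleton (pts X)"
    by (metis bij_betw_same_card is_singleton_altdef is_singletonI)
  moreover have "orbs G X = {pts X}"
    using s Union_orbs[OF E_gset[OF X(1)]] orb_refl[OF E_gset[OF X(1)]] orb_subset[OF E_gset[OF X(1)]]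
    by (auto simp: is_singleton_def orbs_def)
  ultimately show ?thesis
    using that X by (simp add: rho_eq_card)
qed

lemma one_atom: "one_gset \<in> At"
proof -
  obtain X where X: "X \<in> E" "is_singleton (pts X)"
    by (rule singleton_object)
  then have ne: "pts X \<noteq> {}"
    by (auto simp: is_singleton_def)
  have g: "is_gset H (one_gset :: (('i, 'g univ) pro_endo, ('i, 'g univ) pro_endo univ) gset)"
    using is_gset_trivial[OF group_H, of "{(0, {})}"] by (simp add: one_gset_def trivial_gset_def)
  have "finitary_smooth H TH (one_gset :: (('i, 'g univ) pro_endo, ('i, 'g univ) pro_endo univ) gset)"
    using finitary_smooth_iso[OF B_smooth[OF X(1) ne] g] gset_iso_sym[OF g is_gset_B one_gset_iso[OF X]] .
  then show ?thesis
    using atomI[OF _ X(1) ne one_gset_iso[OF X]] by (simp add: SG_def)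
qed

text \<open>\<open>gmaps_B_surj\<close> transported through chosen identifications of the atoms with
  \<open>B Y\<close> and \<open>B X\<close>.\<close>

lemma atom_map:
  assumes AY: "AY \<in> At" "\<phi>Y \<in> gisos H AY (B Y)" "Y \<in> E" "pts Y \<noteq> {}"
    and AX: "\<phi>X \<in> gisos H AX (B X)" "X \<in> E" and F: "F \<in> gmaps H AY AX"
  shows "\<exists>f\<in>surj_gmaps G Y X. \<forall>a\<in>pts AY. \<phi>X (F a) = post Y X f (\<phi>Y a)"
proof -
  let ?\<psi> = "restrict (inv_into (pts AY) \<phi>Y) (pts (B Y))"
  have gA: "is_gset H AY"
    using AY by (simp add: atom_gset)
  have \<psi>: "?\<psi> \<in> gisos H (B Y) AY"
    by (rule gisos_inv[OF gA is_gset_B AY(2)])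
  have "compose (pts AY) \<phi>X F \<in> gmaps H AY (B X)"
    using gmaps_compose[OF gA F gisos_gmaps[OF AX(1)]] .
  then have "compose (pts (B Y)) (compose (pts AY) \<phi>X F) ?\<psi> \<in> gmaps H (B Y) (B X)"
    using gmaps_compose[OF is_gset_B gisos_gmaps[OF \<psi>]] by blast
  then obtain f where f: "f \<in> surj_gmaps G Y X"
    "compose (pts (B Y)) (compose (pts AY) \<phi>X F) ?\<psi> = bmap Y X f"
    by (rule gmaps_B_surj[OF AX(2) AY(3,4)])
  have "\<phi>X (F a) = post Y X f (\<phi>Y a)" if a: "a \<in> pts AY" for a
  proof -
    have "\<phi>Y a \<in> Hom Y"
      using gmaps_mem[OF gisos_gmaps[OF AY(2)] a] by simp
    then show ?thesis
      using fun_cong[OF f(2), of "\<phi>Y a"] a bij_betw_inv_into_left[OF gisos_bij[OF AY(2)] a]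
      by (simp add: compose_eq bmap_def)
  qed
  then show ?thesis
    using f by blast
qed

lemma Bfiber_bij:
  assumes \<phi>Y: "\<phi>Y \<in> gisos H AY (B Y)" and \<phi>X': "\<phi>X' \<in> gisos H AX' (B X')"
    and \<phi>X: "\<phi>X \<in> gisos H AX (B X)"
    and F: "F \<in> gmaps H AY AX" "\<And>a. a \<in> pts AY \<Longrightarrow> \<phi>X (F a) = post Y X f (\<phi>Y a)"
    and K: "K \<in> gmaps H AX' AX" "\<And>a. a \<in> pts AX' \<Longrightarrow> \<phi>X (K a) = post X' X h (\<phi>X' a)"
  shows "bij_betw (map_prod \<phi>Y \<phi>X') (pts (fiber_prod AY F AX' K)) (Bfiber X Y f X' h)"
proof -
  have b: "bij_betw (map_prod \<phi>Y \<phi>X') (pts AY \<times> pts AX') (Hom Y \<times> Hom X')"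
    using bij_betw_map_prod[OF gisos_bij[OF \<phi>Y] gisos_bij[OF \<phi>X']] by simp
  have iff: "F a = K b \<longleftrightarrow> post Y X f (\<phi>Y a) = post X' X h (\<phi>X' b)" if "a \<in> pts AY" "b \<in> pts AX'" for a b
    using inj_on_eq_iff[OF bij_betw_imp_inj_on[OF gisos_bij[OF \<phi>X]], of "F a" "K b"]
      F(2)[OF that(1)] K(2)[OF that(2)] gmaps_mem[OF F(1) that(1)] gmaps_mem[OF K(1) that(2)] by metis
  have "map_prod \<phi>Y \<phi>X' ` pts (fiber_prod AY F AX' K) = Bfiber X Y f X' h"
  proof (intro equalityI subsetI)
    fix z assume "z \<in> map_prod \<phi>Y \<phi>X' ` pts (fiber_prod AY F AX' K)"
    then obtain a b where ab: "a \<in> pts AY" "b \<in> pts AX'" "F a = K b" "z = (\<phi>Y a, \<phi>X' b)"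
      unfolding pts_fiber_prod by force
    then show "z \<in> Bfiber X Y f X' h"
      using iff[OF ab(1,2)] gmaps_mem[OF gisos_gmaps[OF \<phi>Y]] gmaps_mem[OF gisos_gmaps[OF \<phi>X']]
      by (auto simp: Bfiber_def)
  next
    fix z assume z: "z \<in> Bfiber X Y f X' h"
    then have "z \<in> map_prod \<phi>Y \<phi>X' ` (pts AY \<times> pts AX')"
      using bij_betw_imp_surj_on[OF b] by (auto simp: Bfiber_def)
    then obtain a b where ab: "a \<in> pts AY" "b \<in> pts AX'" "z = (\<phi>Y a, \<phi>X' b)"
      by force
    then have "F a = K b"
      using iff z by (simp add: Bfiber_def)
    then show "z \<in> map_prod \<phi>Y \<phi>X' ` pts (fiber_prod AY F AX' K)"
      using ab by (intro image_eqI[of _ _ "(a, b)"]) (auto simp: pts_fiber_prod)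
  qed
  moreover have "inj_on (map_prod \<phi>Y \<phi>X') (pts (fiber_prod AY F AX' K))"
    by (rule inj_on_subset[OF bij_betw_imp_inj_on[OF b]]) (auto simp: pts_fiber_prod)
  ultimately show ?thesis
    by (simp add: bij_betw_def)
qed

text \<open>Identifying each A i with \<open>B (W i)\<close> relates the two parametrizations by a
  commuting square whose vertical maps are bijections. It is an equivalence because one direction
  analyzes a given decomposition and the other builds one.\<close>

lemma Bpair_bij_iff:
  assumes \<Phi>: "bij_betw (map_prod \<phi>Y \<phi>X') S (Bfiber X Y f X' h)"
    and \<theta>: "\<And>i. i \<in> J \<Longrightarrow> \<theta> i \<in> gisos H (A i) (B (W i))"
    and P: "\<And>i a. i \<in> J \<Longrightarrow> a \<in> pts (A i) \<Longrightarrow> \<phi>Y (P i a) = post (W i) Y (p i) (\<theta> i a)"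
    and Q: "\<And>i a. i \<in> J \<Longrightarrow> a \<in> pts (A i) \<Longrightarrow> \<phi>X' (Q i a) = post (W i) X' (q i) (\<theta> i a)"
    and S: "(\<lambda>(i, a). (P i a, Q i a)) ` (SIGMA i:J. pts (A i)) \<subseteq> S"
  shows "bij_betw (\<lambda>(i, a). (P i a, Q i a)) (SIGMA i:J. pts (A i)) S \<longleftrightarrow>
    bij_betw (\<lambda>(i, w). (post (W i) Y (p i) w, post (W i) X' (q i) w)) (SIGMA i:J. Hom (W i)) (Bfiber X Y f X' h)"
    (is "bij_betw ?\<Psi> ?A S \<longleftrightarrow> bij_betw ?\<Psi>' ?A' _")
proof -
  let ?\<Theta> = "\<lambda>(i, a). (i, \<theta> i a)"
  have \<Theta>: "bij_betw ?\<Theta> ?A ?A'"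
  proof -
    have b: "bij_betw (\<theta> i) (pts (A i)) (Hom (W i))" if "i \<in> J" for i
      using gisos_bij[OF \<theta>[OF that]] by simp
    have "inj_on ?\<Theta> ?A"
    proof (rule inj_onI)
      fix y z assume yz: "y \<in> ?A" "z \<in> ?A" and e: "?\<Theta> y = ?\<Theta> z"
      obtain i a j a' where ia: "y = (i, a)" "z = (j, a')"
        by (metis surj_pair)
      have "a = a'"
        by (rule inj_onD[OF bij_betw_imp_inj_on[OF b[of i]]]) (use yz e ia in auto)
      then show "y = z"
        using e ia by simp
    qed
    moreover have "?\<Theta> ` ?A = ?A'"
    proof (intro equalityI subsetI)
      fix z assume "z \<in> ?A'"
      then obtain i w where iw: "z = (i, w)" "i \<in> J" "w \<in> Hom (W i)"
        by blast
      then obtain a where "a \<in> pts (A i)" "w = \<theta> i a"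
        using bij_betw_imp_surj_on[OF b[OF iw(2)]] by blast
      then show "z \<in> ?\<Theta> ` ?A"
        using iw by (intro image_eqI[of _ _ "(i, a)"]) auto
    qed (use bij_betw_imp_surj_on[OF b] in auto)
    ultimately show ?thesis
      by (simp add: bij_betw_def)
  qed
  have c: "(map_prod \<phi>Y \<phi>X' \<circ> ?\<Psi>) z = (?\<Psi>' \<circ> ?\<Theta>) z" if "z \<in> ?A" for z
    using that P Q by auto
  have "bij_betw ?\<Psi>' ?A' (Bfiber X Y f X' h) \<longleftrightarrow> bij_betw (?\<Psi>' \<circ> ?\<Theta>) ?A (Bfiber X Y f X' h)"
    by (rule bij_betw_comp_iff[OF \<Theta>])
  also have "\<dots> \<longleftrightarrow> bij_betw (map_prod \<phi>Y \<phi>X' \<circ> ?\<Psi>) ?A (Bfiber X Y f X' h)"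
    by (rule bij_betw_cong) (use c in auto)
  also have "\<dots> \<longleftrightarrow> bij_betw ?\<Psi> ?A S"
    by (rule bij_betw_comp_iff2[OF \<Phi> S, symmetric])
  finally show ?thesis by simp
qed

end

section \<open>Signed counts of edge covers\<close>

lemma sum_Pow_power:
  fixes c :: "'a::comm_ring_1"
  assumes "finite A"
  shows "(\<Sum>S\<in>Pow A. c ^ card S) = (1 + c) ^ card A"
proof -
  have "(\<Prod>x\<in>A. c + 1) = (\<Sum>S\<in>Pow A. (\<Prod>x\<in>S. c) * (\<Prod>x\<in>A - S. 1))"
    by (rule prod_add[OF assms])
  then show ?thesis
    by (simp add: add.commute)
qed

text \<open>Choosing a subset of A amounts to choosing, independently, a subset of each fiber of f;
  so the sum of products factors.\<close>

lemma sum_Pow_fiberwise: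
  fixes F :: "'b \<Rightarrow> 'a set \<Rightarrow> 'c::comm_ring_1"
  assumes A: "finite A" and B: "finite B" and f: "f ` A \<subseteq> B"
  shows "(\<Sum>S\<in>Pow A. \<Prod>b\<in>B. F b {a \<in> S. f a = b}) = (\<Prod>b\<in>B. \<Sum>S\<in>Pow {a \<in> A. f a = b}. F b S)"
proof -
  have "(\<Prod>b\<in>B. \<Sum>S\<in>Pow {a \<in> A. f a = b}. F b S) =
      (\<Sum>g\<in>PiE B (\<lambda>b. Pow {a \<in> A. f a = b}). \<Prod>b\<in>B. F b (g b))"
    using A B by (intro prod_sum_PiE) auto
  also have "\<dots> = (\<Sum>S\<in>Pow A. \<Prod>b\<in>B. F b {a \<in> S. f a = b})"
  proof (rule sum.reindex_bij_witness[where i = "\<lambda>S. \<lambda>b\<in>B. {a \<in> S. f a = b}" and j = "\<lambda>g. \<Union>b\<in>B. g b"])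
    fix g assume g: "g \<in> PiE B (\<lambda>b. Pow {a \<in> A. f a = b})"
    have gb: "{a \<in> \<Union>b\<in>B. g b. f a = b} = g b" if "b \<in> B" for b
      using g that by (auto simp: PiE_iff)
    show "(\<lambda>b\<in>B. {a \<in> \<Union>b\<in>B. g b. f a = b}) = g"
      using g gb by (intro extensionalityI[of _ B]) (auto simp: PiE_iff)
    show "(\<Prod>b\<in>B. F b {a \<in> \<Union>b\<in>B. g b. f a = b}) = (\<Prod>b\<in>B. F b (g b))"
      using gb by (intro prod.cong) auto
    show "(\<Union>b\<in>B. g b) \<in> Pow A"
      using g by (auto simp: PiE_iff)
  next
    fix S assume "S \<in> Pow A"
    then show "(\<Union>b\<in>B. (\<lambda>b\<in>B. {a \<in> S. f a = b}) b) = S"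
      and "(\<lambda>b\<in>B. {a \<in> S. f a = b}) \<in> PiE B (\<lambda>b. Pow {a \<in> A. f a = b})"
      using f by auto
  qed
  finally show ?thesis by simp
qed

lemma card_fiberwise:
  assumes "finite A" "finite B" "f ` A \<subseteq> B"
  shows "card A = (\<Sum>b\<in>B. card {a \<in> A. f a = b})"
  using sum.group[OF assms, of "\<lambda>_. 1 :: nat"] by simp

text \<open>Inclusion-exclusion as an indicator function: in terms of complements the sum is (1 -
  1)^n with n the size of Y - A.\<close>

lemma sum_alternating_supersets:
  fixes A Y :: "'a set"
  assumes "finite Y" "A \<subseteq> Y"
  shows "(\<Sum>S\<in>Pow Y. if A \<subseteq> S then (-1) ^ card (Y - S) else 0 :: int) = (if A = Y then 1 else 0)"
proof -
  have "(\<Sum>S\<in>Pow Y. if A \<subseteq> S then (-1) ^ card (Y - S) else 0 :: int) =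
      (\<Sum>S\<in>{S \<in> Pow Y. A \<subseteq> S}. (-1) ^ card (Y - S))"
    using assms by (simp add: sum.If_cases Int_def)
  also have "\<dots> = (\<Sum>V\<in>Pow (Y - A). (-1) ^ card V)"
    by (rule sum.reindex_bij_witness[of _ "\<lambda>V. Y - V" "\<lambda>S. Y - S"])
      (use assms in \<open>auto simp: double_diff\<close>)
  also have "\<dots> = 0 ^ card (Y - A)"
    using assms by (subst sum_Pow_power) auto
  also have "\<dots> = (if A = Y then 1 else 0)"
    using assms by (auto simp: power_0_left card_eq_0_iff)
  finally show ?thesis .
qed

text \<open>A bipartite multigraph over X: R is the set of edges, a and b give the two ends, and an
  edge only joins vertices over the same point of X. In the application all four sets are sets of
  orbits.\<close>

locale edge_cover =
  fixes R :: "'r set" and Y :: "'y set" and Z :: "'z set" and X :: "'x set"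
    and a :: "'r \<Rightarrow> 'y" and b :: "'r \<Rightarrow> 'z" and f :: "'y \<Rightarrow> 'x" and h :: "'z \<Rightarrow> 'x"
  assumes finR: "finite R" and finY: "finite Y" and finZ: "finite Z"
    and a: "a ` R \<subseteq> Y" and b: "b ` R \<subseteq> Z" and f: "f ` Y = X" and h: "h ` Z = X"
    and fahb: "\<And>r. r \<in> R \<Longrightarrow> f (a r) = h (b r)"
begin

lemma finX: "finite X"
  using finY f by auto

definition deg :: "'y set \<Rightarrow> 'z \<Rightarrow> nat" where
  "deg S z = card {r \<in> R. a r \<in> S \<and> b r = z}"

lemma deg_eq_sum: "S \<subseteq> Y \<Longrightarrow> deg S z = (\<Sum>y\<in>S. card {r \<in> R. a r = y \<and> b r = z})"
proof -
  assume S: "S \<subseteq> Y"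
  have "finite S"
    using S finY finite_subset by blast
  then have "deg S z = (\<Sum>y\<in>S. card {r \<in> {r \<in> R. a r \<in> S \<and> b r = z}. a r = y})"
    unfolding deg_def by (intro card_fiberwise) (use finR in auto)
  also have "\<dots> = (\<Sum>y\<in>S. card {r \<in> R. a r = y \<and> b r = z})"
    by (intro sum.cong refl arg_cong[of _ _ card]) auto
  finally show ?thesis .
qed

text \<open>If only the vertices of Z have to be covered, the edges at different z are chosen
  independently, and at each z the choice must be nonempty. The factor is the binomial sum over all
  choices minus the empty one.\<close>

lemma cover_sum_right:
  fixes c :: int
  shows "(\<Sum>Q\<in>{Q \<in> Pow {r \<in> R. a r \<in> S}. b ` Q = Z}. c ^ card Q) = (\<Prod>z\<in>Z. (1 + c) ^ deg S z - 1)"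
proof -
  let ?R = "{r \<in> R. a r \<in> S}"
  let ?F = "\<lambda>z Q. if Q = {} then 0 else c ^ card Q"
  have fR: "finite ?R"
    using finR by simp
  have "(\<Sum>Q\<in>{Q \<in> Pow ?R. b ` Q = Z}. c ^ card Q) = (\<Sum>Q\<in>Pow ?R. if b ` Q = Z then c ^ card Q else 0)"
    using fR by (simp add: sum.If_cases Int_def)
  also have "\<dots> = (\<Sum>Q\<in>Pow ?R. \<Prod>z\<in>Z. ?F z {r \<in> Q. b r = z})"
  proof (rule sum.cong[OF refl])
    fix Q assume Q: "Q \<in> Pow ?R"
    then have fQ: "finite Q" and bQ: "b ` Q \<subseteq> Z"
      using fR b finite_subset by auto
    show "(if b ` Q = Z then c ^ card Q else 0) = (\<Prod>z\<in>Z. ?F z {r \<in> Q. b r = z})"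
    proof (cases "b ` Q = Z")
      case True
      have "(\<Prod>z\<in>Z. ?F z {r \<in> Q. b r = z}) = (\<Prod>z\<in>Z. c ^ card {r \<in> Q. b r = z})"
        using True by (intro prod.cong) auto
      then show ?thesis
        using True card_fiberwise[OF fQ finZ bQ] by (simp add: power_sum)
    next
      case False
      then obtain z where "z \<in> Z" "z \<notin> b ` Q"
        using bQ by blast
      then have "{r \<in> Q. b r = z} = {}" "z \<in> Z"
        by auto
      then have "(\<Prod>z\<in>Z. ?F z {r \<in> Q. b r = z}) = 0"
        using finZ by (intro prod_zero) auto
      then show ?thesis
        using False by simp
    qed
  qed
  also have "\<dots> = (\<Prod>z\<in>Z. \<Sum>Q\<in>Pow {r \<in> ?R. b r = z}. ?F z Q)"
    by (rule sum_Pow_fiberwise) (use fR finZ b in auto)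
  also have "\<dots> = (\<Prod>z\<in>Z. (1 + c) ^ deg S z - 1)"
  proof (rule prod.cong[OF refl])
    fix z
    let ?A = "{r \<in> ?R. b r = z}"
    have fA: "finite ?A"
      using finR by simp
    have "(\<Sum>Q\<in>Pow ?A. ?F z Q) = (\<Sum>Q\<in>Pow ?A - {{}}. c ^ card Q)"
      using finR by (intro sum.mono_neutral_cong_right) auto
    also have "\<dots> = (\<Sum>Q\<in>Pow ?A. c ^ card Q) - 1"
      using finR by (subst sum_diff1) auto
    also have "\<dots> = (1 + c) ^ deg S z - 1"
      using sum_Pow_power[OF fA, of c] by (simp add: deg_def conj_assoc)
    finally show "(\<Sum>Q\<in>Pow ?A. ?F z Q) = (1 + c) ^ deg S z - 1" .
  qed
  finally show ?thesis .
qed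

text \<open>The covering condition at Y is traded, by inclusion-exclusion, for a sum over the set S
  of allowed ends in Y; what remains is the one-sided count.\<close>

lemma cover_sum:
  fixes c :: int
  shows "(\<Sum>Q\<in>{Q. Q \<subseteq> R \<and> a ` Q = Y \<and> b ` Q = Z}. c ^ card Q) =
    (\<Sum>S\<in>Pow Y. (-1) ^ card (Y - S) * (\<Prod>z\<in>Z. (1 + c) ^ deg S z - 1))"
proof -
  let ?P = "{Q \<in> Pow R. b ` Q = Z}"
  have fP: "finite ?P"
    using finR by simp
  have "(\<Sum>Q\<in>{Q. Q \<subseteq> R \<and> a ` Q = Y \<and> b ` Q = Z}. c ^ card Q) =
      (\<Sum>Q\<in>?P. (if a ` Q = Y then 1 else 0) * c ^ card Q)"
    using fP by (intro sum.mono_neutral_cong_left) auto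
  also have "\<dots> = (\<Sum>Q\<in>?P. (\<Sum>S\<in>Pow Y. if a ` Q \<subseteq> S then (-1) ^ card (Y - S) else 0) * c ^ card Q)"
    by (intro sum.cong refl arg_cong2[of _ _ _ _ "(*)"] sum_alternating_supersets[symmetric])
      (use finY a in auto)
  also have "\<dots> = (\<Sum>S\<in>Pow Y. \<Sum>Q\<in>?P. (if a ` Q \<subseteq> S then (-1) ^ card (Y - S) else 0) * c ^ card Q)"
    by (subst sum.swap) (simp add: sum_distrib_right)
  also have "\<dots> = (\<Sum>S\<in>Pow Y. (-1) ^ card (Y - S) * (\<Sum>Q\<in>{Q \<in> Pow {r \<in> R. a r \<in> S}. b ` Q = Z}. c ^ card Q))"
  proof (rule sum.cong[OF refl])
    fix S
    have "(\<Sum>Q\<in>?P. (if a ` Q \<subseteq> S then (-1) ^ card (Y - S) else 0) * c ^ card Q) =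
        (\<Sum>Q\<in>{Q \<in> Pow {r \<in> R. a r \<in> S}. b ` Q = Z}. (-1) ^ card (Y - S) * c ^ card Q)"
      using fP by (intro sum.mono_neutral_cong_right) auto
    then show "(\<Sum>Q\<in>?P. (if a ` Q \<subseteq> S then (-1) ^ card (Y - S) else 0) * c ^ card Q) =
        (-1) ^ card (Y - S) * (\<Sum>Q\<in>{Q \<in> Pow {r \<in> R. a r \<in> S}. b ` Q = Z}. c ^ card Q)"
      by (simp add: sum_distrib_left)
  qed
  finally show ?thesis
    by (simp only: cover_sum_right)
qed

lemma sign_complement: "S \<in> Pow Y \<Longrightarrow> (-1) ^ card (Y - S) = (-1 :: int) ^ card Y * (-1) ^ card S"
proof -
  assume S: "S \<in> Pow Y"
  then have "finite S"
    using finY finite_subset by auto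
  then have "card Y = card (Y - S) + card S"
    using S finY by (simp add: card_Diff_subset card_mono)
  then show ?thesis
    by (simp add: power_add)
qed

text \<open>For c = -1 the factor at z is -1 if some edge joins S to z, and 0 otherwise. So only the
  S that map onto X contribute, and their signed count is again a one-sided cover sum.\<close>

lemma cover_sum_minus_one:
  assumes N: "\<And>y z. y \<in> Y \<Longrightarrow> z \<in> Z \<Longrightarrow> f y = h z \<Longrightarrow> \<exists>r\<in>R. a r = y \<and> b r = z"
  shows "(\<Sum>Q\<in>{Q. Q \<subseteq> R \<and> a ` Q = Y \<and> b ` Q = Z}. (-1 :: int) ^ card Q) * (-1) ^ card X =
    (-1) ^ (card Y + card Z)"
proof -
  have deg0: "deg S z = 0 \<longleftrightarrow> h z \<notin> f ` S" if S: "S \<subseteq> Y" and z: "z \<in> Z" for S z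
  proof -
    have "deg S z = 0 \<longleftrightarrow> (\<forall>r\<in>R. a r \<in> S \<longrightarrow> b r \<noteq> z)"
      using finR by (auto simp: deg_def)
    also have "\<dots> \<longleftrightarrow> h z \<notin> f ` S"
    proof
      assume *: "\<forall>r\<in>R. a r \<in> S \<longrightarrow> b r \<noteq> z"
      show "h z \<notin> f ` S"
      proof
        assume "h z \<in> f ` S"
        then obtain y where y: "y \<in> S" "f y = h z"
          by auto
        then show False
          using N[of y z] S z * by blast
      qed
    qed (metis fahb image_eqI)
    finally show ?thesis .
  qed
  have prod: "(\<Prod>z\<in>Z. (1 + (-1)) ^ deg S z - 1) = (if f ` S = X then (-1) ^ card Z else (0 :: int))"
    if S: "S \<in> Pow Y" for S
  proof (cases "f ` S = X")
    case True
    then have "(\<Prod>z\<in>Z. (1 + (-1)) ^ deg S z - 1) = (\<Prod>z\<in>Z. (-1 :: int))"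
      using deg0 S h by (intro prod.cong) (auto simp: power_0_left)
    then show ?thesis
      using True by simp
  next
    case False
    moreover have "f ` S \<subseteq> X"
      using S f by auto
    ultimately obtain x where "x \<in> X" "x \<notin> f ` S"
      by blast
    then obtain z where "z \<in> Z" "h z \<notin> f ` S"
      using h by auto
    then have "z \<in> Z" "deg S z = 0"
      using deg0 S by auto
    then have "(\<Prod>z\<in>Z. (1 + (-1)) ^ deg S z - 1) = (0 :: int)"
      using finZ by (intro prod_zero) (auto intro!: bexI[of _ z])
    then show ?thesis
      using False by simp
  qed
  \<comment> \<open>Here the elements of Y serve as edges, with both ends equal to their image in X;
    the covers are then the subsets of Y that map onto X.\<close>
  interpret right: edge_cover Y X X X f f id id
    by unfold_locales (use finY finX f in auto)
  have "(\<Sum>S\<in>{S \<in> Pow {y \<in> Y. f y \<in> UNIV}. f ` S = X}. (-1 :: int) ^ card S) =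
      (\<Prod>x\<in>X. (1 + (-1)) ^ right.deg UNIV x - 1)"
    by (rule right.cover_sum_right)
  also have "\<dots> = (\<Prod>x\<in>X. -1)"
    using f finY by (intro prod.cong) (auto simp: right.deg_def power_0_left)
  finally have s: "(\<Sum>S\<in>{S \<in> Pow Y. f ` S = X}. (-1 :: int) ^ card S) = (-1) ^ card X"
    by simp
  have "(\<Sum>Q\<in>{Q. Q \<subseteq> R \<and> a ` Q = Y \<and> b ` Q = Z}. (-1 :: int) ^ card Q) =
      (\<Sum>S\<in>Pow Y. (-1) ^ card (Y - S) * (if f ` S = X then (-1) ^ card Z else 0))"
    unfolding cover_sum by (intro sum.cong refl arg_cong2[of _ _ _ _ "(*)"] prod)
  also have "\<dots> = (\<Sum>S\<in>{S \<in> Pow Y. f ` S = X}. (-1) ^ card Y * (-1) ^ card Z * (-1) ^ card S)"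
    using finY by (intro sum.mono_neutral_cong_right) (auto simp: sign_complement)
  also have "\<dots> = (-1) ^ card Y * (-1) ^ card Z * (-1) ^ card X"
    using s by (simp add: sum_distrib_left[symmetric])
  finally show ?thesis
    by (simp add: power_add power_mult_distrib[symmetric])
qed

text \<open>For c = -2 the factor at z is -2 or 0 according to whether the degree is odd or even.
  Since all multiplicities over X are odd, this parity is that of the part of S lying over h z, so
  only the S that are odd over every point of X contribute.\<close>

lemma cover_sum_minus_two:
  assumes N: "\<And>y z. y \<in> Y \<Longrightarrow> z \<in> Z \<Longrightarrow> f y = h z \<Longrightarrow> odd (card {r \<in> R. a r = y \<and> b r = z})"
  shows "(\<Sum>Q\<in>{Q. Q \<subseteq> R \<and> a ` Q = Y \<and> b ` Q = Z}. (-2 :: int) ^ card Q) * (-2) ^ card X =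
    (-2) ^ (card Y + card Z)"
proof -
  have deg: "odd (deg S z) \<longleftrightarrow> odd (card {y \<in> S. f y = h z})" if S: "S \<subseteq> Y" and z: "z \<in> Z" for S z
  proof -
    have fS: "finite S"
      using S finY finite_subset by blast
    have "odd (card {r \<in> R. a r = y \<and> b r = z}) \<longleftrightarrow> f y = h z" if y: "y \<in> S" for y
    proof (cases "f y = h z")
      case False
      then have "{r \<in> R. a r = y \<and> b r = z} = {}"
        using fahb by auto
      then have "card {r \<in> R. a r = y \<and> b r = z} = 0"
        by (simp only: card.empty)
      then show ?thesis
        using False by simp
    qed (use N S z y in auto)
    then have e: "{y \<in> S. odd (card {r \<in> R. a r = y \<and> b r = z})} = {y \<in> S. f y = h z}"
      by auto
    show ?thesis
      unfolding deg_eq_sum[OF S] even_sum_iff[OF fS] e by simp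
  qed
  have prod: "(\<Prod>z\<in>Z. (1 + (-2)) ^ deg S z - 1) =
      (if \<forall>x\<in>X. odd (card {y \<in> S. f y = x}) then (-2) ^ card Z else (0 :: int))"
    if S: "S \<in> Pow Y" for S
  proof (cases "\<forall>x\<in>X. odd (card {y \<in> S. f y = x})")
    case True
    then have "(\<Prod>z\<in>Z. (1 + (-2)) ^ deg S z - 1) = (\<Prod>z\<in>Z. (-2 :: int))"
      using deg S h by (intro prod.cong) auto
    then show ?thesis
      using True by simp
  next
    case False
    then obtain z where "z \<in> Z" "even (card {y \<in> S. f y = h z})"
      using h by blast
    then have "(\<Prod>z\<in>Z. (1 + (-2)) ^ deg S z - 1) = (0 :: int)"
      using deg S finZ by (intro prod_zero) (auto intro!: bexI[of _ z])
    then show ?thesis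
      using False by simp
  qed
  let ?F = "\<lambda>x S. if odd (card S) then (-1 :: int) ^ card S else 0"
  \<comment> \<open>Half of the subsets of a nonempty set have odd size; doubling avoids a division
    in the integers.\<close>
  have F: "2 * (\<Sum>S\<in>Pow A. ?F x S) = - (2 ^ card A)" if A: "finite A" "A \<noteq> {}" for A :: "'y set" and x :: 'x
  proof -
    have "2 * (\<Sum>S\<in>Pow A. ?F x S) = (\<Sum>S\<in>Pow A. (-1) ^ card S - 1 ^ card S)"
      unfolding sum_distrib_left by (intro sum.cong) auto
    also have "\<dots> = (1 + (-1)) ^ card A - (1 + 1) ^ card A"
      using A by (simp add: sum_subtractf sum_Pow_power card_Pow)
    finally show ?thesis
      using A by (simp add: power_0_left card_Pow)
  qed
  have "(\<Sum>S\<in>{S \<in> Pow Y. \<forall>x\<in>X. odd (card {y \<in> S. f y = x})}. (-1 :: int) ^ card S) =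
      (\<Sum>S\<in>Pow Y. \<Prod>x\<in>X. ?F x {y \<in> S. f y = x})"
  proof (rule sum.mono_neutral_cong_left)
    show "\<forall>S\<in>Pow Y - {S \<in> Pow Y. \<forall>x\<in>X. odd (card {y \<in> S. f y = x})}.
        (\<Prod>x\<in>X. ?F x {y \<in> S. f y = x}) = 0"
      using finX by (auto intro!: prod_zero)
    fix S assume S: "S \<in> {S \<in> Pow Y. \<forall>x\<in>X. odd (card {y \<in> S. f y = x})}"
    then have "finite S" "f ` S \<subseteq> X"
      using finY f finite_subset by auto
    from card_fiberwise[OF this(1) finX this(2)]
    have "(-1 :: int) ^ card S = (\<Prod>x\<in>X. (-1) ^ card {y \<in> S. f y = x})"
      by (simp add: power_sum)
    also have "\<dots> = (\<Prod>x\<in>X. ?F x {y \<in> S. f y = x})"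
      using S by (intro prod.cong) auto
    finally show "(-1 :: int) ^ card S = (\<Prod>x\<in>X. ?F x {y \<in> S. f y = x})" .
  qed (use finY in auto)
  also have "\<dots> = (\<Prod>x\<in>X. \<Sum>S\<in>Pow {y \<in> Y. f y = x}. ?F x S)"
    by (rule sum_Pow_fiberwise) (use finX finY f in auto)
  finally have "2 ^ card X * (\<Sum>S\<in>{S \<in> Pow Y. \<forall>x\<in>X. odd (card {y \<in> S. f y = x})}. (-1 :: int) ^ card S) =
      (\<Prod>x\<in>X. 2 * (\<Sum>S\<in>Pow {y \<in> Y. f y = x}. ?F x S))"
    by (simp add: prod.distrib)
  also have "\<dots> = (\<Prod>x\<in>X. - (2 ^ card {y \<in> Y. f y = x}))"
    by (intro prod.cong refl F) (use finY f in auto)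
  also have "\<dots> = (\<Prod>x\<in>X. (-1) * 2 ^ card {y \<in> Y. f y = x})"
    by simp
  also have "\<dots> = (-1) ^ card X * 2 ^ card Y"
    using card_fiberwise[OF finY finX, of f] f by (simp only: prod.distrib) (simp add: power_sum)
  finally have s: "2 ^ card X * (\<Sum>S\<in>{S \<in> Pow Y. \<forall>x\<in>X. odd (card {y \<in> S. f y = x})}. (-1 :: int) ^ card S) =
      (-1) ^ card X * 2 ^ card Y" .
  have "(\<Sum>Q\<in>{Q. Q \<subseteq> R \<and> a ` Q = Y \<and> b ` Q = Z}. (-2 :: int) ^ card Q) =
      (\<Sum>S\<in>Pow Y. (-1) ^ card (Y - S) *
        (if \<forall>x\<in>X. odd (card {y \<in> S. f y = x}) then (-2) ^ card Z else 0))"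
    unfolding cover_sum by (intro sum.cong refl arg_cong2[of _ _ _ _ "(*)"] prod)
  also have "\<dots> = (\<Sum>S\<in>{S \<in> Pow Y. \<forall>x\<in>X. odd (card {y \<in> S. f y = x})}.
      (-1) ^ card Y * (-2) ^ card Z * (-1) ^ card S)"
    using finY by (intro sum.mono_neutral_cong_right) (auto simp: sign_complement)
  also have "\<dots> = (-1) ^ card Y * (-2) ^ card Z *
      (\<Sum>S\<in>{S \<in> Pow Y. \<forall>x\<in>X. odd (card {y \<in> S. f y = x})}. (-1) ^ card S)"
    by (simp add: sum_distrib_left)
  finally have "(\<Sum>Q\<in>{Q. Q \<subseteq> R \<and> a ` Q = Y \<and> b ` Q = Z}. (-2 :: int) ^ card Q) * (-2) ^ card X =
      (-1) ^ card Y * (-2) ^ card Z * (-1) ^ card X *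
      (2 ^ card X * (\<Sum>S\<in>{S \<in> Pow Y. \<forall>x\<in>X. odd (card {y \<in> S. f y = x})}. (-1) ^ card S))"
    using power_mult_distrib[of "-1 :: int" 2 "card X"] by simp
  also have "\<dots> = (-1) ^ card Y * (-2) ^ card Z * 2 ^ card Y * ((-1) ^ card X * (-1) ^ card X)"
    unfolding s by simp
  also have "\<dots> = (-2) ^ (card Y + card Z)"
    using power_mult_distrib[of "-1 :: int" 2 "card Y"] by (simp add: power_add power_mult_distrib[symmetric])
  finally show ?thesis .
qed

end

context order_with_pro
begin

section \<open>Decompositions in the associated order\<close>

lemma graph_iso:
  assumes gW: "is_gset G W" and p: "p \<in> gmaps G W Y" and q: "q \<in> gmaps G W X'"
    and inj: "inj_on (\<lambda>x. (p x, q x)) (pts W)"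
  shows "(\<lambda>x\<in>pts W. (p x, q x)) \<in> gisos G W (sub_gset (prod_gset Y X') ((\<lambda>x. (p x, q x)) ` pts W))"
proof -
  let ?S = "sub_gset (prod_gset Y X') ((\<lambda>x. (p x, q x)) ` pts W)"
  have "restrict (\<lambda>x. (p x, q x)) (pts W) \<in> gmaps G W ?S"
    by (rule gmapsI[OF gW])
      (simp_all add: gmaps_act[OF p] gmaps_act[OF q] gmaps_mem[OF p] gmaps_mem[OF q])
  then show ?thesis
    using inj by (auto simp: gisos_def bij_betw_def inj_on_def)
qed

text \<open>An arbitrary decomposition of a fiber product of atoms, read in \<open>E\<close>. This
  is what verifying the sum formula for a candidate measure requires.\<close>

lemma atom_decomposition:
  assumes F: "F \<in> gmaps H AY AX" and K: "K \<in> gmaps H AX' AX"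
    and AY: "AY \<in> At" "\<phi>Y \<in> gisos H AY (B Y)" "Y \<in> E" "pts Y \<noteq> {}"
    and AX: "AX \<in> At" "\<phi>X \<in> gisos H AX (B X)" "X \<in> E" "pts X \<noteq> {}"
    and AX': "AX' \<in> At" "\<phi>X' \<in> gisos H AX' (B X')" "X' \<in> E" "pts X' \<noteq> {}"
    and fam: "\<And>i. i \<in> J \<Longrightarrow> A i \<in> At \<and> P i \<in> gmaps H (A i) AY \<and> Q i \<in> gmaps H (A i) AX'"
    and bij: "bij_betw (\<lambda>(i, a). (P i a, Q i a)) (SIGMA i:J. pts (A i)) (pts (fiber_prod AY F AX' K))"
  obtains f h W D where "f \<in> surj_gmaps G Y X" "h \<in> surj_gmaps G X' X" "bij_betw D J (ample Y f X' h)"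
    "\<And>i. i \<in> J \<Longrightarrow> W i \<in> E \<and> pts (W i) \<noteq> {} \<and> gset_iso H (A i) (B (W i)) \<and>
      gset_iso G (W i) (sub_gset (prod_gset Y X') (D i))"
proof -
  obtain f where f: "f \<in> surj_gmaps G Y X" "\<And>a. a \<in> pts AY \<Longrightarrow> \<phi>X (F a) = post Y X f (\<phi>Y a)"
    using atom_map[OF AY AX(2,3) F] by blast
  obtain h where h: "h \<in> surj_gmaps G X' X" "\<And>a. a \<in> pts AX' \<Longrightarrow> \<phi>X (K a) = post X' X h (\<phi>X' a)"
    using atom_map[OF AX' AX(2,3) K] by blast
  have "\<forall>i\<in>J. \<exists>W \<theta>. W \<in> E \<and> pts W \<noteq> {} \<and> \<theta> \<in> gisos H (A i) (B W)"
    using fam by (metis atomE)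
  then obtain W where "\<forall>i\<in>J. \<exists>\<theta>. W i \<in> E \<and> pts (W i) \<noteq> {} \<and> \<theta> \<in> gisos H (A i) (B (W i))"
    using bchoice[of J] by metis
  then obtain \<theta> where \<theta>: "\<And>i. i \<in> J \<Longrightarrow> W i \<in> E" "\<And>i. i \<in> J \<Longrightarrow> pts (W i) \<noteq> {}"
    "\<And>i. i \<in> J \<Longrightarrow> \<theta> i \<in> gisos H (A i) (B (W i))"
    using bchoice[of J] by metis
  have "\<forall>i\<in>J. \<exists>p. p \<in> surj_gmaps G (W i) Y \<and> (\<forall>a\<in>pts (A i). \<phi>Y (P i a) = post (W i) Y p (\<theta> i a))"
  proof
    fix i assume i: "i \<in> J"
    show "\<exists>p. p \<in> surj_gmaps G (W i) Y \<and> (\<forall>a\<in>pts (A i). \<phi>Y (P i a) = post (W i) Y p (\<theta> i a))"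
      unfolding Bex_def[symmetric]
      by (rule atom_map[OF conjunct1[OF fam[OF i]] \<theta>(3)[OF i] \<theta>(1)[OF i] \<theta>(2)[OF i] AY(2,3)
        conjunct1[OF conjunct2[OF fam[OF i]]]])
  qed
  then obtain p where p: "\<And>i. i \<in> J \<Longrightarrow> p i \<in> surj_gmaps G (W i) Y"
    "\<And>i a. i \<in> J \<Longrightarrow> a \<in> pts (A i) \<Longrightarrow> \<phi>Y (P i a) = post (W i) Y (p i) (\<theta> i a)"
    using bchoice[of J] by metis
  have "\<forall>i\<in>J. \<exists>q. q \<in> surj_gmaps G (W i) X' \<and> (\<forall>a\<in>pts (A i). \<phi>X' (Q i a) = post (W i) X' q (\<theta> i a))"
  proof
    fix i assume i: "i \<in> J"
    show "\<exists>q. q \<in> surj_gmaps G (W i) X' \<and> (\<forall>a\<in>pts (A i). \<phi>X' (Q i a) = post (W i) X' q (\<theta> i a))"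
      unfolding Bex_def[symmetric]
      by (rule atom_map[OF conjunct1[OF fam[OF i]] \<theta>(3)[OF i] \<theta>(1)[OF i] \<theta>(2)[OF i] AX'(2,3)
        conjunct2[OF conjunct2[OF fam[OF i]]]])
  qed
  then obtain q where q: "\<And>i. i \<in> J \<Longrightarrow> q i \<in> surj_gmaps G (W i) X'"
    "\<And>i a. i \<in> J \<Longrightarrow> a \<in> pts (A i) \<Longrightarrow> \<phi>X' (Q i a) = post (W i) X' (q i) (\<theta> i a)"
    using bchoice[of J] by metis
  have \<Phi>: "bij_betw (map_prod \<phi>Y \<phi>X') (pts (fiber_prod AY F AX' K)) (Bfiber X Y f X' h)"
    by (rule Bfiber_bij[OF AY(2) AX'(2) AX(2) F f(2) K h(2)])
  have b: "bij_betw (\<lambda>(i, w). (post (W i) Y (p i) w, post (W i) X' (q i) w)) (SIGMA i:J. Hom (W i)) (Bfiber X Y f X' h)"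
    by (rule iffD1[OF Bpair_bij_iff[OF \<Phi> \<theta>(3) p(2) q(2) equalityD1[OF bij_betw_imp_surj_on[OF bij]]] bij])
  note dec = Bfiber_decompose[OF AY(3,4) AX'(3) f(1) h(1)]
  have inj: "inj_on (\<lambda>x. (p i x, q i x)) (pts (W i))" if "i \<in> J" for i
    by (rule dec(1)[of J W p q]) (rule \<theta>(1) \<theta>(2) p(1) q(1) b that, assumption?)+
  have bD: "bij_betw (\<lambda>i. (\<lambda>x. (p i x, q i x)) ` pts (W i)) J (ample Y f X' h)"
    by (rule dec(2)) (rule \<theta>(1) \<theta>(2) p(1) q(1) b, assumption?)+
  show ?thesis
  proof (rule that[OF f(1) h(1) bD])
    fix i assume i: "i \<in> J"
    show "W i \<in> E \<and> pts (W i) \<noteq> {} \<and> gset_iso H (A i) (B (W i)) \<and>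
        gset_iso G (W i) (sub_gset (prod_gset Y X') ((\<lambda>x. (p i x, q i x)) ` pts (W i)))"
      using \<theta>[OF i] graph_iso[OF E_gset[OF \<theta>(1)[OF i]] surj_gmaps_gmaps[OF p(1)[OF i]]
        surj_gmaps_gmaps[OF q(1)[OF i]] inj[OF i]]
      unfolding gset_iso_def by blast
  qed
qed

lemma atom_map_exists:
  assumes AY: "is_gset H AY" "\<phi>Y \<in> gisos H AY (B Y)" and AX: "is_gset H AX" "\<phi>X \<in> gisos H AX (B X)"
    and f: "f \<in> surj_gmaps G Y X"
  shows "\<exists>F\<in>gmaps H AY AX. \<forall>a\<in>pts AY. \<phi>X (F a) = post Y X f (\<phi>Y a)"
proof -
  let ?\<psi> = "restrict (inv_into (pts AX) \<phi>X) (pts (B X))"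
  have \<psi>: "?\<psi> \<in> gisos H (B X) AX"
    by (rule gisos_inv[OF AX(1) is_gset_B AX(2)])
  let ?F = "compose (pts AY) ?\<psi> (compose (pts AY) (bmap Y X f) \<phi>Y)"
  have "?F \<in> gmaps H AY AX"
    by (rule gmaps_compose[OF AY(1) gmaps_compose[OF AY(1) gisos_gmaps[OF AY(2)] bmap_gmaps[OF f]]
      gisos_gmaps[OF \<psi>]])
  moreover have "\<phi>X (?F a) = post Y X f (\<phi>Y a)" if a: "a \<in> pts AY" for a
  proof -
    have u: "\<phi>Y a \<in> Hom Y"
      using gmaps_mem[OF gisos_gmaps[OF AY(2)] a] by simp
    have "post Y X f (\<phi>Y a) \<in> pts (B X)"
      using post_Hom[OF u f] by simp
    then show ?thesis
      using a u bij_betw_inv_into_right[OF gisos_bij[OF AX(2)]] by (simp add: compose_eq bmap_def)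
  qed
  ultimately show ?thesis
    by blast
qed

lemma finite_orbs_Fib:
  assumes "inE Y" "inE X'" "f \<in> gmaps G Y X" "h \<in> gmaps G X' X"
  shows "finite (orbs G (fiber_prod Y f X' h))"
  unfolding fiber_prod_def
  using assms by (intro inE_finite inE_sub inE_prod fiber_set_invariant inE_gset)

text \<open>The opposite direction: every square in \<open>E\<close> yields an actual decomposition,
  to which the sum formula of a given measure can be applied. The index set consists of numbers
  because \<open>orbit_measure\<close> quantifies over such families.\<close>

lemma atom_decomposition_exists:
  assumes f: "f \<in> surj_gmaps G Y X" and h: "h \<in> surj_gmaps G X' X"
    and AY: "AY \<in> At" "\<phi>Y \<in> gisos H AY (B Y)" "Y \<in> E" "pts Y \<noteq> {}"
    and AX: "AX \<in> At" "\<phi>X \<in> gisos H AX (B X)"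
    and AX': "AX' \<in> At" "\<phi>X' \<in> gisos H AX' (B X')" "X' \<in> E"
  obtains F K and J :: "nat set" and A P Q D where "F \<in> gmaps H AY AX" "K \<in> gmaps H AX' AX" "finite J"
    "\<And>i. i \<in> J \<Longrightarrow> A i \<in> At \<and> P i \<in> gmaps H (A i) AY \<and> Q i \<in> gmaps H (A i) AX'"
    "bij_betw (\<lambda>(i, a). (P i a, Q i a)) (SIGMA i:J. pts (A i)) (pts (fiber_prod AY F AX' K))"
    "bij_betw D J (ample Y f X' h)"
    "\<And>i. i \<in> J \<Longrightarrow> \<exists>W\<in>E. pts W \<noteq> {} \<and> gset_iso H (A i) (B W) \<and>
      gset_iso G W (sub_gset (prod_gset Y X') (D i))"
proof -
  have gAY: "is_gset H AY" and gAX: "is_gset H AX" and gAX': "is_gset H AX'"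
    using AY AX AX' atom_gset by auto
  obtain F where F: "F \<in> gmaps H AY AX" "\<And>a. a \<in> pts AY \<Longrightarrow> \<phi>X (F a) = post Y X f (\<phi>Y a)"
    using atom_map_exists[OF gAY AY(2) gAX AX(2) f] by blast
  obtain K where K: "K \<in> gmaps H AX' AX" "\<And>a. a \<in> pts AX' \<Longrightarrow> \<phi>X (K a) = post X' X h (\<phi>X' a)"
    using atom_map_exists[OF gAX' AX'(2) gAX AX(2) h] by blast
  have "finite (ample Y f X' h)"
    using finite_ample[OF E_gset[OF AY(3)] E_gset[OF AX'(3)] surj_gmaps_gmaps[OF f] surj_gmaps_gmaps[OF h]]
      finite_orbs_Fib[OF E_inE[OF AY(3)] E_inE[OF AX'(3)] surj_gmaps_gmaps[OF f] surj_gmaps_gmaps[OF h]]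
    by blast
  then obtain D where D: "bij_betw D {0..<card (ample Y f X' h)} (ample Y f X' h)"
    using ex_bij_betw_nat_finite by blast
  define J where "J = {0..<card (ample Y f X' h)}"
  \<comment> \<open>All data of a piece are bundled in one tuple, so that a single choice over J
    produces them consistently.\<close>
  let ?piece = "\<lambda>i (W, p, q, A, \<theta>). W \<in> E \<and> p \<in> surj_gmaps G W Y \<and> q \<in> surj_gmaps G W X' \<and>
      inj_on (\<lambda>x. (p x, q x)) (pts W) \<and> (\<lambda>x. (p x, q x)) ` pts W = D i \<and>
      (\<lambda>x\<in>pts W. (p x, q x)) \<in> gisos G W (sub_gset (prod_gset Y X') (D i)) \<and>
      pts W \<noteq> {} \<and> A \<in> At \<and> \<theta> \<in> gisos H A (B W)"
  have "\<forall>i\<in>J. \<exists>t. ?piece i t"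
  proof
    fix i assume "i \<in> J"
    then have "D i \<in> ample Y f X' h"
      using D by (auto simp: J_def bij_betw_def)
    then have Di: "invariant_set G (prod_gset Y X') (D i)" "fst ` D i = pts Y" "snd ` D i = pts X'"
      by (auto simp: ample_def)
    obtain W p q where W: "W \<in> E" "p \<in> surj_gmaps G W Y" "q \<in> surj_gmaps G W X'"
      "inj_on (\<lambda>x. (p x, q x)) (pts W)" "(\<lambda>x. (p x, q x)) ` pts W = D i"
      "(\<lambda>x\<in>pts W. (p x, q x)) \<in> gisos G W (sub_gset (prod_gset Y X') (D i))"
      by (rule graph_object[OF E_inE[OF AY(3)] E_inE[OF AX'(3)] Di])
    have ne: "pts W \<noteq> {}"
      using surj_gmaps_image[OF W(2)] AY(4) by auto
    obtain A \<theta> where "A \<in> At" "\<theta> \<in> gisos H A (B W)"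
      by (rule atom_exists[OF W(1) ne])
    then show "\<exists>t. ?piece i t"
      using W ne by (intro exI[of _ "(W, p, q, A, \<theta>)"]) simp
  qed
  from bchoice[OF this] obtain t where t: "\<forall>i\<in>J. ?piece i (t i)"
    ..
  define W where "W i = fst (t i)" for i
  define p where "p i = fst (snd (t i))" for i
  define q where "q i = fst (snd (snd (t i)))" for i
  define A where "A i = fst (snd (snd (snd (t i))))" for i
  define \<theta> where "\<theta> i = snd (snd (snd (snd (t i))))" for i
  have W: "W i \<in> E" "p i \<in> surj_gmaps G (W i) Y" "q i \<in> surj_gmaps G (W i) X'"
      "inj_on (\<lambda>x. (p i x, q i x)) (pts (W i))" "(\<lambda>x. (p i x, q i x)) ` pts (W i) = D i"
      "(\<lambda>x\<in>pts (W i). (p i x, q i x)) \<in> gisos G (W i) (sub_gset (prod_gset Y X') (D i))"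
      "pts (W i) \<noteq> {}" "A i \<in> At" "\<theta> i \<in> gisos H (A i) (B (W i))" if "i \<in> J" for i
    using t that unfolding W_def p_def q_def A_def \<theta>_def by (auto simp: case_prod_beta)
  have "\<forall>i\<in>J. \<exists>P. P \<in> gmaps H (A i) AY \<and> (\<forall>a\<in>pts (A i). \<phi>Y (P a) = post (W i) Y (p i) (\<theta> i a))"
    using atom_map_exists[OF atom_gset[OF W(8)] W(9) gAY AY(2) W(2)] by blast
  then obtain P where P: "\<And>i. i \<in> J \<Longrightarrow> P i \<in> gmaps H (A i) AY"
    "\<And>i a. i \<in> J \<Longrightarrow> a \<in> pts (A i) \<Longrightarrow> \<phi>Y (P i a) = post (W i) Y (p i) (\<theta> i a)"
    using bchoice[of J] by metis
  have "\<forall>i\<in>J. \<exists>P. P \<in> gmaps H (A i) AX' \<and> (\<forall>a\<in>pts (A i). \<phi>X' (P a) = post (W i) X' (q i) (\<theta> i a))"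
    using atom_map_exists[OF atom_gset[OF W(8)] W(9) gAX' AX'(2) W(3)] by blast
  then obtain Q where Q: "\<And>i. i \<in> J \<Longrightarrow> Q i \<in> gmaps H (A i) AX'"
    "\<And>i a. i \<in> J \<Longrightarrow> a \<in> pts (A i) \<Longrightarrow> \<phi>X' (Q i a) = post (W i) X' (q i) (\<theta> i a)"
    using bchoice[of J] by metis
  have \<Phi>: "bij_betw (map_prod \<phi>Y \<phi>X') (pts (fiber_prod AY F AX' K)) (Bfiber X Y f X' h)"
    by (rule Bfiber_bij[OF AY(2) AX'(2) AX(2) F K])
  have bD: "bij_betw (\<lambda>i. (\<lambda>x. (p i x, q i x)) ` pts (W i)) J (ample Y f X' h)"
    using D W(5) unfolding J_def[symmetric] by (subst bij_betw_cong[of _ _ D]) auto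
  have b: "bij_betw (\<lambda>(i, w). (post (W i) Y (p i) w, post (W i) X' (q i) w)) (SIGMA i:J. Hom (W i)) (Bfiber X Y f X' h)"
    by (rule decompose_Bfiber[OF AY(3,4) AX'(3) f h]) (rule W(1) W(7) W(2) W(3) W(4) bD, assumption?)+
  have S: "(\<lambda>(i, a). (P i a, Q i a)) ` (SIGMA i:J. pts (A i)) \<subseteq> pts (fiber_prod AY F AX' K)"
  proof (rule image_subsetI)
    fix s assume "s \<in> (SIGMA i:J. pts (A i))"
    then obtain i a where s: "s = (i, a)" "i \<in> J" "a \<in> pts (A i)"
      by blast
    have m: "P i a \<in> pts AY" "Q i a \<in> pts AX'"
      using gmaps_mem[OF P(1)[OF s(2)] s(3)] gmaps_mem[OF Q(1)[OF s(2)] s(3)] .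
    have "\<theta> i a \<in> Hom (W i)"
      using gmaps_mem[OF gisos_gmaps[OF W(9)[OF s(2)]] s(3)] by simp
    then have "(post (W i) Y (p i) (\<theta> i a), post (W i) X' (q i) (\<theta> i a)) \<in> Bfiber X Y f X' h"
      using bij_betw_imp_surj_on[OF b] s(2) by (auto simp: image_iff)
    then have "\<phi>X (F (P i a)) = \<phi>X (K (Q i a))"
      using F(2)[OF m(1)] K(2)[OF m(2)] P(2)[OF s(2,3)] Q(2)[OF s(2,3)] by (simp add: Bfiber_def)
    then have "F (P i a) = K (Q i a)"
      using inj_onD[OF bij_betw_imp_inj_on[OF gisos_bij[OF AX(2)]]] gmaps_mem[OF F(1) m(1)] gmaps_mem[OF K(1) m(2)]
      by blast
    then show "(\<lambda>(i, a). (P i a, Q i a)) s \<in> pts (fiber_prod AY F AX' K)"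
      using m by (simp add: s pts_fiber_prod)
  qed
  have bij: "bij_betw (\<lambda>(i, a). (P i a, Q i a)) (SIGMA i:J. pts (A i)) (pts (fiber_prod AY F AX' K))"
    by (rule iffD2[OF Bpair_bij_iff[OF \<Phi> W(9) P(2) Q(2) S] b])
  show ?thesis
  proof (rule that[OF F(1) K(1) _ _ bij D[folded J_def]])
    show "\<exists>W\<in>E. pts W \<noteq> {} \<and> gset_iso H (A i) (B W) \<and> gset_iso G W (sub_gset (prod_gset Y X') (D i))"
      if "i \<in> J" for i
      using W[OF that] unfolding gset_iso_def by blast
  qed (use P(1) Q(1) W(8) in \<open>auto simp: J_def\<close>)
qed

section \<open>Existence of the power measures\<close>

lemma Fib_edge_cover:
  assumes Y: "inE Y" and X': "inE X'" and f: "f \<in> surj_gmaps G Y X" and h: "h \<in> surj_gmaps G X' X"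
  shows "edge_cover (orbs G (fiber_prod Y f X' h)) (orbs G Y) (orbs G X') (orbs G X)
    ((`) fst) ((`) snd) ((`) f) ((`) h)"
proof
  note fh = surj_gmaps_gmaps[OF f] surj_gmaps_gmaps[OF h]
  note g = inE_gset[OF Y] inE_gset[OF X']
  show "(`) fst ` orbs G (fiber_prod Y f X' h) \<subseteq> orbs G Y" "(`) snd ` orbs G (fiber_prod Y f X' h) \<subseteq> orbs G X'"
    using orbs_Fib_fst[OF g fh] orbs_Fib_snd[OF g fh] by auto
  show "f ` fst ` r = h ` snd ` r" if "r \<in> orbs G (fiber_prod Y f X' h)" for r
  proof -
    have "r \<subseteq> pts (fiber_prod Y f X' h)"
      using that Union_orbs[OF is_gset_Fib[OF g fh]] by blast
    then have "f (fst z) = h (snd z)" if "z \<in> r" for z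
      using that by (auto simp: pts_fiber_prod)
    then show ?thesis
      by (simp add: image_image cong: image_cong)
  qed
  show "finite (orbs G (fiber_prod Y f X' h))"
    by (rule finite_orbs_Fib[OF Y X' fh])
  show "finite (orbs G Y)" "finite (orbs G X')"
    using inE_finite[OF Y] inE_finite[OF X'] .
  show "(`) f ` orbs G Y = orbs G X" "(`) h ` orbs G X' = orbs G X"
    using surj_gmaps_orbs[OF f] surj_gmaps_orbs[OF h] by simp_all
qed

lemma Fib_edge_exists:
  assumes Y: "is_gset G Y" and X': "is_gset G X'" and f: "f \<in> gmaps G Y X" and h: "h \<in> gmaps G X' X"
    and A: "A \<in> orbs G Y" and A': "A' \<in> orbs G X'" and e: "f ` A = h ` A'"
  shows "\<exists>r\<in>orbs G (fiber_prod Y f X' h). fst ` r = A \<and> snd ` r = A'"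
proof -
  obtain y where y: "y \<in> pts Y" "A = orb G Y y"
    using A by (auto simp: orbs_def)
  have "f y \<in> h ` A'"
    using e orb_refl[OF Y y(1)] y by blast
  then obtain z where z: "z \<in> A'" "f y = h z"
    by blast
  then have z': "z \<in> pts X'" "A' = orb G X' z"
    using orbs_mem_eq[OF X' A'] by auto
  then have yz: "(y, z) \<in> pts (fiber_prod Y f X' h)"
    using y z by (simp add: pts_fiber_prod)
  show ?thesis
    using orb_Fib_fst[OF Y X' f h yz] orb_Fib_snd[OF Y X' f h yz] orb_in_orbs[OF yz] y z' by blast
qed

lemma sub_orbit_atom:
  assumes "X \<in> E" "A \<in> orbs G X" shows "sub_gset X A \<in> atoms G E"
proof -
  have "orbs G (sub_gset X A) = {A}"
    using orbs_invariant_sub[OF E_gset[OF assms(1)], of "{A}"] assms(2) by simp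
  moreover have "sub_gset X A \<in> E"
    using invariant_orbs_Union[OF E_gset[OF assms(1)], of "{A}"] assms inE_E[OF inE_sub[OF E_inE]] by simp
  ultimately show ?thesis
    by (simp add: atoms_def rho_eq_card)
qed

text \<open>Restricting the square to A, A' and their common image gives a square of atoms, and the
  edges between A and A' are the orbits of its fiber product.\<close>

lemma Fib_edge_odd:
  assumes odd: "odd_order G E" and X: "X \<in> E" and Y: "Y \<in> E" and X': "X' \<in> E"
    and f: "f \<in> gmaps G Y X" and h: "h \<in> gmaps G X' X"
    and A: "A \<in> orbs G Y" and A': "A' \<in> orbs G X'" and e: "f ` A = h ` A'"
  shows "odd (card {r \<in> orbs G (fiber_prod Y f X' h). fst ` r = A \<and> snd ` r = A'})"
proof -
  let ?Y = "sub_gset Y A" and ?X' = "sub_gset X' A'" and ?X = "sub_gset X (f ` A)"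
  let ?Fib = "fiber_prod Y f X' h"
  have gY: "is_gset G Y" and gX': "is_gset G X'" and gX: "is_gset G X"
    using X Y X' E_gset by auto
  have invA: "invariant_set G Y A" and invA': "invariant_set G X' A'"
    using invariant_orbs_Union[OF gY, of "{A}"] invariant_orbs_Union[OF gX', of "{A'}"] A A' by auto
  have sA: "y \<in> pts Y \<and> A = orb G Y y" if "y \<in> A" for y
    using orbs_mem_eq[OF gY A that] .
  have sA': "y \<in> pts X' \<and> A' = orb G X' y" if "y \<in> A'" for y
    using orbs_mem_eq[OF gX' A' that] .
  have fA: "f ` A \<in> orbs G X"
    using A gmaps_orb[OF f] gmaps_mem[OF f] by (auto simp: orbs_def)
  let ?f = "restrict f A" and ?h = "restrict h A'"
  have f': "?f \<in> gmaps G ?Y ?X"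
    using gmapsI[OF is_gset_sub[OF gY invA], of f ?X] sA gmaps_act[OF f] by simp
  have h': "?h \<in> gmaps G ?X' ?X"
    using gmapsI[OF is_gset_sub[OF gX' invA'], of h ?X] sA' gmaps_act[OF h] e by simp
  \<comment> \<open>\<open>odd_order\<close> takes the two factors in the opposite order; hence the
    swap below.\<close>
  let ?F = "fiber_prod ?X' ?h ?Y ?f"
  have "odd (rho G ?F)"
    using odd sub_orbit_atom[OF X fA] sub_orbit_atom[OF Y A] sub_orbit_atom[OF X' A'] f' h'
    unfolding odd_order_def by blast
  moreover have "rho G ?F = card {r \<in> orbs G ?Fib. fst ` r = A \<and> snd ` r = A'}"
  proof -
    let ?S = "{(y, z). y \<in> A \<and> z \<in> A' \<and> f y = h z}"
    have pF: "pts ?F = prod.swap ` ?S"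
      by (force simp: pts_fiber_prod image_iff)
    have SF: "?S \<subseteq> pts ?Fib"
      using sA sA' by (auto simp: pts_fiber_prod)
    have o: "orb G ?F (prod.swap w) = prod.swap ` orb G ?Fib w" if w: "w \<in> ?S" for w
    proof -
      obtain y z where yz: "w = (y, z)" "y \<in> A" "z \<in> A'" "f y = h z"
        using w by auto
      then have "orb G ?F (z, y) = (\<lambda>g. (act X' g z, act Y g y)) ` carrier G"
        by (auto simp: orbit_def fiber_prod_def)
      moreover have "orb G ?Fib (y, z) = (\<lambda>g. (act Y g y, act X' g z)) ` carrier G"
        using yz sA sA' by (auto simp: orbit_def fiber_prod_def)
      ultimately show ?thesis
        using yz by (simp add: image_image)
    qed
    have "orbs G ?F = (`) prod.swap ` (orb G ?Fib ` ?S)"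
      unfolding orbs_def pF using o by (auto simp: image_image intro!: image_cong)
    moreover have "orb G ?Fib ` ?S = {r \<in> orbs G ?Fib. fst ` r = A \<and> snd ` r = A'}"
    proof (intro equalityI subsetI)
      fix r assume "r \<in> orb G ?Fib ` ?S"
      then obtain y z where yz: "r = orb G ?Fib (y, z)" "(y, z) \<in> ?S"
        by blast
      then have "(y, z) \<in> pts ?Fib" "y \<in> A" "z \<in> A'"
        using SF by auto
      then show "r \<in> {r \<in> orbs G ?Fib. fst ` r = A \<and> snd ` r = A'}"
        using orb_Fib_fst[OF gY gX' f h, of y z] orb_Fib_snd[OF gY gX' f h, of y z] sA sA' yz(1)
        by (auto simp: orb_in_orbs)
    next
      fix r assume r: "r \<in> {r \<in> orbs G ?Fib. fst ` r = A \<and> snd ` r = A'}"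
      then obtain y z where yz: "r = orb G ?Fib (y, z)" "(y, z) \<in> pts ?Fib"
        by (auto simp: orbs_def)
      then have "(y, z) \<in> r"
        using orb_refl[OF is_gset_Fib[OF gY gX' f h]] by blast
      then have "y \<in> A" "z \<in> A'"
        using r by force+
      then show "r \<in> orb G ?Fib ` ?S"
        using yz by (auto simp: pts_fiber_prod)
    qed
    ultimately have "orbs G ?F = (`) prod.swap ` {r \<in> orbs G ?Fib. fst ` r = A \<and> snd ` r = A'}"
      by simp
    moreover have "inj_on ((`) prod.swap) {r \<in> orbs G ?Fib. fst ` r = A \<and> snd ` r = A'}"
      by (rule inj_on_image) (auto simp: inj_on_def)
    ultimately show ?thesis
      by (simp add: rho_eq_card card_image)
  qed
  ultimately show ?thesis by simp
qed

lemma covers_sum_minus_one: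
  assumes Y: "inE Y" and X': "inE X'" and f: "f \<in> surj_gmaps G Y X" and h: "h \<in> surj_gmaps G X' X"
  shows "(\<Sum>Q\<in>covers Y f X' h. (-1 :: int) ^ card Q) * (-1) ^ rho G X = (-1) ^ (rho G Y + rho G X')"
proof -
  interpret EC: edge_cover "orbs G (fiber_prod Y f X' h)" "orbs G Y" "orbs G X'" "orbs G X"
    "(`) fst" "(`) snd" "(`) f" "(`) h"
    by (rule Fib_edge_cover[OF assms])
  show ?thesis
    using EC.cover_sum_minus_one Fib_edge_exists[OF inE_gset[OF Y] inE_gset[OF X'] surj_gmaps_gmaps[OF f] surj_gmaps_gmaps[OF h]]
    unfolding covers_def rho_eq_card
    by blast
qed

lemma covers_sum_minus_two:
  assumes odd: "odd_order G E" and X: "X \<in> E" and Y: "Y \<in> E" and X': "X' \<in> E"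
    and f: "f \<in> surj_gmaps G Y X" and h: "h \<in> surj_gmaps G X' X"
  shows "(\<Sum>Q\<in>covers Y f X' h. (-2 :: int) ^ card Q) * (-2) ^ rho G X = (-2) ^ (rho G Y + rho G X')"
proof -
  interpret EC: edge_cover "orbs G (fiber_prod Y f X' h)" "orbs G Y" "orbs G X'" "orbs G X"
    "(`) fst" "(`) snd" "(`) f" "(`) h"
    by (rule Fib_edge_cover[OF E_inE[OF Y] E_inE[OF X'] f h])
  show ?thesis
    using EC.cover_sum_minus_two Fib_edge_odd[OF odd X Y X' surj_gmaps_gmaps[OF f] surj_gmaps_gmaps[OF h]]
    unfolding covers_def rho_eq_card
    by blast
qed

text \<open>The number of orbits of the object behind an atom; \<open>gset_iso_B_rho\<close> makes
  it independent of the object chosen.\<close>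

definition rhoB :: "(('i, 'g univ) pro_endo, 'y) gset \<Rightarrow> nat" where
  "rhoB A = (THE n. \<exists>X\<in>E. pts X \<noteq> {} \<and> gset_iso H A (B X) \<and> n = rho G X)"

lemma rhoB_eq:
  assumes A: "is_gset H A" and X: "X \<in> E" "pts X \<noteq> {}" "gset_iso H A (B X)"
  shows "rhoB A = rho G X"
  unfolding rhoB_def
proof (rule the_equality)
  fix n assume "\<exists>X\<in>E. pts X \<noteq> {} \<and> gset_iso H A (B X) \<and> n = rho G X"
  then obtain Y where Y: "Y \<in> E" "pts Y \<noteq> {}" "gset_iso H A (B Y)" "n = rho G Y"
    by blast
  have "gset_iso H (B Y) (B X)"
    using gset_iso_trans[OF is_gset_B gset_iso_sym[OF A is_gset_B Y(3)] X(3)] .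
  then show "n = rho G X"
    using gset_iso_B_rho[OF Y(1,2) X(1,2)] Y(4) by simp
qed (use X in blast)

lemma rhoB_atom: "A \<in> At \<Longrightarrow> X \<in> E \<Longrightarrow> pts X \<noteq> {} \<Longrightarrow> \<phi> \<in> gisos H A (B X) \<Longrightarrow> rhoB A = rho G X"
  by (rule rhoB_eq) (auto simp: gset_iso_def atom_gset)

lemma rhoB_le:
  assumes "AY \<in> At" "AX \<in> At" "F \<in> gmaps H AY AX"
  shows "rhoB AX \<le> rhoB AY"
proof -
  obtain Y \<phi>Y where Y: "Y \<in> E" "pts Y \<noteq> {}" "\<phi>Y \<in> gisos H AY (B Y)"
    using assms(1) by (rule atomE)
  obtain X \<phi>X where X: "X \<in> E" "pts X \<noteq> {}" "\<phi>X \<in> gisos H AX (B X)"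
    using assms(2) by (rule atomE)
  obtain f where "f \<in> surj_gmaps G Y X"
    using atom_map[OF assms(1) Y(3,1,2) X(3,1) assms(3)] by blast
  then have "rho G X \<le> rho G Y"
    using rho_surj_le inE_finite[OF E_inE[OF Y(1)]] by blast
  then show ?thesis
    using rhoB_atom[OF assms(1) Y] rhoB_atom[OF assms(2) X] by simp
qed

text \<open>Multiplicativity along AY -> AX -> 1 leaves no other value when c is nonzero. By
  \<open>rhoB_le\<close> the subtraction is not truncated on morphisms of atoms.\<close>

definition power_measure :: "int \<Rightarrow> (('i, 'g univ) pro_endo, 'y, int) gmeasure" where
  "power_measure c AY AX F = c ^ (rhoB AY - rhoB AX)"

lemma rhoB_one: "rhoB (one_gset :: (('i, 'g univ) pro_endo, ('i, 'g univ) pro_endo univ) gset) = 1"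
proof -
  obtain X where X: "X \<in> E" "is_singleton (pts X)" "rho G X = 1"
    by (rule singleton_object)
  then show ?thesis
    using rhoB_eq[OF atom_gset[OF one_atom] X(1) _ one_gset_iso[OF X(1,2)]]
    by (auto simp: is_singleton_def)
qed

text \<open>Multiplied by suitable powers of c, which can be cancelled in the integers, the sum
  formula becomes the edge cover identity of the hypothesis.\<close>

lemma power_measure_orbit_measure:
  assumes c: "c \<noteq> 0"
    and sum: "\<And>X Y X' f h. X \<in> E \<Longrightarrow> Y \<in> E \<Longrightarrow> X' \<in> E \<Longrightarrow>
      f \<in> surj_gmaps G Y X \<Longrightarrow> h \<in> surj_gmaps G X' X \<Longrightarrow>
      (\<Sum>Q\<in>covers Y f X' h. c ^ card Q) * c ^ rho G X = c ^ (rho G Y + rho G X')"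
  shows "orbit_measure H C (power_measure c)"
  unfolding orbit_measure_def
proof (intro conjI ballI allI impI)
  fix AY AX F assume "AY \<in> At" "AX \<in> At" and F: "F \<in> gisos H AY AX"
  then show "power_measure c AY AX F = 1"
    using rhoB_le[of AY AX F] rhoB_le[of AX AY] gisos_inv[OF _ _ F] atom_gset gisos_gmaps
    by (fastforce simp: power_measure_def)
next
  fix AZ AY AX F K assume "AZ \<in> At" "AY \<in> At" "AX \<in> At" "F \<in> gmaps H AZ AY" "K \<in> gmaps H AY AX"
  then show "power_measure c AZ AX (compose (pts AZ) K F) = power_measure c AY AX K * power_measure c AZ AY F"
    using rhoB_le[of AY AX K] rhoB_le[of AZ AY F] by (simp add: power_measure_def power_add[symmetric])
next
  fix AY AX AX' F K and J :: "nat set" and A P Q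
  assume at: "AY \<in> At" "AX \<in> At" "AX' \<in> At" and FK: "F \<in> gmaps H AY AX" "K \<in> gmaps H AX' AX"
    and fam: "finite J \<and> (\<forall>i\<in>J. A i \<in> At \<and> P i \<in> gmaps H (A i) AY \<and> Q i \<in> gmaps H (A i) AX') \<and>
      bij_betw (\<lambda>(i, a). (P i a, Q i a)) (SIGMA i:J. pts (A i)) (pts (fiber_prod AY F AX' K))"
  obtain Y \<phi>Y where Y: "Y \<in> E" "pts Y \<noteq> {}" "\<phi>Y \<in> gisos H AY (B Y)"
    using at(1) by (rule atomE)
  obtain X \<phi>X where X: "X \<in> E" "pts X \<noteq> {}" "\<phi>X \<in> gisos H AX (B X)"
    using at(2) by (rule atomE)
  obtain X' \<phi>X' where X': "X' \<in> E" "pts X' \<noteq> {}" "\<phi>X' \<in> gisos H AX' (B X')"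
    using at(3) by (rule atomE)
  obtain f h W D where f: "f \<in> surj_gmaps G Y X" and h: "h \<in> surj_gmaps G X' X" and
    D: "bij_betw D J (ample Y f X' h)" and
    W: "\<And>i. i \<in> J \<Longrightarrow> W i \<in> E \<and> pts (W i) \<noteq> {} \<and> gset_iso H (A i) (B (W i)) \<and>
      gset_iso G (W i) (sub_gset (prod_gset Y X') (D i))"
    by (rule atom_decomposition[OF FK at(1) Y(3,1,2) at(2) X(3,1,2) at(3) X'(3,1,2), of J A P Q])
      (use fam in blast)+
  have r: "rhoB AY = rho G Y" "rhoB AX = rho G X" "rhoB AX' = rho G X'"
    using rhoB_atom[OF at(1) Y] rhoB_atom[OF at(2) X] rhoB_atom[OF at(3) X'] .
  have rA: "rhoB (A i) = rho G (sub_gset (prod_gset Y X') (D i))" if i: "i \<in> J" for i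
  proof -
    have "is_gset H (A i)" "is_gset G (W i)"
      using fam i atom_gset W[OF i] E_gset by auto
    then show ?thesis
      using rhoB_eq[of "A i" "W i"] W[OF i]
        gset_iso_rho[of G "W i" "sub_gset (prod_gset Y X') (D i)"] by simp
  qed
  have le: "rho G X' \<le> rhoB (A i)" if i: "i \<in> J" for i
    using rhoB_le[of "A i" AX' "Q i"] fam at i r by auto
  have le': "rho G X \<le> rho G Y"
    using rhoB_le[OF at(1,2) FK(1)] r by simp
  let ?S = "\<Sum>i\<in>J. power_measure c (A i) AX' (Q i)"
  have "?S * c ^ rho G X' = (\<Sum>i\<in>J. c ^ rhoB (A i))"
    unfolding sum_distrib_right
    by (rule sum.cong[OF refl]) (use le in \<open>simp add: power_measure_def r power_add[symmetric]\<close>)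
  also have "\<dots> = (\<Sum>i\<in>J. c ^ rho G (sub_gset (prod_gset Y X') (D i)))"
    by (rule sum.cong[OF refl]) (simp add: rA)
  also have "\<dots> = (\<Sum>Q\<in>covers Y f X' h. c ^ card Q)"
    using sum.reindex_bij_betw[OF D, of "\<lambda>D. c ^ rho G (sub_gset (prod_gset Y X') D)"]
      sum_ample[OF E_gset[OF Y(1)] E_gset[OF X'(1)] surj_gmaps_gmaps[OF f] surj_gmaps_gmaps[OF h], of "\<lambda>n. c ^ n"]
    by simp
  finally have "?S * c ^ rho G X' * c ^ rho G X = c ^ (rho G Y - rho G X) * c ^ rho G X' * c ^ rho G X"
    using sum[OF X(1) Y(1) X'(1) f h] le' by (simp add: power_add[symmetric])
  then show "power_measure c AY AX F = ?S"
    using c by (simp add: power_measure_def r)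
qed

lemma power_measure_is_power_measure:
  assumes "orbit_measure H C (power_measure c :: (('i, 'g univ) pro_endo, ('i, 'g univ) pro_endo univ, int) gmeasure)"
  shows "is_power_measure c G E \<Omega> (power_measure c)"
  unfolding is_power_measure_def
proof (intro conjI ballI impI assms)
  fix X and A :: "(('i, 'g univ) pro_endo, ('i, 'g univ) pro_endo univ) gset"
  assume X: "X \<in> E" "pts X \<noteq> {}" and A: "A \<in> At" "gset_iso H A (B X)"
  show "atom_measure (power_measure c) A = c ^ (rho G X - 1)"
    using rhoB_eq[OF atom_gset[OF A(1)] X A(2)] rhoB_one by (simp add: atom_measure_def power_measure_def)
qed

lemma alpha_exists: "is_power_measure (-1) G E \<Omega> (power_measure (-1))"
  by (intro power_measure_is_power_measure power_measure_orbit_measure covers_sum_minus_one E_inE) auto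

lemma beta_exists: "odd_order G E \<Longrightarrow> is_power_measure (-2) G E \<Omega> (power_measure (-2))"
  by (intro power_measure_is_power_measure power_measure_orbit_measure covers_sum_minus_two) auto

end

section \<open>The values of a regular measure\<close>

lemma unit_cancel:
  fixes a b c :: "'a::comm_ring_1"
  assumes "c dvd 1" "c * a = c * b" shows "a = b"
proof -
  obtain d where "1 = c * d"
    using assms(1) by (auto simp: dvd_def)
  then have "a = d * (c * a)" "b = d * (c * b)"
    by (metis mult.assoc mult.commute mult_1)+
  then show ?thesis
    using assms(2) by simp
qed

locale regular_pro = order_with_pro G T E \<Omega>
  for G :: "('g, 'm) monoid_scheme" and T :: "'g topology" and E :: "('g, 'g univ) gset set"
    and \<Omega> :: "('i, 'g, 'g univ) pro_obj" +
  fixes \<mu> :: "(('i, 'g univ) pro_endo, ('i, 'g univ) pro_endo univ, 'k::comm_ring_1) gmeasure"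
  assumes regular: "regular_measure (pro_Aut G \<Omega>) (assoc_order G E \<Omega>) \<mu>"
begin

abbreviation "am A \<equiv> atom_measure \<mu> A"

lemma orbit_measure: "orbit_measure H C \<mu>"
  using regular by (simp add: regular_measure_def)

lemma am_unit: "A \<in> At \<Longrightarrow> am A dvd 1"
  using regular by (simp add: regular_measure_def)

lemma mu_iso: "AY \<in> At \<Longrightarrow> AX \<in> At \<Longrightarrow> F \<in> gisos H AY AX \<Longrightarrow> \<mu> AY AX F = 1"
  using orbit_measure unfolding orbit_measure_def by blast

lemma mu_comp: "AZ \<in> At \<Longrightarrow> AY \<in> At \<Longrightarrow> AX \<in> At \<Longrightarrow> F \<in> gmaps H AZ AY \<Longrightarrow> K \<in> gmaps H AY AX \<Longrightarrow>
    \<mu> AZ AX (compose (pts AZ) K F) = \<mu> AY AX K * \<mu> AZ AY F"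
  using orbit_measure unfolding orbit_measure_def by blast

lemma mu_fiber:
  assumes "AY \<in> At" "AX \<in> At" "AX' \<in> At" "F \<in> gmaps H AY AX" "K \<in> gmaps H AX' AX"
    and "finite (J::nat set)"
    and "\<And>i. i \<in> J \<Longrightarrow> A i \<in> At \<and> P i \<in> gmaps H (A i) AY \<and> Q i \<in> gmaps H (A i) AX'"
    and "bij_betw (\<lambda>(i, a). (P i a, Q i a)) (SIGMA i:J. pts (A i)) (pts (fiber_prod AY F AX' K))"
  shows "\<mu> AY AX F = (\<Sum>i\<in>J. \<mu> (A i) AX' (Q i))"
  using orbit_measure[unfolded orbit_measure_def, THEN conjunct2, THEN conjunct2,
      rule_format, OF assms(1-5), of J A P Q] assms(6-8) by blast

lemma const_gmaps: "A \<in> At \<Longrightarrow> (\<lambda>x\<in>pts A. (0, {})) \<in> gmaps H A one_gset"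
  using gmapsI[OF atom_gset, of A "\<lambda>_. (0, {})" one_gset] by (simp add: one_gset_def)

text \<open>Multiplicativity along AY -> AX -> 1. Through it, regularity reduces questions about
  morphisms to values on atoms.\<close>

lemma am_mu:
  assumes "AY \<in> At" "AX \<in> At" "F \<in> gmaps H AY AX"
  shows "am AY = am AX * \<mu> AY AX F"
proof -
  have "compose (pts AY) (\<lambda>x\<in>pts AX. (0, {}) :: ('i, 'g univ) pro_endo univ) F = (\<lambda>x\<in>pts AY. (0, {}))"
    using gmaps_mem[OF assms(3)] by (auto simp: compose_def)
  then show ?thesis
    using mu_comp[OF assms(1,2) one_atom assms(3) const_gmaps[OF assms(2)]]
    by (simp add: atom_measure_def)
qed

lemma am_iso: "AY \<in> At \<Longrightarrow> AX \<in> At \<Longrightarrow> gset_iso H AY AX \<Longrightarrow> am AY = am AX"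
  using am_mu[of AY AX] mu_iso[of AY AX] gisos_gmaps unfolding gset_iso_def by fastforce

lemma am_one: "am one_gset = 1"
proof -
  have "(\<lambda>x\<in>pts one_gset. (0, {})) \<in> gisos H one_gset one_gset"
    using const_gmaps[OF one_atom] by (auto simp: gisos_def one_gset_def bij_betw_def)
  then show ?thesis
    using mu_iso[OF one_atom one_atom] by (simp add: atom_measure_def)
qed

definition mE :: "('g, 'g univ) gset \<Rightarrow> 'k" where
  "mE X = am (SOME A. A \<in> At \<and> gset_iso H A (B X))"

text \<open>The value of the measure as a function of G-sets on any point type. For nonempty sets
  isomorphic to an object of \<open>E\<close> the choices made here are immaterial
  (\<open>m_eq\<close>).\<close>

definition m :: "('g, 'y) gset \<Rightarrow> 'k" where
  "m Z = mE (SOME X. X \<in> E \<and> gset_iso G X Z)"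

lemma m_eq:
  assumes Z: "is_gset G Z" and X: "X \<in> E" "pts X \<noteq> {}" "gset_iso G X Z"
    and A: "A \<in> At" "gset_iso H A (B X)"
  shows "m Z = am A"
proof -
  define X0 where "X0 = (SOME X. X \<in> E \<and> gset_iso G X Z)"
  have X0: "X0 \<in> E" "gset_iso G X0 Z"
    using someI[of "\<lambda>X. X \<in> E \<and> gset_iso G X Z" X] X unfolding X0_def by blast+
  have iso: "gset_iso G X X0"
    using gset_iso_trans[OF E_gset[OF X(1)] X(3) gset_iso_sym[OF E_gset[OF X0(1)] Z X0(2)]] .
  then have "pts X0 \<noteq> {}"
    using X(2) by (auto simp: gset_iso_def gisos_def bij_betw_def)
  define A0 where "A0 = (SOME A. A \<in> At \<and> gset_iso H A (B X0))"
  obtain A1 \<phi> where "A1 \<in> At" "\<phi> \<in> gisos H A1 (B X0)"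
    by (rule atom_exists[OF X0(1) \<open>pts X0 \<noteq> {}\<close>])
  then have A0: "A0 \<in> At" "gset_iso H A0 (B X0)"
    using someI[of "\<lambda>A. A \<in> At \<and> gset_iso H A (B X0)" A1] unfolding A0_def gset_iso_def by blast+
  have "gset_iso H (B X) (B X0)"
    using iso bmap_gisos[OF E_gset[OF X(1)] E_gset[OF X0(1)]] unfolding gset_iso_def by blast
  then have "gset_iso H A (B X0)"
    by (rule gset_iso_trans[OF atom_gset[OF A(1)] A(2)])
  then have "gset_iso H A A0"
    using gset_iso_trans[OF atom_gset[OF A(1)]] gset_iso_sym[OF atom_gset[OF A0(1)] is_gset_B A0(2)] by blast
  then show ?thesis
    using am_iso[OF A(1) A0(1)] by (simp add: m_def mE_def A0_def X0_def)
qed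

lemma m_ex:
  assumes Z: "inE Z" "pts Z \<noteq> {}"
  obtains X A where "X \<in> E" "pts X \<noteq> {}" "gset_iso G X Z" "A \<in> At" "gset_iso H A (B X)"
proof -
  obtain X where X: "X \<in> E" "gset_iso G X Z"
    using Z(1) by (auto simp: inE_def)
  then have ne: "pts X \<noteq> {}"
    using Z(2) by (auto simp: gset_iso_def gisos_def bij_betw_def)
  obtain A \<phi> where "A \<in> At" "\<phi> \<in> gisos H A (B X)"
    by (rule atom_exists[OF X(1) ne])
  then show ?thesis
    using that X ne unfolding gset_iso_def by blast
qed

lemma m_unit: "inE Z \<Longrightarrow> pts Z \<noteq> {} \<Longrightarrow> m Z dvd 1"
  by (metis am_unit inE_gset m_eq m_ex)

lemma m_iso:
  assumes "inE Z" "pts Z \<noteq> {}" "is_gset G Z'" "gset_iso G Z Z'"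
  shows "m Z = m Z'"
proof -
  obtain X A where X: "X \<in> E" "pts X \<noteq> {}" "gset_iso G X Z" "A \<in> At" "gset_iso H A (B X)"
    by (rule m_ex[OF assms(1,2)])
  have "gset_iso G X Z'"
    by (rule gset_iso_trans[OF E_gset[OF X(1)] X(3) assms(4)])
  then show ?thesis
    using m_eq[OF inE_gset[OF assms(1)] X] m_eq[OF assms(3) X(1,2) _ X(4,5)] by simp
qed

lemma m_singleton:
  assumes "inE Z" "is_singleton (pts Z)"
  shows "m Z = 1"
proof -
  have ne: "pts Z \<noteq> {}"
    using assms by (auto simp: is_singleton_def)
  obtain X A where X: "X \<in> E" "pts X \<noteq> {}" "gset_iso G X Z" "A \<in> At" "gset_iso H A (B X)"
    by (rule m_ex[OF assms(1) ne])
  obtain f where "bij_betw f (pts X) (pts Z)"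
    using X(3) by (auto simp: gset_iso_def gisos_def)
  then have "is_singleton (pts X)"
    using assms(2) by (metis bij_betw_same_card is_singleton_altdef)
  then show ?thesis
    using m_eq[OF inE_gset[OF assms(1)] X(1-3) one_atom one_gset_iso] X(1) am_one by simp
qed

lemma ample_gset_E:
  assumes "inE Y" "inE X'" "pts Y \<noteq> {}" "D \<in> ample Y f X' h"
  shows "inE (sub_gset (prod_gset Y X') D)" "pts (sub_gset (prod_gset Y X') D) \<noteq> {}"
  using assms by (auto simp: ample_def intro: inE_sub inE_prod)

text \<open>The sum formula multiplied by the values at AX and AX', so that only values on atoms
  remain.\<close>

lemma m_fiber_E:
  assumes f: "f \<in> surj_gmaps G Y X" and h: "h \<in> surj_gmaps G X' X"
    and E: "X \<in> E" "Y \<in> E" "X' \<in> E" and ne: "pts Y \<noteq> {}"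
  shows "m Y * m X' = m X * (\<Sum>D\<in>ample Y f X' h. m (sub_gset (prod_gset Y X') D))"
proof -
  have neX: "pts X \<noteq> {}" and neX': "pts X' \<noteq> {}"
    using surj_gmaps_image[OF f] surj_gmaps_image[OF h] ne by auto
  obtain AY \<phi>Y where AY: "AY \<in> At" "\<phi>Y \<in> gisos H AY (B Y)"
    by (rule atom_exists[OF E(2) ne])
  obtain AX \<phi>X where AX: "AX \<in> At" "\<phi>X \<in> gisos H AX (B X)"
    by (rule atom_exists[OF E(1) neX])
  obtain AX' \<phi>X' where AX': "AX' \<in> At" "\<phi>X' \<in> gisos H AX' (B X')"
    by (rule atom_exists[OF E(3) neX'])
  have mY: "m Y = am AY" and mX: "m X = am AX" and mX': "m X' = am AX'"
    using m_eq[OF E_gset _ _ gset_iso_refl[OF E_gset]] AY AX AX' E ne neX neX' unfolding gset_iso_def by blast+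
  obtain F K and J :: "nat set" and A P Q D where FK: "F \<in> gmaps H AY AX" "K \<in> gmaps H AX' AX" "finite J" and
    fam: "\<And>i. i \<in> J \<Longrightarrow> A i \<in> At \<and> P i \<in> gmaps H (A i) AY \<and> Q i \<in> gmaps H (A i) AX'" and
    bij: "bij_betw (\<lambda>(i, a). (P i a, Q i a)) (SIGMA i:J. pts (A i)) (pts (fiber_prod AY F AX' K))" and
    D: "bij_betw D J (ample Y f X' h)" and
    W: "\<And>i. i \<in> J \<Longrightarrow> \<exists>W\<in>E. pts W \<noteq> {} \<and> gset_iso H (A i) (B W) \<and>
      gset_iso G W (sub_gset (prod_gset Y X') (D i))"
    by (rule atom_decomposition_exists[OF f h AY E(2) ne AX AX' E(3)]) blast
  have mA: "m (sub_gset (prod_gset Y X') (D i)) = am (A i)" if i: "i \<in> J" for i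
  proof -
    obtain V where V: "V \<in> E" "pts V \<noteq> {}" "gset_iso H (A i) (B V)"
      "gset_iso G V (sub_gset (prod_gset Y X') (D i))"
      using W[OF i] by blast
    have "D i \<in> ample Y f X' h"
      using D i by (auto simp: bij_betw_def)
    then have "is_gset G (sub_gset (prod_gset Y X') (D i))"
      using ample_gset_E[OF E_inE[OF E(2)] E_inE[OF E(3)] ne] inE_gset by blast
    then show ?thesis
      using m_eq[OF _ V(1,2,4) _ V(3)] fam[OF i] by blast
  qed
  have "m Y * m X' = am AX * (am AX' * \<mu> AY AX F)"
    using am_mu[OF AY(1) AX(1) FK(1)] by (simp add: mY mX' ac_simps)
  also have "am AX' * \<mu> AY AX F = (\<Sum>i\<in>J. am AX' * \<mu> (A i) AX' (Q i))"
    using mu_fiber[OF AY(1) AX(1) AX'(1) FK fam bij] by (simp add: sum_distrib_left)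
  also have "\<dots> = (\<Sum>i\<in>J. m (sub_gset (prod_gset Y X') (D i)))"
  proof (rule sum.cong[OF refl])
    fix i assume i: "i \<in> J"
    show "am AX' * \<mu> (A i) AX' (Q i) = m (sub_gset (prod_gset Y X') (D i))"
      using am_mu[OF _ AX'(1), of "A i" "Q i"] fam[OF i] mA[OF i] by simp
  qed
  also have "\<dots> = (\<Sum>D\<in>ample Y f X' h. m (sub_gset (prod_gset Y X') D))"
    by (rule sum.reindex_bij_betw[OF D])
  finally show ?thesis
    by (simp add: mX)
qed

lemma iso_invariant:
  assumes U: "is_gset G U" and \<phi>: "\<phi> \<in> gisos G U V" and D: "invariant_set G U D"
  shows "invariant_set G V (\<phi> ` D)" "gset_iso G (sub_gset U D) (sub_gset V (\<phi> ` D))"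
proof -
  have m: "x \<in> pts U" "\<And>g. g \<in> carrier G \<Longrightarrow> act U g x \<in> D" if "x \<in> D" for x
    using D that by (auto simp: invariant_set_def)
  have a: "\<phi> (act U g x) = act V g (\<phi> x)" if "x \<in> D" "g \<in> carrier G" for g x
    using gmaps_act[OF gisos_gmaps[OF \<phi>]] m that by blast
  show i: "invariant_set G V (\<phi> ` D)"
    unfolding invariant_set_def
    using m a gmaps_mem[OF gisos_gmaps[OF \<phi>]] by (auto simp: a[symmetric])
  have "restrict \<phi> (pts (sub_gset U D)) \<in> gmaps G (sub_gset U D) (sub_gset V (\<phi> ` D))"
    by (rule gmapsI[OF is_gset_sub[OF U D]]) (simp_all add: a)
  moreover have "inj_on \<phi> D"
    using inj_on_subset[OF bij_betw_imp_inj_on[OF gisos_bij[OF \<phi>]]] D by (simp add: invariant_set_def)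
  ultimately show "gset_iso G (sub_gset U D) (sub_gset V (\<phi> ` D))"
    by (auto simp: gset_iso_def gisos_def bij_betw_def inj_on_def)
qed

lemma ample_transport:
  assumes Y: "is_gset G Y" and X': "is_gset G X'" and \<eta>: "\<eta> \<in> gisos G Y Y2" and \<zeta>: "\<zeta> \<in> gisos G X' X2"
    and e: "\<And>y z. y \<in> pts Y \<Longrightarrow> z \<in> pts X' \<Longrightarrow> f y = h z \<Longrightarrow> f2 (\<eta> y) = h2 (\<zeta> z)"
    and D: "D \<in> ample Y f X' h"
  shows "map_prod \<eta> \<zeta> ` D \<in> ample Y2 f2 X2 h2"
    and "gset_iso G (sub_gset (prod_gset Y X') D) (sub_gset (prod_gset Y2 X2) (map_prod \<eta> \<zeta> ` D))"
proof -
  have D': "invariant_set G (prod_gset Y X') D" "fst ` D = pts Y" "snd ` D = pts X'"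
    "\<And>y z. (y, z) \<in> D \<Longrightarrow> f y = h z"
    using D by (auto simp: ample_def)
  have DD: "D \<subseteq> pts Y \<times> pts X'"
    using D'(1) by (simp add: invariant_set_def)
  have im: "restrict (map_prod \<eta> \<zeta>) (pts Y \<times> pts X') ` D = map_prod \<eta> \<zeta> ` D"
    using DD by (intro image_cong) auto
  note i = iso_invariant[OF is_gset_prod[OF Y X'] prod_gisos[OF Y X' \<eta> \<zeta>] D'(1), unfolded im]
  show "gset_iso G (sub_gset (prod_gset Y X') D) (sub_gset (prod_gset Y2 X2) (map_prod \<eta> \<zeta> ` D))"
    by (rule i(2))
  have "fst ` map_prod \<eta> \<zeta> ` D = \<eta> ` fst ` D" "snd ` map_prod \<eta> \<zeta> ` D = \<zeta> ` snd ` D"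
    by (simp_all add: image_image)
  then have fs: "fst ` map_prod \<eta> \<zeta> ` D = pts Y2" "snd ` map_prod \<eta> \<zeta> ` D = pts X2"
    using D' gisos_bij[OF \<eta>] gisos_bij[OF \<zeta>] by (simp_all add: bij_betw_def)
  have ff: "f2 y = h2 z" if im: "(y, z) \<in> map_prod \<eta> \<zeta> ` D" for y z
  proof -
    obtain w where "(y, z) = map_prod \<eta> \<zeta> w" "w \<in> D"
      by (rule imageE[OF im])
    then have yz: "(fst w, snd w) \<in> D" "y = \<eta> (fst w)" "z = \<zeta> (snd w)"
      by (simp_all add: map_prod_def case_prod_beta)
    then have "fst w \<in> pts Y" "snd w \<in> pts X'"
      using DD by blast+
    then show ?thesis
      using e[OF _ _ D'(4)[OF yz(1)]] yz by simp
  qed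
  have "case w of (y, z) \<Rightarrow> f2 y = h2 z" if "w \<in> map_prod \<eta> \<zeta> ` D" for w
    using that ff[of "fst w" "snd w"] by (simp add: case_prod_beta)
  then show "map_prod \<eta> \<zeta> ` D \<in> ample Y2 f2 X2 h2"
    using i(1) fs unfolding ample_def by blast
qed

text \<open>The square is replaced by an isomorphic one in \<open>E\<close>, and the ample sets
  correspond under the product of the isomorphisms. The extension to all point types is needed
  because the squares used below have numbers, sums and sets of orbits as points.\<close>

lemma m_fiber:
  assumes f: "f \<in> surj_gmaps G Y X" and h: "h \<in> surj_gmaps G X' X"
    and E: "inE X" "inE Y" "inE X'" and ne: "pts Y \<noteq> {}"
  shows "m Y * m X' = m X * (\<Sum>D\<in>ample Y f X' h. m (sub_gset (prod_gset Y X') D))"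
proof -
  have neX: "pts X \<noteq> {}" and neX': "pts X' \<noteq> {}"
    using surj_gmaps_image[OF f] surj_gmaps_image[OF h] ne by auto
  have g: "is_gset G X" "is_gset G Y" "is_gset G X'"
    using E inE_gset by auto
  obtain X0 \<xi> where X0: "X0 \<in> E" "\<xi> \<in> gisos G X0 X"
    using inE_rep[OF E(1)] by blast
  obtain Y0 \<eta> where Y0: "Y0 \<in> E" "\<eta> \<in> gisos G Y0 Y"
    using inE_rep[OF E(2)] by blast
  obtain X'0 \<zeta> where X'0: "X'0 \<in> E" "\<zeta> \<in> gisos G X'0 X'"
    using inE_rep[OF E(3)] by blast
  note g0 = E_gset[OF X0(1)] E_gset[OF Y0(1)] E_gset[OF X'0(1)]
  define \<xi>' where "\<xi>' = restrict (inv_into (pts X0) \<xi>) (pts X)"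
  define \<eta>' where "\<eta>' = restrict (inv_into (pts Y0) \<eta>) (pts Y)"
  define \<zeta>' where "\<zeta>' = restrict (inv_into (pts X'0) \<zeta>) (pts X')"
  note inv = gisos_inv[OF g0(1) g(1) X0(2)] gisos_inv[OF g0(2) g(2) Y0(2)] gisos_inv[OF g0(3) g(3) X'0(2)]
  note inv = inv[folded \<xi>'_def \<eta>'_def \<zeta>'_def]
  define f0 where "f0 = compose (pts Y0) \<xi>' (compose (pts Y0) f \<eta>)"
  define h0 where "h0 = compose (pts X'0) \<xi>' (compose (pts X'0) h \<zeta>)"
  have f0: "f0 \<in> surj_gmaps G Y0 X0"
    unfolding f0_def using surj_gmaps_compose[OF g0(2) surj_gmaps_compose[OF g0(2) gisos_surj_gmaps[OF Y0(2)] f]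
      gisos_surj_gmaps[OF inv(1)]] .
  have h0: "h0 \<in> surj_gmaps G X'0 X0"
    unfolding h0_def using surj_gmaps_compose[OF g0(3) surj_gmaps_compose[OF g0(3) gisos_surj_gmaps[OF X'0(2)] h]
      gisos_surj_gmaps[OF inv(1)]] .
  have \<eta>m: "\<eta> y \<in> pts Y" if "y \<in> pts Y0" for y
    using gmaps_mem[OF gisos_gmaps[OF Y0(2)] that] .
  have \<zeta>m: "\<zeta> y \<in> pts X'" if "y \<in> pts X'0" for y
    using gmaps_mem[OF gisos_gmaps[OF X'0(2)] that] .
  have fm: "f y \<in> pts X" if "y \<in> pts Y" for y
    using gmaps_mem[OF surj_gmaps_gmaps[OF f] that] .
  have hm: "h y \<in> pts X" if "y \<in> pts X'" for y
    using gmaps_mem[OF surj_gmaps_gmaps[OF h] that] .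
  have e: "f0 y = h0 z \<longleftrightarrow> f (\<eta> y) = h (\<zeta> z)" if "y \<in> pts Y0" "z \<in> pts X'0" for y z
  proof -
    have "f0 y = \<xi>' (f (\<eta> y))" "h0 z = \<xi>' (h (\<zeta> z))"
      using that by (simp_all add: f0_def h0_def compose_eq)
    then show ?thesis
      using inj_on_eq_iff[OF bij_betw_imp_inj_on[OF gisos_bij[OF inv(1)]]] that \<eta>m \<zeta>m fm hm by metis
  qed
  have \<eta>\<eta>: "\<eta> (\<eta>' y) = y" "\<eta>' y \<in> pts Y0" if "y \<in> pts Y" for y
    using that bij_betw_inv_into_right[OF gisos_bij[OF Y0(2)]] gmaps_mem[OF gisos_gmaps[OF inv(2)]]
    by (simp_all add: \<eta>'_def)
  have \<zeta>\<zeta>: "\<zeta> (\<zeta>' y) = y" "\<zeta>' y \<in> pts X'0" if "y \<in> pts X'" for y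
    using that bij_betw_inv_into_right[OF gisos_bij[OF X'0(2)]] gmaps_mem[OF gisos_gmaps[OF inv(3)]]
    by (simp_all add: \<zeta>'_def)
  have \<eta>\<eta>': "\<eta>' (\<eta> y) = y" if "y \<in> pts Y0" for y
    using that bij_betw_inv_into_left[OF gisos_bij[OF Y0(2)]] \<eta>m by (simp add: \<eta>'_def)
  have \<zeta>\<zeta>': "\<zeta>' (\<zeta> y) = y" if "y \<in> pts X'0" for y
    using that bij_betw_inv_into_left[OF gisos_bij[OF X'0(2)]] \<zeta>m by (simp add: \<zeta>'_def)
  note t = ample_transport[OF g0(2,3) Y0(2) X'0(2), of f0 h0 f h]
  note t' = ample_transport[OF g(2,3) inv(2,3), of f h f0 h0]
  have sub: "D \<subseteq> pts Y' \<times> pts Z'" if "D \<in> ample Y' f' Z' h'" for D Y' Z' f' h'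
    using that by (auto simp: ample_def invariant_set_def)
  have bij: "bij_betw ((`) (map_prod \<eta> \<zeta>)) (ample Y0 f0 X'0 h0) (ample Y f X' h)"
  proof (rule bij_betw_byWitness[where f' = "(`) (map_prod \<eta>' \<zeta>')"])
    show "\<forall>D\<in>ample Y0 f0 X'0 h0. map_prod \<eta>' \<zeta>' ` map_prod \<eta> \<zeta> ` D = D"
    proof
      fix D assume "D \<in> ample Y0 f0 X'0 h0"
      then have D: "D \<subseteq> pts Y0 \<times> pts X'0"
        by (rule sub)
      have "(map_prod \<eta>' \<zeta>' \<circ> map_prod \<eta> \<zeta>) z = z" if "z \<in> D" for z
        using subsetD[OF D that] \<eta>\<eta>'[of "fst z"] \<zeta>\<zeta>'[of "snd z"] by (simp add: map_prod_def case_prod_beta mem_Times_iff)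
      then show "map_prod \<eta>' \<zeta>' ` map_prod \<eta> \<zeta> ` D = D"
        unfolding image_comp by (simp cong: image_cong)
    qed
    show "\<forall>D\<in>ample Y f X' h. map_prod \<eta> \<zeta> ` map_prod \<eta>' \<zeta>' ` D = D"
    proof
      fix D assume "D \<in> ample Y f X' h"
      then have D: "D \<subseteq> pts Y \<times> pts X'"
        by (rule sub)
      have "(map_prod \<eta> \<zeta> \<circ> map_prod \<eta>' \<zeta>') z = z" if "z \<in> D" for z
        using subsetD[OF D that] \<eta>\<eta>(1)[of "fst z"] \<zeta>\<zeta>(1)[of "snd z"] by (simp add: map_prod_def case_prod_beta mem_Times_iff)
      then show "map_prod \<eta> \<zeta> ` map_prod \<eta>' \<zeta>' ` D = D"
        unfolding image_comp by (simp cong: image_cong)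
    qed
    show "(`) (map_prod \<eta> \<zeta>) ` ample Y0 f0 X'0 h0 \<subseteq> ample Y f X' h"
      using t(1) e by blast
    show "(`) (map_prod \<eta>' \<zeta>') ` ample Y f X' h \<subseteq> ample Y0 f0 X'0 h0"
    proof (rule image_subsetI, rule t'(1))
      fix y z assume yz: "y \<in> pts Y" "z \<in> pts X'" "f y = h z"
      show "f0 (\<eta>' y) = h0 (\<zeta>' z)"
        unfolding e[OF \<eta>\<eta>(2)[OF yz(1)] \<zeta>\<zeta>(2)[OF yz(2)]] using yz by (simp only: \<eta>\<eta>(1) \<zeta>\<zeta>(1))
    qed
  qed
  have ne0: "pts Y0 \<noteq> {}" "pts X0 \<noteq> {}" "pts X'0 \<noteq> {}"
    using ne neX neX' gisos_bij[OF X0(2)] gisos_bij[OF Y0(2)] gisos_bij[OF X'0(2)] by (auto simp: bij_betw_def)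
  have mm: "m Y0 = m Y" "m X0 = m X" "m X'0 = m X'"
    using m_iso[OF E_inE[OF Y0(1)] ne0(1) g(2)] m_iso[OF E_inE[OF X0(1)] ne0(2) g(1)]
      m_iso[OF E_inE[OF X'0(1)] ne0(3) g(3)] X0(2) Y0(2) X'0(2) unfolding gset_iso_def by blast+
  have "m Y * m X' = m X * (\<Sum>D\<in>ample Y0 f0 X'0 h0. m (sub_gset (prod_gset Y0 X'0) D))"
    using m_fiber_E[OF f0 h0 X0(1) Y0(1) X'0(1) ne0(1)] by (simp only: mm)
  also have "(\<Sum>D\<in>ample Y0 f0 X'0 h0. m (sub_gset (prod_gset Y0 X'0) D)) =
      (\<Sum>D\<in>ample Y0 f0 X'0 h0. m (sub_gset (prod_gset Y X') (map_prod \<eta> \<zeta> ` D)))"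
  proof (rule sum.cong[OF refl])
    fix D assume D: "D \<in> ample Y0 f0 X'0 h0"
    have D2: "map_prod \<eta> \<zeta> ` D \<in> ample Y f X' h"
      using bij D by (auto simp: bij_betw_def)
    show "m (sub_gset (prod_gset Y0 X'0) D) = m (sub_gset (prod_gset Y X') (map_prod \<eta> \<zeta> ` D))"
      using ample_gset_E[OF E_inE[OF Y0(1)] E_inE[OF X'0(1)] ne0(1) D]
        inE_gset[OF ample_gset_E(1)[OF E(2,3) ne D2]]
    proof (rule m_iso)
      show "gset_iso G (sub_gset (prod_gset Y0 X'0) D) (sub_gset (prod_gset Y X') (map_prod \<eta> \<zeta> ` D))"
        by (rule t(2)) (use e D in auto)
    qed
  qed
  also have "\<dots> = (\<Sum>D\<in>ample Y f X' h. m (sub_gset (prod_gset Y X') D))"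
    by (rule sum.reindex_bij_betw[OF bij])
  finally show ?thesis .
qed

text \<open>The hypothesis \<open>fib\<close> says that the stabilizer of z is transitive on the
  points of Y over h z. An ample set contains one point over each z, hence by invariance all of
  them, so the sum over ample sets has a single term.\<close>

lemma m_pullback:
  assumes f: "f \<in> surj_gmaps G Y X" and h: "h \<in> surj_gmaps G X' X"
    and E: "inE X" "inE Y" "inE X'" and ne: "pts Y \<noteq> {}"
    and fib: "\<And>y y' z. y \<in> pts Y \<Longrightarrow> y' \<in> pts Y \<Longrightarrow> z \<in> pts X' \<Longrightarrow> f y = h z \<Longrightarrow> f y' = h z \<Longrightarrow>
      \<exists>g\<in>carrier G. act X' g z = z \<and> act Y g y = y'"
  shows "m Y * m X' = m X * m (fiber_prod Y f X' h)"
proof -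
  let ?S = "{(y, z). y \<in> pts Y \<and> z \<in> pts X' \<and> f y = h z}"
  have inv: "invariant_set G (prod_gset Y X') ?S"
    using fiber_set_invariant[OF inE_gset[OF E(2)] inE_gset[OF E(3)] surj_gmaps_gmaps[OF f] surj_gmaps_gmaps[OF h]] .
  have "ample Y f X' h = {?S}"
  proof (intro equalityI subsetI)
    fix D assume "D \<in> ample Y f X' h"
    then have D: "invariant_set G (prod_gset Y X') D" "snd ` D = pts X'" "\<And>y z. (y, z) \<in> D \<Longrightarrow> f y = h z"
      by (auto simp: ample_def)
    then have DS: "D \<subseteq> ?S"
      by (auto simp: invariant_set_def)
    have "(y', z) \<in> D" if yz: "(y', z) \<in> ?S" for y' z
    proof -
      have z: "y' \<in> pts Y" "z \<in> pts X'" "f y' = h z"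
        using yz by auto
      then obtain y where y: "(y, z) \<in> D"
        using D(2) by force
      then have y': "y \<in> pts Y" "f y = h z"
        using DS by auto
      obtain g where g: "g \<in> carrier G" "act X' g z = z" "act Y g y = y'"
        using fib[OF y'(1) z(1,2) y'(2) z(3)] by blast
      then have "act (prod_gset Y X') g (y, z) = (y', z)"
        using y' z by simp
      then show ?thesis
        using D(1) y g(1) unfolding invariant_set_def by metis
    qed
    then show "D \<in> {?S}"
      using DS by auto
  next
    fix D assume "D \<in> {?S}"
    moreover have "\<exists>z\<in>pts X'. f y = h z" if "y \<in> pts Y" for y
      using gmaps_mem[OF surj_gmaps_gmaps[OF f] that] surj_gmaps_image[OF h] by (metis imageE)
    moreover have "\<exists>y\<in>pts Y. f y = h z" if "z \<in> pts X'" for z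
      using gmaps_mem[OF surj_gmaps_gmaps[OF h] that] surj_gmaps_image[OF f] by (metis imageE)
    ultimately show "D \<in> ample Y f X' h"
      using inv by (force simp: ample_def image_iff)
  qed
  then show ?thesis
    using m_fiber[OF f h E ne] by (simp add: fiber_prod_def)
qed

section \<open>Finite sets with trivial action\<close>

definition a :: "nat \<Rightarrow> 'k" where
  "a n = m (trivial_gset {..<n} :: ('g, nat) gset)"

lemma m_trivial:
  fixes S :: "'s set"
  assumes "finite S" "S \<noteq> {}"
  shows "m (trivial_gset S :: ('g, 's) gset) = a (card S)"
proof -
  obtain e where "bij_betw e S {..<card S}"
    using ex_bij_betw_finite_nat[OF assms(1)] by (auto simp: atLeast0LessThan)
  then have "gset_iso G (trivial_gset S) (trivial_gset {..<card S})"
    by (rule trivial_iso)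
  then show ?thesis
    unfolding a_def using assms by (intro m_iso inE_trivial is_gset_trivial group_G) auto
qed

lemma a_unit: "n > 0 \<Longrightarrow> a n dvd 1"
  unfolding a_def by (rule m_unit) (auto intro: inE_trivial)

lemma a_1: "a 1 = 1"
  unfolding a_def by (rule m_singleton) (auto intro: inE_trivial simp: lessThan_Suc)

text \<open>With trivial action every subset is invariant, so the ample sets are the relations over
  U between S and S' that reach every element on both sides.\<close>

lemma a_square:
  fixes S :: "'s set" and S' :: "'t set" and U :: "'u set"
  assumes fin: "finite S" "finite S'" and ne: "S \<noteq> {}" and f: "f ` S = U" and h: "h ` S' = U"
  shows "a (card S) * a (card S') = a (card U) *
    (\<Sum>D\<in>{D. D \<subseteq> {(y, z). y \<in> S \<and> z \<in> S' \<and> f y = h z} \<and> fst ` D = S \<and> snd ` D = S'}. a (card D))"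
    (is "_ = _ * (\<Sum>D\<in>?A. _)")
proof -
  let ?S = "trivial_gset S :: ('g, 's) gset" and ?S' = "trivial_gset S' :: ('g, 't) gset"
  let ?U = "trivial_gset U :: ('g, 'u) gset"
  have g: "is_gset G ?S" "is_gset G ?S'"
    by (simp_all add: is_gset_trivial group_G)
  have f': "restrict f S \<in> surj_gmaps G ?S ?U"
    using gmapsI[OF g(1), of f ?U] f by (auto simp: surj_gmaps_def)
  have h': "restrict h S' \<in> surj_gmaps G ?S' ?U"
    using gmapsI[OF g(2), of h ?U] h by (auto simp: surj_gmaps_def)
  have finU: "finite U" and neU: "U \<noteq> {}" and ne': "S' \<noteq> {}"
    using f h fin ne by auto
  have tr: "act (prod_gset ?S ?S') g x = x" if "x \<in> S \<times> S'" for g x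
    using that by auto
  have invD: "invariant_set G (prod_gset ?S ?S') D \<longleftrightarrow> D \<subseteq> S \<times> S'" for D
    using tr unfolding invariant_set_def by (metis pts_prod_gset pts_trivial_gset subsetD)
  have cong: "(\<forall>(y, z)\<in>D. restrict f S y = restrict h S' z) \<longleftrightarrow> (\<forall>(y, z)\<in>D. f y = h z)"
    if "D \<subseteq> S \<times> S'" for D
    using that by (intro ball_cong) auto
  have am: "ample ?S (restrict f S) ?S' (restrict h S') = ?A"
  proof (rule Set.set_eqI)
    fix D
    have "D \<in> ample ?S (restrict f S) ?S' (restrict h S') \<longleftrightarrow>
        D \<subseteq> S \<times> S' \<and> (\<forall>(y, z)\<in>D. f y = h z) \<and> fst ` D = S \<and> snd ` D = S'"
    proof (cases "D \<subseteq> S \<times> S'")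
      case True
      then show ?thesis
        using cong[OF True] by (simp only: ample_def mem_Collect_eq invD pts_trivial_gset simp_thms)
    next
      case False
      then show ?thesis
        by (simp only: ample_def mem_Collect_eq invD simp_thms)
    qed
    also have "\<dots> \<longleftrightarrow> D \<in> ?A"
      by blast
    finally show "D \<in> ample ?S (restrict f S) ?S' (restrict h S') \<longleftrightarrow> D \<in> ?A" .
  qed
  have "m (sub_gset (prod_gset ?S ?S') D) = a (card D)" if D: "D \<in> ?A" for D
  proof -
    have D': "D \<subseteq> S \<times> S'" "D \<noteq> {}"
      using D ne by auto
    then have "finite D"
      using fin finite_subset by blast
    have inv: "invariant_set G (prod_gset ?S ?S') D"
      using D' invD by blast
    have iD: "inE (sub_gset (prod_gset ?S ?S') D)"
      using inv fin by (intro inE_sub inE_prod inE_trivial)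
    have "restrict (\<lambda>x. x) (pts (sub_gset (prod_gset ?S ?S') D)) \<in> gmaps G (sub_gset (prod_gset ?S ?S') D) (trivial_gset D)"
      by (rule gmapsI[OF inE_gset[OF iD]]) (use D' in auto)
    then have "gset_iso G (sub_gset (prod_gset ?S ?S') D) (trivial_gset D)"
      by (auto simp: gset_iso_def gisos_def bij_betw_def inj_on_def)
    then have "m (sub_gset (prod_gset ?S ?S') D) = m (trivial_gset D :: ('g, 's \<times> 't) gset)"
      using D' iD by (intro m_iso is_gset_trivial group_G) auto
    then show ?thesis
      using m_trivial[OF \<open>finite D\<close> D'(2)] by simp
  qed
  then have "(\<Sum>D\<in>?A. m (sub_gset (prod_gset ?S ?S') D)) = (\<Sum>D\<in>?A. a (card D))"
    by (rule sum.cong[OF refl])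
  then show ?thesis
    using m_fiber[OF f' h' inE_trivial[OF finU] inE_trivial[OF fin(1)] inE_trivial[OF fin(2)]] ne
    by (simp add: am m_trivial fin finU neU ne')
qed

text \<open>In this square one side of each fiber is a single point: n points against 1 over 0, and
  1 against 2 over 1. All n + 2 pairs are forced, and the fiber product is the only ample
  set.\<close>

lemma a_step:
  assumes "n \<ge> 1" shows "a (n + 1) * a 3 = a 2 * a (n + 2)"
proof -
  let ?f = "\<lambda>i::nat. if i < n then 0 else 1 :: nat" and ?h = "\<lambda>i::nat. if i = 0 then 0 else 1 :: nat"
  let ?F = "{(y, z). y \<in> {..n} \<and> z \<in> {0, 1, 2} \<and> ?f y = ?h z}"
  have F: "?F = (\<lambda>y. (y, 0)) ` {..<n} \<union> {(n, 1), (n, 2)}"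
    by (auto split: if_splits)
  have cF: "card ?F = n + 2"
    unfolding F by (subst card_Un_disjoint) (auto simp: card_image inj_on_def)
  have A: "{D. D \<subseteq> ?F \<and> fst ` D = {..n} \<and> snd ` D = {0, 1, 2}} = {?F}"
  proof (intro equalityI subsetI)
    fix D assume "D \<in> {D. D \<subseteq> ?F \<and> fst ` D = {..n} \<and> snd ` D = {0, 1, 2}}"
    then have D: "D \<subseteq> ?F" "fst ` D = {..n}" "snd ` D = {0, 1, 2}"
      by auto
    have "(y, 0) \<in> D" if y: "y < n" for y
    proof -
      have "y \<in> fst ` D"
        using D(2) y by simp
      then obtain z where z: "(y, z) \<in> D"
        by force
      then have "(y, z) \<in> ?F"
        using D(1) by blast
      then have "z = 0"
        using y by (auto split: if_splits)
      then show ?thesis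
        using z by simp
    qed
    moreover have "(n, z) \<in> D" if z: "z \<in> {1, 2}" for z
    proof -
      have "z \<in> snd ` D"
        using D(3) z by auto
      then obtain y where y: "(y, z) \<in> D"
        by force
      then have "(y, z) \<in> ?F"
        using D(1) by blast
      then have "y = n"
        using z by (cases "y < n") auto
      then show ?thesis
        using y by simp
    qed
    ultimately show "D \<in> {?F}"
      using D(1) unfolding F by auto
  next
    fix D assume "D \<in> {?F}"
    moreover have "fst ` ?F = {..n}" "snd ` ?F = {0, 1, 2}"
      unfolding F using assms by (auto simp: image_Un image_image image_constant_conv lessThan_empty_iff)
    ultimately show "D \<in> {D. D \<subseteq> ?F \<and> fst ` D = {..n} \<and> snd ` D = {0, 1, 2}}"
      by auto
  qed
  have "a (card {..n}) * a (card {0::nat, 1, 2}) = a (card {0::nat, 1}) *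
      (\<Sum>D\<in>{D. D \<subseteq> ?F \<and> fst ` D = {..n} \<and> snd ` D = {0, 1, 2}}. a (card D))"
    by (rule a_square) (use assms in \<open>auto simp: image_iff\<close>)
  also have "(\<Sum>D\<in>{D. D \<subseteq> ?F \<and> fst ` D = {..n} \<and> snd ` D = {0, 1, 2}}. a (card D)) = a (n + 2)"
    unfolding A using cF by (simp only: sum.insert finite.emptyI empty_iff not_False_eq_True sum.empty add_0_right)
  finally show ?thesis
    by (simp add: eval_nat_numeral)
qed

section \<open>Two quadratic relations from doubled points\<close>

lemma sum_Pow_insert:
  fixes F :: "'s set \<Rightarrow> 'k"
  assumes "finite A" "x \<notin> A"
  shows "(\<Sum>D\<in>Pow (insert x A). F D) = (\<Sum>D\<in>Pow A. F D + F (insert x D))"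
proof -
  have "(\<Sum>D\<in>Pow (insert x A). F D) = (\<Sum>D\<in>Pow A. F D) + (\<Sum>D\<in>insert x ` Pow A. F D)"
    unfolding Pow_insert using assms by (intro sum.union_disjoint) auto
  also have "(\<Sum>D\<in>insert x ` Pow A. F D) = (\<Sum>D\<in>Pow A. F (insert x D))"
    using assms by (subst sum.reindex) (auto simp: inj_on_def)
  finally show ?thesis
    by (simp add: sum.distrib)
qed

lemma sum_Collect_Pow:
  fixes K :: "'s set \<Rightarrow> 'k"
  assumes "\<And>D. D \<subseteq> F \<Longrightarrow> P D \<longleftrightarrow> Q D" "finite F"
  shows "(\<Sum>D\<in>{D. D \<subseteq> F \<and> P D}. K D) = (\<Sum>D\<in>Pow F. if Q D then K D else 0)"
  using assms by (intro sum.mono_neutral_cong_left) auto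

text \<open>Edge covers of the complete bipartite graph on 2 + 2 vertices: two perfect matchings,
  four sets of three edges, and the set of all four edges.\<close>

lemma a_quad1: "a 2 * a 2 = 2 * a 2 + 4 * a 3 + a 4"
proof -
  let ?F = "{(0, 0), (0, 1), (1, 0), (1, 1)} :: (nat \<times> nat) set"
  have F: "{(y::nat, z::nat). y \<in> {0, 1} \<and> z \<in> {0, 1} \<and> (0::nat) = 0} = ?F"
    by auto
  have "a (card {0::nat, 1}) * a (card {0::nat, 1}) = a (card {0::nat}) *
      (\<Sum>D\<in>{D. D \<subseteq> {(y::nat, z::nat). y \<in> {0, 1} \<and> z \<in> {0, 1} \<and> (0::nat) = 0} \<and> fst ` D = {0, 1} \<and> snd ` D = {0, 1}}. a (card D))"
    by (rule a_square[where f = "\<lambda>_. 0::nat" and h = "\<lambda>_. 0::nat"]) auto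
  also have "(\<Sum>D\<in>{D. D \<subseteq> {(y::nat, z::nat). y \<in> {0, 1} \<and> z \<in> {0, 1} \<and> (0::nat) = 0} \<and> fst ` D = {0, 1} \<and> snd ` D = {0, 1}}. a (card D)) =
      (\<Sum>D\<in>Pow ?F. if ((0, 0) \<in> D \<or> (0, 1) \<in> D) \<and> ((1, 0) \<in> D \<or> (1, 1) \<in> D) \<and>
        ((0, 0) \<in> D \<or> (1, 0) \<in> D) \<and> ((0, 1) \<in> D \<or> (1, 1) \<in> D) then a (card D) else 0)"
  proof (unfold F, rule sum_Collect_Pow)
    fix D assume D: "D \<subseteq> ?F"
    have sub: "A = {0, 1} \<longleftrightarrow> 0 \<in> A \<and> 1 \<in> A" if "A \<subseteq> {0, 1}" for A :: "nat set"
      using that by blast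
    have *: "fst ` D \<subseteq> {0, 1}" "snd ` D \<subseteq> {0, 1}"
      using D by auto
    have img: "y \<in> fst ` D \<longleftrightarrow> (\<exists>z. (y, z) \<in> D)" "y \<in> snd ` D \<longleftrightarrow> (\<exists>z. (z, y) \<in> D)" for y
      by force+
    have DF: "(y, z) \<in> ?F" if "(y, z) \<in> D" for y z
      using D that by blast
    have mem: "0 \<in> fst ` D \<longleftrightarrow> (0, 0) \<in> D \<or> (0, 1) \<in> D" "1 \<in> fst ` D \<longleftrightarrow> (1, 0) \<in> D \<or> (1, 1) \<in> D"
      "0 \<in> snd ` D \<longleftrightarrow> (0, 0) \<in> D \<or> (1, 0) \<in> D" "1 \<in> snd ` D \<longleftrightarrow> (0, 1) \<in> D \<or> (1, 1) \<in> D"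
      unfolding img using DF[of 0] DF[of 1] DF[of 2] DF[of _ 0] DF[of _ 1] DF[of _ 2] by auto (metis+)
    show "fst ` D = {0, 1} \<and> snd ` D = {0, 1} \<longleftrightarrow>
        ((0, 0) \<in> D \<or> (0, 1) \<in> D) \<and> ((1, 0) \<in> D \<or> (1, 1) \<in> D) \<and>
        ((0, 0) \<in> D \<or> (1, 0) \<in> D) \<and> ((0, 1) \<in> D \<or> (1, 1) \<in> D)"
      unfolding sub[OF *(1)] sub[OF *(2)] mem by argo
  qed simp
  also have "\<dots> = 2 * a 2 + 4 * a 3 + a 4"
    by (simp add: sum_Pow_insert Pow_empty eval_nat_numeral)
  finally show ?thesis
    using a_1 by (simp add: eval_nat_numeral)
qed

text \<open>The graph of \<open>a_quad1\<close> with a further component consisting of the edge (0,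
  0), which every cover must contain. The counts 2, 4, 1 therefore recur with one more edge each;
  the base now has two points.\<close>

lemma a_quad2: "a 3 * a 3 = a 2 * (2 * a 3 + 4 * a 4 + a 5)"
proof -
  let ?f = "\<lambda>i::nat. if i = 0 then 0 else 1 :: nat"
  let ?F = "{(0, 0), (1, 1), (1, 2), (2, 1), (2, 2)} :: (nat \<times> nat) set"
  have F: "{(y, z). y \<in> {0, 1, 2} \<and> z \<in> {0, 1, 2} \<and> ?f y = ?f z} = ?F"
    by (auto split: if_splits)
  have "a (card {0::nat, 1, 2}) * a (card {0::nat, 1, 2}) = a (card {0::nat, 1}) *
      (\<Sum>D\<in>{D. D \<subseteq> {(y, z). y \<in> {0, 1, 2} \<and> z \<in> {0, 1, 2} \<and> ?f y = ?f z} \<and> fst ` D = {0, 1, 2} \<and> snd ` D = {0, 1, 2}}. a (card D))"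
    by (rule a_square) auto
  also have "(\<Sum>D\<in>{D. D \<subseteq> {(y, z). y \<in> {0, 1, 2} \<and> z \<in> {0, 1, 2} \<and> ?f y = ?f z} \<and> fst ` D = {0, 1, 2} \<and> snd ` D = {0, 1, 2}}. a (card D)) =
      (\<Sum>D\<in>Pow ?F. if (0, 0) \<in> D \<and> ((1, 1) \<in> D \<or> (1, 2) \<in> D) \<and> ((2, 1) \<in> D \<or> (2, 2) \<in> D) \<and>
        ((1, 1) \<in> D \<or> (2, 1) \<in> D) \<and> ((1, 2) \<in> D \<or> (2, 2) \<in> D) then a (card D) else 0)"
  proof (unfold F, rule sum_Collect_Pow)
    fix D assume D: "D \<subseteq> ?F"
    have sub: "A = {0, 1, 2} \<longleftrightarrow> 0 \<in> A \<and> 1 \<in> A \<and> 2 \<in> A" if "A \<subseteq> {0, 1, 2}" for A :: "nat set"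
      using that by blast
    have *: "fst ` D \<subseteq> {0, 1, 2}" "snd ` D \<subseteq> {0, 1, 2}"
      using D by auto
    have img: "y \<in> fst ` D \<longleftrightarrow> (\<exists>z. (y, z) \<in> D)" "y \<in> snd ` D \<longleftrightarrow> (\<exists>z. (z, y) \<in> D)" for y
      by force+
    have DF: "(y, z) \<in> ?F" if "(y, z) \<in> D" for y z
      using D that by blast
    have mem: "0 \<in> fst ` D \<longleftrightarrow> (0, 0) \<in> D" "0 \<in> snd ` D \<longleftrightarrow> (0, 0) \<in> D"
      "1 \<in> fst ` D \<longleftrightarrow> (1, 1) \<in> D \<or> (1, 2) \<in> D" "2 \<in> fst ` D \<longleftrightarrow> (2, 1) \<in> D \<or> (2, 2) \<in> D"
      "1 \<in> snd ` D \<longleftrightarrow> (1, 1) \<in> D \<or> (2, 1) \<in> D" "2 \<in> snd ` D \<longleftrightarrow> (1, 2) \<in> D \<or> (2, 2) \<in> D"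
      unfolding img using DF[of 0] DF[of 1] DF[of 2] DF[of _ 0] DF[of _ 1] DF[of _ 2] by auto (metis+)
    show "fst ` D = {0, 1, 2} \<and> snd ` D = {0, 1, 2} \<longleftrightarrow>
        (0, 0) \<in> D \<and> ((1, 1) \<in> D \<or> (1, 2) \<in> D) \<and> ((2, 1) \<in> D \<or> (2, 2) \<in> D) \<and>
        ((1, 1) \<in> D \<or> (2, 1) \<in> D) \<and> ((1, 2) \<in> D \<or> (2, 2) \<in> D)"
      unfolding sub[OF *(1)] sub[OF *(2)] mem by argo
  qed simp
  also have "\<dots> = 2 * a 3 + 4 * a 4 + a 5"
    by (simp add: sum_Pow_insert Pow_empty eval_nat_numeral)
  finally show ?thesis
    by (simp add: eval_nat_numeral)
qed

end

section \<open>Collapsing orbits to points\<close>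

lemma act_fiber_prod: "w \<in> pts (fiber_prod Y f X' h) \<Longrightarrow>
    act (fiber_prod Y f X' h) g w = (act Y g (fst w), act X' g (snd w))"
  by (auto simp: fiber_prod_def)

context regular_pro
begin

definition ob :: "('g, 'y) gset \<Rightarrow> 'y + 'y set \<Rightarrow> 'y set" where
  "ob X e = (case e of Inl x \<Rightarrow> orb G X x | Inr A \<Rightarrow> A)"

definition blow_pts :: "('g, 'y) gset \<Rightarrow> nat set \<Rightarrow> nat set \<Rightarrow> (('y + 'y set) \<times> nat) set" where
  "blow_pts X J K = {(Inl x, j) | x j. x \<in> pts X \<and> j \<in> J \<and> j \<in> K} \<union>
     {(Inr A, j) | A j. A \<in> orbs G X \<and> j \<in> J \<and> j \<notin> K}"

text \<open>The disjoint union over \<open>j \<in> J\<close> of copies of \<open>X\<close> for \<open>j \<in> K\<close> and of its set of orbits,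
  with trivial action, for \<open>j \<notin> K\<close>.\<close>

definition blow :: "('g, 'y) gset \<Rightarrow> nat set \<Rightarrow> nat set \<Rightarrow> ('g, ('y + 'y set) \<times> nat) gset" where
  "blow X J K = sub_gset (prod_gset (coprod_gset X (trivial_gset (orbs G X))) (trivial_gset J)) (blow_pts X J K)"

definition base :: "('g, 'y) gset \<Rightarrow> nat set \<Rightarrow> ('g, 'y set \<times> nat) gset" where
  "base X J = trivial_gset (orbs G X \<times> J)"

definition blow_proj :: "('g, 'y) gset \<Rightarrow> ('y + 'y set) \<times> nat \<Rightarrow> 'y set \<times> nat" where
  "blow_proj X z = (ob X (fst z), snd z)"

lemma ob_simps [simp]: "ob X (Inl x) = orb G X x" "ob X (Inr A) = A"
  by (simp_all add: ob_def)

lemma blow_pts_iff [simp]: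
  "(Inl x, j) \<in> blow_pts X J K \<longleftrightarrow> x \<in> pts X \<and> j \<in> J \<and> j \<in> K"
  "(Inr A, j) \<in> blow_pts X J K \<longleftrightarrow> A \<in> orbs G X \<and> j \<in> J \<and> j \<notin> K"
  by (auto simp: blow_pts_def)

lemma blow_pts_cases:
  assumes "z \<in> blow_pts X J K"
  obtains x j where "z = (Inl x, j)" "x \<in> pts X" "j \<in> J" "j \<in> K"
    | A j where "z = (Inr A, j)" "A \<in> orbs G X" "j \<in> J" "j \<notin> K"
  using assms by (auto simp: blow_pts_def)

lemma pts_blow [simp]: "pts (blow X J K) = blow_pts X J K"
  by (simp add: blow_def)

lemma act_blow [simp]:
  "x \<in> pts X \<Longrightarrow> j \<in> J \<Longrightarrow> j \<in> K \<Longrightarrow> act (blow X J K) g (Inl x, j) = (Inl (act X g x), j)"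
  "A \<in> orbs G X \<Longrightarrow> j \<in> J \<Longrightarrow> j \<notin> K \<Longrightarrow> act (blow X J K) g (Inr A, j) = (Inr A, j)"
  by (simp_all add: blow_def Plus_def)

lemma inE_blow:
  assumes X: "inE X" and J: "finite J"
  shows "inE (blow X J K)"
  unfolding blow_def
proof (rule inE_sub)
  show "inE (prod_gset (coprod_gset X (trivial_gset (orbs G X))) (trivial_gset J))"
    by (intro inE_prod inE_coprod inE_trivial X J inE_finite[OF X])
  show "invariant_set G (prod_gset (coprod_gset X (trivial_gset (orbs G X))) (trivial_gset J)) (blow_pts X J K)"
    unfolding invariant_set_def
  proof (intro conjI ballI subsetI)
    fix z assume "z \<in> blow_pts X J K"
    then show "z \<in> pts (prod_gset (coprod_gset X (trivial_gset (orbs G X))) (trivial_gset J))"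
      by (rule blow_pts_cases) (auto simp: Plus_def)
  next
    fix g z assume "g \<in> carrier G" "z \<in> blow_pts X J K"
    from this(2) show "act (prod_gset (coprod_gset X (trivial_gset (orbs G X))) (trivial_gset J)) g z \<in> blow_pts X J K"
      by (rule blow_pts_cases) (use \<open>g \<in> carrier G\<close> act_closed[OF inE_gset[OF X]] in \<open>auto simp: Plus_def\<close>)
  qed
qed

lemma inE_base: "inE X \<Longrightarrow> finite J \<Longrightarrow> inE (base X J)"
  unfolding base_def by (intro inE_trivial finite_cartesian_product inE_finite)

lemma blow_proj_surj:
  assumes X: "inE X" and J: "finite J"
  shows "restrict (blow_proj X) (blow_pts X J K) \<in> surj_gmaps G (blow X J K) (base X J)"
proof -
  have mem: "blow_proj X z \<in> orbs G X \<times> J" if "z \<in> blow_pts X J K" for z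
    using that by (rule blow_pts_cases) (auto simp: blow_proj_def orb_in_orbs)
  have "restrict (blow_proj X) (pts (blow X J K)) \<in> gmaps G (blow X J K) (base X J)"
  proof (rule gmapsI[OF inE_gset[OF inE_blow[OF X J]]])
    show "blow_proj X z \<in> pts (base X J)" if "z \<in> pts (blow X J K)" for z
      using mem that by (simp add: base_def)
    show "blow_proj X (act (blow X J K) g z) = act (base X J) g (blow_proj X z)"
      if g: "g \<in> carrier G" and z: "z \<in> pts (blow X J K)" for g z
    proof -
      have "z \<in> blow_pts X J K"
        using z by simp
      then have "blow_proj X (act (blow X J K) g z) = blow_proj X z"
        by (rule blow_pts_cases) (simp_all add: blow_proj_def orb_act[OF inE_gset[OF X]] g)
      then show ?thesis
        using mem z by (simp add: base_def)
    qed
  qed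
  moreover have "blow_proj X ` blow_pts X J K = orbs G X \<times> J"
  proof (intro equalityI subsetI)
    fix w assume "w \<in> orbs G X \<times> J"
    then obtain A j where w: "w = (A, j)" "A \<in> orbs G X" "j \<in> J"
      by blast
    then obtain x where x: "x \<in> pts X" "A = orb G X x"
      by (auto simp: orbs_def)
    show "w \<in> blow_proj X ` blow_pts X J K"
      using w x by (intro image_eqI[of _ _ "if j \<in> K then (Inl x, j) else (Inr A, j)"])
        (auto simp: blow_proj_def)
  qed (use mem in blast)
  ultimately show ?thesis
    by (simp add: surj_gmaps_def base_def)
qed

lemma blow_nonempty: "inE X \<Longrightarrow> pts X \<noteq> {} \<Longrightarrow> J \<noteq> {} \<Longrightarrow> finite J \<Longrightarrow> blow_pts X J K \<noteq> {}"
proof -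
  assume "inE X" and ne: "pts X \<noteq> {}" "J \<noteq> {}" and "finite J"
  obtain x j where x: "x \<in> pts X" "j \<in> J"
    using ne by blast
  then have "(if j \<in> K then (Inl x, j) else (Inr (orb G X x), j)) \<in> blow_pts X J K"
    by (auto simp: orb_in_orbs)
  then show "blow_pts X J K \<noteq> {}"
    by blast
qed

text \<open>On an uncollapsed copy the fibers of \<open>blow_proj\<close> are orbits of X; on a
  collapsed copy they are points, and the identity serves. That last clause keeps the opposite
  corner fixed in \<open>blow_union\<close>.\<close>

lemma blow_fiber:
  assumes X: "inE X" and J: "finite J"
    and y: "y \<in> blow_pts X J K" "y' \<in> blow_pts X J K" and e: "blow_proj X y = blow_proj X y'"
  shows "\<exists>g\<in>carrier G. act (blow X J K) g y = y' \<and> (snd y \<notin> K \<longrightarrow> g = \<one>\<^bsub>G\<^esub>)"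
  using y(1)
proof (cases rule: blow_pts_cases)
  case (1 x j)
  from y(2) obtain x' where x': "y' = (Inl x', j)" "x' \<in> pts X" "orb G X x = orb G X x'"
    by (cases rule: blow_pts_cases) (use 1 e in \<open>auto simp: blow_proj_def\<close>)
  then obtain g where "g \<in> carrier G" "x' = act X g x"
    using orb_eq_iff[OF inE_gset[OF X]] 1 by blast
  then show ?thesis
    using 1 x' by auto
next
  case (2 A j)
  from y(2) have "y' = y"
    by (cases rule: blow_pts_cases) (use 2 e in \<open>auto simp: blow_proj_def\<close>)
  then show ?thesis
    using 2 group.is_monoid[OF group_G] by (intro bexI[of _ "\<one>\<^bsub>G\<^esub>"]) (auto simp: monoid.one_closed)
qed

text \<open>The projection of \<open>blow X J (K \<union> K')\<close> to \<open>blow X J K\<close>: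
  on copies outside K a point is replaced by its orbit.\<close>

definition cl :: "('g, 'y) gset \<Rightarrow> nat set \<Rightarrow> ('y + 'y set) \<times> nat \<Rightarrow> ('y + 'y set) \<times> nat" where
  "cl X K z = (if snd z \<in> K then fst z else Inr (ob X (fst z)), snd z)"

text \<open>At each index at most one of the two sets is uncollapsed, so one can move within a fiber
  on one side while the other side stays fixed, as \<open>m_pullback\<close> requires. The fiber
  product keeps X wherever either side has it.\<close>

lemma blow_union:
  assumes X: "inE X" "pts X \<noteq> {}" and J: "finite J" "J \<noteq> {}" and K: "K \<inter> K' = {}"
  shows "m (blow X J K) * m (blow X J K') = m (base X J) * m (blow X J (K \<union> K'))"
proof -
  let ?Y = "blow X J K" and ?Z = "blow X J K'" and ?V = "blow X J (K \<union> K')"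
  let ?p = "restrict (blow_proj X) (blow_pts X J K)" and ?q = "restrict (blow_proj X) (blow_pts X J K')"
  let ?Fib = "fiber_prod ?Y ?p ?Z ?q"
  have gX: "is_gset G X"
    using X(1) by (rule inE_gset)
  have pq: "?p \<in> surj_gmaps G ?Y (base X J)" "?q \<in> surj_gmaps G ?Z (base X J)"
    by (rule blow_proj_surj[OF X(1) J(1)])+
  have "m ?Y * m ?Z = m (base X J) * m ?Fib"
  proof (rule m_pullback[OF pq inE_base[OF X(1) J(1)] inE_blow[OF X(1) J(1)] inE_blow[OF X(1) J(1)]])
    show "pts ?Y \<noteq> {}"
      using blow_nonempty[OF X J(2,1)] by simp
    fix y y' z assume y: "y \<in> pts ?Y" "y' \<in> pts ?Y" and z: "z \<in> pts ?Z" and e: "?p y = ?q z" "?p y' = ?q z"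
    have e': "blow_proj X y = blow_proj X z" "blow_proj X y' = blow_proj X z"
      using y z e by auto
    obtain g where g: "g \<in> carrier G" "act ?Y g y = y'" "snd y \<notin> K \<longrightarrow> g = \<one>\<^bsub>G\<^esub>"
      using blow_fiber[OF X(1) J(1), of y K y'] y e' by auto
    have "act ?Z g z = z"
    proof (cases "snd y \<in> K")
      case True
      then have zK: "snd z \<notin> K'"
        using e' K by (auto simp: blow_proj_def)
      have "z \<in> blow_pts X J K'"
        using z by simp
      then show ?thesis
        by (cases rule: blow_pts_cases) (use zK in auto)
    next
      case False
      then show ?thesis
        using g act_one[OF inE_gset[OF inE_blow[OF X(1) J(1)]] z] by simp
    qed
    then show "\<exists>g\<in>carrier G. act ?Z g z = z \<and> act ?Y g y = y'"
      using g by blast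
  qed
  also have "m ?Fib = m ?V"
  proof -
    define \<Theta> where "\<Theta> z = (cl X K z, cl X K' z)" for z
    have mem: "\<Theta> z \<in> pts ?Fib" if "z \<in> blow_pts X J (K \<union> K')" for z
      using that
      by (cases rule: blow_pts_cases) (auto simp: \<Theta>_def cl_def pts_fiber_prod blow_proj_def orb_in_orbs)
    have act: "act ?Fib g w = (act ?Y g (fst w), act ?Z g (snd w))" if "w \<in> pts ?Fib" for g w
      using that by (rule act_fiber_prod)
    have "restrict \<Theta> (pts ?V) \<in> gmaps G ?V ?Fib"
    proof (rule gmapsI[OF inE_gset[OF inE_blow[OF X(1) J(1)]]])
      show "\<Theta> z \<in> pts ?Fib" if "z \<in> pts ?V" for z
        using mem that by simp
      show "\<Theta> (act ?V g z) = act ?Fib g (\<Theta> z)" if g: "g \<in> carrier G" and z: "z \<in> pts ?V" for g z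
      proof -
        have z': "z \<in> blow_pts X J (K \<union> K')"
          using z by simp
        have "\<Theta> (act ?V g z) = (act ?Y g (cl X K z), act ?Z g (cl X K' z))"
          using z' K by (cases rule: blow_pts_cases)
            (auto simp: \<Theta>_def cl_def orb_act[OF gX] orb_in_orbs g)
        then show ?thesis
          using act[OF mem[OF z']] by (simp add: \<Theta>_def)
      qed
    qed
    moreover have "inj_on \<Theta> (blow_pts X J (K \<union> K'))"
    proof (rule inj_onI)
      fix z w assume z: "z \<in> blow_pts X J (K \<union> K')" and w: "w \<in> blow_pts X J (K \<union> K')" and e: "\<Theta> z = \<Theta> w"
      from z show "z = w"
      proof (cases rule: blow_pts_cases)
        case (1 x j)
        from w show ?thesis
          by (cases rule: blow_pts_cases) (use 1 e in \<open>auto simp: \<Theta>_def cl_def split: if_splits\<close>)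
      next
        case (2 A j)
        from w show ?thesis
          by (cases rule: blow_pts_cases) (use 2 e in \<open>auto simp: \<Theta>_def cl_def split: if_splits\<close>)
      qed
    qed
    moreover have "pts ?Fib \<subseteq> \<Theta> ` blow_pts X J (K \<union> K')"
    proof
      fix w assume "w \<in> pts ?Fib"
      then obtain y z where w: "w = (y, z)" "y \<in> blow_pts X J K" "z \<in> blow_pts X J K'"
        "blow_proj X y = blow_proj X z"
        by (auto simp: pts_fiber_prod)
      show "w \<in> \<Theta> ` blow_pts X J (K \<union> K')"
      proof (cases "snd y \<in> K")
        case True
        then have "snd z \<notin> K'"
          using w K by (auto simp: blow_proj_def)
        with w(3) obtain A j where z: "z = (Inr A, j)"
          by (cases rule: blow_pts_cases) auto
        from w(2) True obtain x i where y: "y = (Inl x, i)" "x \<in> pts X" "i \<in> J" "i \<in> K"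
          by (cases rule: blow_pts_cases) auto
        show ?thesis
          using w y z K by (intro image_eqI[of _ _ y]) (auto simp: \<Theta>_def cl_def blow_proj_def)
      next
        case False
        from w(2) False obtain A i where y: "y = (Inr A, i)"
          by (cases rule: blow_pts_cases) auto
        from w(3) show ?thesis
          by (cases rule: blow_pts_cases; intro image_eqI[of _ _ z])
            (use w y False in \<open>auto simp: \<Theta>_def cl_def blow_proj_def\<close>)
      qed
    qed
    ultimately have "restrict \<Theta> (pts ?V) \<in> gisos G ?V ?Fib"
      using mem by (auto simp: gisos_def bij_betw_def)
    then show ?thesis
      using m_iso[OF inE_blow[OF X(1) J(1)] _ is_gset_Fib[OF inE_gset[OF inE_blow[OF X(1) J(1)]]
          inE_gset[OF inE_blow[OF X(1) J(1)]] surj_gmaps_gmaps[OF pq(1)] surj_gmaps_gmaps[OF pq(2)]]]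
        blow_nonempty[OF X J(2,1)] unfolding gset_iso_def by fastforce
  qed
  finally show ?thesis .
qed

text \<open>Pulling back along a map of sets with trivial action duplicates copies. The whole group
  fixes the points of \<open>base X J'\<close>, so \<open>blow_fiber\<close> supplies the
  transitivity that \<open>m_pullback\<close> asks for.\<close>

lemma blow_reindex:
  assumes X: "inE X" "pts X \<noteq> {}" and J: "finite J" "J \<noteq> {}" and J': "finite J'"
    and s: "\<sigma> ` J' = J"
  shows "m (blow X J K) * m (base X J') = m (base X J) * m (blow X J' (\<sigma> -` K))"
proof -
  let ?Y = "blow X J K" and ?Z = "base X J'" and ?V = "blow X J' (\<sigma> -` K)"
  let ?p = "restrict (blow_proj X) (blow_pts X J K)"
  let ?q = "\<lambda>w\<in>orbs G X \<times> J'. (fst w, \<sigma> (snd w))"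
  let ?Fib = "fiber_prod ?Y ?p ?Z ?q"
  have gX: "is_gset G X"
    using X(1) by (rule inE_gset)
  have p: "?p \<in> surj_gmaps G ?Y (base X J)"
    by (rule blow_proj_surj[OF X(1) J(1)])
  have sJ: "\<sigma> j \<in> J" if "j \<in> J'" for j
    using s that by blast
  have "restrict (\<lambda>w. (fst w, \<sigma> (snd w))) (pts ?Z) \<in> gmaps G ?Z (base X J)"
    by (rule gmapsI[OF inE_gset[OF inE_base[OF X(1) J']]]) (auto simp: base_def sJ)
  moreover have "(\<lambda>w. (fst w, \<sigma> (snd w))) ` (orbs G X \<times> J') = orbs G X \<times> J"
    using s by (auto simp: image_iff)
  ultimately have q: "?q \<in> surj_gmaps G ?Z (base X J)"
    by (simp add: surj_gmaps_def base_def)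
  have J'ne: "J' \<noteq> {}"
    using J(2) s by auto
  have "m ?Y * m ?Z = m (base X J) * m ?Fib"
  proof (rule m_pullback[OF p q inE_base[OF X(1) J(1)] inE_blow[OF X(1) J(1)] inE_base[OF X(1) J']])
    show "pts ?Y \<noteq> {}"
      using blow_nonempty[OF X J(2,1)] by simp
    fix y y' z assume y: "y \<in> pts ?Y" "y' \<in> pts ?Y" and z: "z \<in> pts ?Z" and e: "?p y = ?q z" "?p y' = ?q z"
    then have "blow_proj X y = blow_proj X y'"
      by simp
    then obtain g where "g \<in> carrier G" "act ?Y g y = y'"
      using blow_fiber[OF X(1) J(1), of y K y'] y by auto
    then show "\<exists>g\<in>carrier G. act ?Z g z = z \<and> act ?Y g y = y'"
      using z by (auto simp: base_def)
  qed
  also have "m ?Fib = m ?V"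
  proof -
    define \<Theta> where "\<Theta> z = ((fst z, \<sigma> (snd z)), blow_proj X z)" for z
    have mem: "\<Theta> z \<in> pts ?Fib" if "z \<in> blow_pts X J' (\<sigma> -` K)" for z
      using that
      by (cases rule: blow_pts_cases) (auto simp: \<Theta>_def pts_fiber_prod blow_proj_def orb_in_orbs base_def sJ)
    have act: "act ?Fib g w = (act ?Y g (fst w), snd w)" if "w \<in> pts ?Fib" for g w
      using act_fiber_prod[OF that] that by (auto simp: base_def pts_fiber_prod)
    have "restrict \<Theta> (pts ?V) \<in> gmaps G ?V ?Fib"
    proof (rule gmapsI[OF inE_gset[OF inE_blow[OF X(1) J']]])
      show "\<Theta> z \<in> pts ?Fib" if "z \<in> pts ?V" for z
        using mem that by simp
      show "\<Theta> (act ?V g z) = act ?Fib g (\<Theta> z)" if g: "g \<in> carrier G" and z: "z \<in> pts ?V" for g z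
      proof -
        have z': "z \<in> blow_pts X J' (\<sigma> -` K)"
          using z by simp
        have "\<Theta> (act ?V g z) = (act ?Y g (fst z, \<sigma> (snd z)), blow_proj X z)"
          using z' by (cases rule: blow_pts_cases)
            (auto simp: \<Theta>_def blow_proj_def orb_act[OF gX] g sJ)
        then show ?thesis
          using act[OF mem[OF z']] by (simp add: \<Theta>_def)
      qed
    qed
    moreover have "inj_on \<Theta> (blow_pts X J' (\<sigma> -` K))"
      by (auto simp: inj_on_def \<Theta>_def blow_proj_def)
    moreover have "pts ?Fib \<subseteq> \<Theta> ` blow_pts X J' (\<sigma> -` K)"
    proof
      fix w assume "w \<in> pts ?Fib"
      then obtain y A j where w: "w = (y, (A, j))" "y \<in> blow_pts X J K" "A \<in> orbs G X" "j \<in> J'"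
        "blow_proj X y = (A, \<sigma> j)"
        by (auto simp: pts_fiber_prod base_def)
      from w(2) show "w \<in> \<Theta> ` blow_pts X J' (\<sigma> -` K)"
        by (cases rule: blow_pts_cases; intro image_eqI[of _ _ "(fst y, j)"])
          (use w in \<open>auto simp: \<Theta>_def blow_proj_def\<close>)
    qed
    ultimately have "restrict \<Theta> (pts ?V) \<in> gisos G ?V ?Fib"
      using mem by (auto simp: gisos_def bij_betw_def)
    then show ?thesis
      using m_iso[OF inE_blow[OF X(1) J'] _ is_gset_Fib[OF inE_gset[OF inE_blow[OF X(1) J(1)]]
          inE_gset[OF inE_base[OF X(1) J']] surj_gmaps_gmaps[OF p] surj_gmaps_gmaps[OF q]]]
        blow_nonempty[OF X J'ne J'] unfolding gset_iso_def by fastforce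
  qed
  finally show ?thesis .
qed

lemma orbs_nonempty: "pts X \<noteq> {} \<Longrightarrow> orbs G X \<noteq> {}"
  by (simp add: orbs_def)

lemma m_base: "inE X \<Longrightarrow> pts X \<noteq> {} \<Longrightarrow> finite J \<Longrightarrow> J \<noteq> {} \<Longrightarrow> m (base X J) = a (rho G X * card J)"
  unfolding base_def rho_eq_card
  by (subst m_trivial) (simp_all add: inE_finite card_cartesian_product orbs_nonempty)

text \<open>Writing \<open>m (blow X J K) = r J K * m (base X J)\<close>, the two preceding lemmas say that \<open>r\<close> is
  multiplicative in \<open>K\<close> and invariant under surjections of \<open>J\<close>. Hence \<open>r {0,1} {0}\<close> is an idempotent
  unit, and all values of \<open>r\<close> are \<open>1\<close>.\<close>

lemma m_eq_a_rho:
  assumes X: "inE X" "pts X \<noteq> {}"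
  shows "m X = a (rho G X)"
proof -
  define b where "b J K = m (blow X J K)" for J K
  define t where "t J = m (base X J)" for J
  have bu: "b J K dvd 1" if "finite J" "J \<noteq> {}" for J K
    unfolding b_def using m_unit[OF inE_blow[OF X(1) that(1)]] blow_nonempty[OF X that(2,1)] by simp
  have tu: "t J dvd 1" if "finite J" "J \<noteq> {}" for J
    unfolding t_def using m_unit[OF inE_base[OF X(1) that(1)]] that X by (simp add: base_def orbs_def)
  have re: "b J K * t J' = t J * b J' (\<sigma> -` K)" if "finite J" "J \<noteq> {}" "finite J'" "\<sigma> ` J' = J" for J K J' \<sigma>
    unfolding b_def t_def by (rule blow_reindex[OF X that])
  have un: "b J K * b J K' = t J * b J (K \<union> K')" if "finite J" "J \<noteq> {}" "K \<inter> K' = {}" for J K K'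
    unfolding b_def t_def by (rule blow_union[OF X that])
  have loc: "b J K = b J K'" if "J \<inter> K = J \<inter> K'" for J K K'
  proof -
    have "blow_pts X J K = blow_pts X J K'"
      using that by (auto simp: blow_pts_def)
    then show ?thesis
      by (simp add: b_def blow_def)
  qed
  \<comment> \<open>A third index is used so that {0}, {1} and their union are all preimages of {0}
    under surjections onto the two indices, and therefore have the same ratio.\<close>
  let ?J2 = "{0, 1} :: nat set" and ?J3 = "{0, 1, 2} :: nat set"
  have b2: "b ?J2 {0} = b ?J2 {1}"
  proof -
    have "b ?J2 {0} * t ?J2 = t ?J2 * b ?J2 ((\<lambda>i. 1 - i) -` {0})"
      by (rule re) auto
    also have "b ?J2 ((\<lambda>i. 1 - i) -` {0}) = b ?J2 {1}"
      by (rule loc) auto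
    finally show ?thesis
      using unit_cancel[OF tu[of ?J2]] by (simp add: mult.commute)
  qed
  have b3: "b ?J2 {0} * t ?J3 = t ?J2 * b ?J3 {i}" if "i \<in> {0, 1}" for i
  proof -
    have "b ?J2 {0} * t ?J3 = t ?J2 * b ?J3 ((\<lambda>k. if k = i then 0 else 1 :: nat) -` {0})"
      by (rule re) (use that in auto)
    also have "b ?J3 ((\<lambda>k. if k = i then 0 else 1 :: nat) -` {0}) = b ?J3 {i}"
      by (rule loc) (auto split: if_splits)
    finally show ?thesis .
  qed
  have b3': "b ?J2 {0} * t ?J3 = t ?J2 * b ?J3 {0, 1}"
  proof -
    have "b ?J2 {0} * t ?J3 = t ?J2 * b ?J3 ((\<lambda>k. if k = 2 then 1 else 0 :: nat) -` {0})"
      by (rule re) auto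
    also have "b ?J3 ((\<lambda>k. if k = 2 then 1 else 0 :: nat) -` {0}) = b ?J3 {0, 1}"
      by (rule loc) (auto split: if_splits)
    finally show ?thesis .
  qed
  have u3: "b ?J3 {0} * b ?J3 {1} = t ?J3 * b ?J3 {0, 1}"
    using un[of ?J3 "{0}" "{1}"] by (simp add: insert_commute)
  have "b ?J3 {0} = b ?J3 {0, 1}" "b ?J3 {1} = b ?J3 {0, 1}"
    by (rule unit_cancel[OF tu[of ?J2]]; use b3[of 0] b3[of 1] b3' in simp)+
  then have "b ?J3 {0, 1} * b ?J3 {0, 1} = b ?J3 {0, 1} * t ?J3"
    using u3 by (simp add: mult.commute)
  then have "b ?J3 {0, 1} = t ?J3"
    using unit_cancel[OF bu[of ?J3]] by simp
  then have "t ?J3 * b ?J2 {0} = t ?J3 * t ?J2"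
    using b3' by (simp add: mult.commute)
  then have "b ?J2 {0} = t ?J2"
    using unit_cancel[OF tu[of ?J3]] by simp
  then have "t ?J2 * b ?J2 {0, 1} = t ?J2 * t ?J2"
    using un[of ?J2 "{0}" "{1}"] b2 by (simp add: insert_commute)
  then have b22: "b ?J2 {0, 1} = t ?J2"
    using unit_cancel[OF tu[of ?J2]] by simp
  \<comment> \<open>The constant map onto one index compares two uncollapsed copies of X with X
    itself.\<close>
  have "b {0} {0} * t ?J2 = t {0} * b ?J2 ((\<lambda>_. 0 :: nat) -` {0})"
    by (rule re) auto
  also have "b ?J2 ((\<lambda>_. 0 :: nat) -` {0}) = b ?J2 {0, 1}"
    by (rule loc) auto
  finally have "t ?J2 * b {0} {0} = t ?J2 * t {0}"
    using b22 by (simp add: mult.commute)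
  then have b1: "b {0} {0} = t {0}"
    using unit_cancel[OF tu[of ?J2]] by simp
  have gX: "is_gset G X"
    using X(1) by (rule inE_gset)
  have "restrict (\<lambda>x. (Inl x, 0)) (pts X) \<in> gmaps G X (blow X {0} {0})"
    by (rule gmapsI[OF gX]) auto
  moreover have "bij_betw (\<lambda>x. (Inl x, 0)) (pts X) (blow_pts X {0} {0})"
    by (auto simp: bij_betw_def inj_on_def blow_pts_def)
  ultimately have "gset_iso G X (blow X {0} {0})"
    by (auto simp: gset_iso_def gisos_def)
  then have "m X = b {0} {0}"
    unfolding b_def using m_iso[OF X inE_gset[OF inE_blow[OF X(1)]]] by simp
  then show ?thesis
    using b1 m_base[OF X, of "{0}"] by (simp add: t_def)
qed

section \<open>The parameter of a regular measure\<close>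

definition s :: 'k where
  "s = a 2"

lemma s_unit: "s dvd 1"
  unfolding s_def by (rule a_unit) simp

text \<open>Write a 2 = s and a 3 = s r. Then \<open>a_step\<close> gives a 4 = s r^2 and a 5 = s
  r^3; \<open>a_quad1\<close> becomes s = 2 + 4 r + r^2 and \<open>a_quad2\<close> becomes r = 2 + 4
  r + r^2. Hence s = r and r^2 + 3 r + 2 = 0.\<close>

lemma a_3: "a 3 = s * s" and s_quadratic: "(s + 1) * (s + 2) = 0"
proof -
  obtain u where u: "s * u = 1"
    using s_unit by (auto simp: dvd_def)
  define r where "r = a 3 * u"
  have a3: "a 3 = s * r"
    using u by (simp add: r_def ac_simps) (metis mult.assoc mult.commute mult_1)
  have rr: "r dvd 1"
    using a_unit[of 3] a3 by (metis dvd_mult_right dvd_trans zero_less_numeral)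
  have "s * a 4 = s * (s * r * r)"
    using a_step[of 2] a3 by (simp add: s_def ac_simps eval_nat_numeral)
  then have a4: "a 4 = s * r * r"
    by (rule unit_cancel[OF s_unit])
  have "s * a 5 = s * (s * r * r * r)"
    using a_step[of 3] a3 a4 by (simp add: s_def ac_simps eval_nat_numeral)
  then have a5: "a 5 = s * r * r * r"
    by (rule unit_cancel[OF s_unit])
  have "s * s = s * (2 + 4 * r + r * r)"
    using a_quad1 unfolding a3 a4 by (simp add: s_def algebra_simps)
  then have s1: "s = 2 + 4 * r + r * r"
    by (rule unit_cancel[OF s_unit])
  have "s * (s * (r * r)) = s * (s * (r * (2 + 4 * r + r * r)))"
    using a_quad2 unfolding a3 a4 a5 by (simp add: s_def algebra_simps)
  then have "r * r = r * (2 + 4 * r + r * r)"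
    using unit_cancel[OF s_unit] by metis
  then have r1: "r = 2 + 4 * r + r * r"
    by (rule unit_cancel[OF rr])
  have sr: "s = r"
    using s1 r1 by simp
  then show "a 3 = s * s"
    using a3 by simp
  have "(r + 1) * (r + 2) = (2 + 4 * r + r * r) - r"
    by (simp add: algebra_simps)
  then show "(s + 1) * (s + 2) = 0"
    using r1 sr by simp
qed

lemma a_power: "a (Suc n) = s ^ n"
proof (induction n)
  case 0
  then show ?case
    using a_1 by simp
next
  case (Suc n)
  have "s * a (Suc (Suc n)) = s * (s * s ^ n)"
    using a_step[of "Suc n"] Suc a_3 a_step[of "n"]
    by (cases n) (simp_all add: s_def eval_nat_numeral ac_simps)
  then show ?case
    using unit_cancel[OF s_unit] by simp
qed

lemma m_power: "inE X \<Longrightarrow> pts X \<noteq> {} \<Longrightarrow> m X = s ^ (rho G X - 1)"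
proof -
  assume X: "inE X" "pts X \<noteq> {}"
  have "orbs G X \<noteq> {}"
    using X by (simp add: orbs_def)
  then have "rho G X > 0"
    using inE_finite[OF X(1)] by (simp add: rho_eq_card card_gt_0_iff)
  then obtain n where "rho G X = Suc n"
    using gr0_conv_Suc by blast
  then show ?thesis
    using m_eq_a_rho[OF X] a_power by simp
qed

text \<open>A square of atoms has one vertex on each side, so its covers are all nonempty sets of
  its N edges, and the fiber relation reads (1 + s)^N = 1 + s. As 1 + s squares to its negative,
  even N gives 2 (1 + s) = 0; then the quadratic relation gives s (1 + s) = 0, and s is a
  unit.\<close>

lemma not_odd_order:
  assumes "\<not> odd_order G E" shows "s = -1"
proof -
  obtain X Y Z f h where at: "X \<in> atoms G E" "Y \<in> atoms G E" "Z \<in> atoms G E" and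
    fh: "f \<in> gmaps G Y X" "h \<in> gmaps G Z X" and ev: "even (rho G (fiber_prod Z h Y f))"
    using assms unfolding odd_order_def by blast
  have E: "inE X" "inE Y" "inE Z"
    using at E_inE by (auto simp: atoms_def)
  note g = inE_gset[OF E(1)] inE_gset[OF E(2)] inE_gset[OF E(3)]
  have one: "orbs G W = {pts W} \<and> pts W \<noteq> {}" if W: "W \<in> atoms G E" for W
  proof -
    have gW: "is_gset G W"
      using W E_gset by (auto simp: atoms_def)
    have "card (orbs G W) = 1"
      using W by (simp add: atoms_def rho_eq_card)
    then obtain A where A: "orbs G W = {A}"
      by (auto simp: card_1_singleton_iff)
    then have "A = pts W"
      using Union_orbs[OF gW] by simp
    moreover have "pts W \<noteq> {}"
      using A by (auto simp: orbs_def)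
    ultimately show ?thesis
      using A by simp
  qed
  have surj: "k \<in> surj_gmaps G W X" if k: "k \<in> gmaps G W X" and W: "W \<in> atoms G E" for k W
  proof -
    obtain x where x: "x \<in> pts W"
      using one[OF W] by blast
    have kx: "k x \<in> pts X"
      using gmaps_mem[OF k x] .
    have "k ` pts W = k ` orb G W x"
      using one[OF W] orb_in_orbs[OF x, of G] by auto
    also have "\<dots> = orb G X (k x)"
      by (rule gmaps_orb[OF k x])
    also have "\<dots> = pts X"
      using one[OF at(1)] orb_in_orbs[OF kx, of G] by auto
    finally show ?thesis
      using k by (simp add: surj_gmaps_def)
  qed
  note f = surj[OF fh(1) at(2)] and h = surj[OF fh(2) at(3)]
  let ?Fib = "fiber_prod Z h Y f"
  define N where "N = rho G ?Fib"
  have finR: "finite (orbs G ?Fib)"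
    by (rule finite_orbs_Fib[OF E(3,2) fh(2,1)])
  have cov: "covers Z h Y f = Pow (orbs G ?Fib) - {{}}"
  proof (intro equalityI subsetI)
    fix Q assume "Q \<in> covers Z h Y f"
    then show "Q \<in> Pow (orbs G ?Fib) - {{}}"
      using one[OF at(2)] by (auto simp: covers_def)
  next
    fix Q assume Q: "Q \<in> Pow (orbs G ?Fib) - {{}}"
    have "fst ` r = pts Z" "snd ` r = pts Y" if "r \<in> Q" for r
      using orbs_Fib_fst[OF g(3,2) fh(2,1), of r] orbs_Fib_snd[OF g(3,2) fh(2,1), of r] Q that
        one[OF at(2)] one[OF at(3)] by auto
    then show "Q \<in> covers Z h Y f"
      using Q one[OF at(2)] one[OF at(3)] by (auto simp: covers_def)
  qed
  have r1: "rho G X = 1" "rho G Y = 1" "rho G Z = 1"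
    using at by (auto simp: atoms_def)
  have ne: "pts X \<noteq> {}" "pts Y \<noteq> {}" "pts Z \<noteq> {}"
    using one at by auto
  have "1 = (\<Sum>D\<in>ample Z h Y f. m (sub_gset (prod_gset Z Y) D))"
    using m_fiber[OF h f E(1,3,2) ne(3)] m_power[OF E(1) ne(1)] m_power[OF E(2) ne(2)] m_power[OF E(3) ne(3)]
    by (simp add: r1)
  also have "\<dots> = (\<Sum>D\<in>ample Z h Y f. s ^ (rho G (sub_gset (prod_gset Z Y) D) - 1))"
    by (rule sum.cong[OF refl]) (use m_power ample_gset_E[OF E(3,2) ne(3)] in blast)
  also have "\<dots> = (\<Sum>Q\<in>covers Z h Y f. s ^ (card Q - 1))"
    by (rule sum_ample[OF g(3,2) fh(2,1)])
  finally have one': "1 = (\<Sum>Q\<in>covers Z h Y f. s ^ (card Q - 1))" .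
  have "s = (\<Sum>Q\<in>covers Z h Y f. s * s ^ (card Q - 1))"
    using arg_cong[OF one', of "\<lambda>x. s * x"] by (simp only: mult_1_right sum_distrib_left)
  also have "\<dots> = (\<Sum>Q\<in>Pow (orbs G ?Fib) - {{}}. s ^ card Q)"
    unfolding cov
  proof (rule sum.cong[OF refl])
    fix Q assume "Q \<in> Pow (orbs G ?Fib) - {{}}"
    then have "card Q > 0"
      using finR finite_subset by (auto simp: card_gt_0_iff)
    then show "s * s ^ (card Q - 1) = s ^ card Q"
      by (metis Suc_diff_1 power_Suc)
  qed
  also have "\<dots> = (1 + s) ^ N - 1"
    using finR sum_Pow_power[OF finR, of s] by (subst sum_diff1) (auto simp: N_def rho_eq_card)
  finally have N: "(1 + s) ^ N = 1 + s"
    by (simp add: algebra_simps)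
  have sq: "(1 + s) * (1 + s) = - (1 + s)"
    using s_quadratic by (simp add: algebra_simps eq_neg_iff_add_eq_0)
  have pw: "(1 + s) ^ Suc k = (-1) ^ k * (1 + s)" for k
  proof (induction k)
    case (Suc k)
    have "(1 + s) ^ Suc (Suc k) = (-1) ^ k * ((1 + s) * (1 + s))"
      using Suc by (simp add: ac_simps)
    also have "\<dots> = (-1) ^ Suc k * (1 + s)"
      unfolding sq by (simp add: algebra_simps)
    finally show ?case .
  qed simp
  have "2 * (1 + s) = 0"
  proof (cases N)
    \<comment> \<open>Here s = 0, and the quadratic relation itself reads 2 = 0.\<close>
    case 0
    then have "s = 0"
      using N by simp
    then show ?thesis
      using s_quadratic by simp
  next
    case (Suc k)
    then have "odd k"
      using ev by (simp add: N_def)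
    then have "- (1 + s) = 1 + s"
      using N pw[of k] Suc by simp
    then show ?thesis
      by (metis add.right_inverse mult_2)
  qed
  then have "s * (1 + s) = s * 0"
    using s_quadratic by (simp add: algebra_simps)
  then have "1 + s = 0"
    by (rule unit_cancel[OF s_unit])
  then show ?thesis
    by (simp add: eq_neg_iff_add_eq_0 add.commute)
qed

section \<open>Reading the measure off from its parameter\<close>

lemma am_power:
  assumes "A \<in> At" shows "am A = s ^ (rhoB A - 1)"
proof -
  obtain X \<phi> where X: "X \<in> E" "pts X \<noteq> {}" "\<phi> \<in> gisos H A (B X)"
    using assms by (rule atomE)
  have "gset_iso H A (B X)"
    using X(3) by (auto simp: gset_iso_def)
  then have "am A = m X"
    using m_eq[OF E_gset[OF X(1)] X(1,2) gset_iso_refl[OF E_gset[OF X(1)]] assms] by simp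
  then show ?thesis
    using m_power[OF E_inE[OF X(1)] X(2)] rhoB_atom[OF assms X] by simp
qed

lemma rhoB_pos: "A \<in> At \<Longrightarrow> rhoB A \<ge> 1"
  using rhoB_le[OF _ one_atom const_gmaps] rhoB_one by simp

lemma mu_power:
  assumes "AY \<in> At" "AX \<in> At" "F \<in> gmaps H AY AX"
  shows "\<mu> AY AX F = s ^ (rhoB AY - rhoB AX)"
proof -
  have le: "rhoB AX \<le> rhoB AY" "1 \<le> rhoB AX"
    using rhoB_le[OF assms] rhoB_pos[OF assms(2)] by auto
  have "am AX * \<mu> AY AX F = am AX * s ^ (rhoB AY - rhoB AX)"
    using am_mu[OF assms] le by (simp add: am_power assms power_add[symmetric])
  then show ?thesis
    by (rule unit_cancel[OF am_unit[OF assms(2)]])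
qed

lemma alpha_k: "is_alpha_k G E \<Omega> (extend_scalars (power_measure (-1)) :: (('i, 'g univ) pro_endo, ('i, 'g univ) pro_endo univ, 'k) gmeasure)"
  unfolding is_alpha_k_def using alpha_exists by (auto simp: measure_eq_def)

lemma beta_k: "odd_order G E \<Longrightarrow>
    is_beta_k G E \<Omega> (extend_scalars (power_measure (-2)) :: (('i, 'g univ) pro_endo, ('i, 'g univ) pro_endo univ, 'k) gmeasure)"
  unfolding is_beta_k_def using beta_exists by (auto simp: measure_eq_def)

lemma mu_alpha: "s = -1 \<Longrightarrow> is_alpha_k G E \<Omega> \<mu>"
  unfolding is_alpha_k_def using alpha_exists
  by (intro exI[of _ "power_measure (-1)"]) (simp add: measure_eq_def mu_power extend_scalars_def power_measure_def)

lemma mu_beta: "s = -2 \<Longrightarrow> odd_order G E \<Longrightarrow> is_beta_k G E \<Omega> \<mu>"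
  unfolding is_beta_k_def using beta_exists
  by (intro conjI exI[of _ "power_measure (-2)"])
    (simp_all add: measure_eq_def mu_power extend_scalars_def power_measure_def)

lemma s_idempotent: "(s + 2) * (s + 2) = s + 2"
  using s_quadratic by (simp add: algebra_simps)

text \<open>By the quadratic relation s acts as -1 on the idempotent s + 2 and as -2 on its
  complement, so the powers of s split accordingly.\<close>

lemma s_power: "s ^ n = (s + 2) * (-1) ^ n + (1 - (s + 2)) * (-2) ^ n"
proof (induction n)
  case (Suc n)
  have 1: "s * (s + 2) = - (s + 2)" and 2: "s * (1 - (s + 2)) = -2 * (1 - (s + 2))"
    using s_quadratic by (simp_all add: algebra_simps eq_neg_iff_add_eq_0)
  have "s ^ Suc n = (s * (s + 2)) * (-1) ^ n + (s * (1 - (s + 2))) * (-2) ^ n"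
    unfolding power_Suc Suc by (rule trans[OF distrib_left]) (simp only: mult.assoc)
  then show ?case
    unfolding 1 2 by (simp add: algebra_simps)
qed simp

text \<open>If \<open>E\<close> is not odd, s = -1 and only \<alpha> is possible. If it is odd, e =
  s + 2 is the weight of \<alpha>: e = 1 means s = -1, and e = 0 means s = -2.\<close>

lemma regular_classification:
  "((\<forall>e::'k. e * e = e \<longrightarrow> e = 0 \<or> e = 1) \<longrightarrow> is_alpha_k G E \<Omega> \<mu> \<or> is_beta_k G E \<Omega> \<mu>) \<and>
   (is_alpha_k G E \<Omega> \<mu> \<or>
     (\<exists>\<alpha>\<^sub>k \<beta>\<^sub>k (e::'k). is_alpha_k G E \<Omega> \<alpha>\<^sub>k \<and> is_beta_k G E \<Omega> \<beta>\<^sub>k \<and> e * e = e \<and>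
        measure_eq H C \<mu> (\<lambda>Y X f. e * \<alpha>\<^sub>k Y X f + (1 - e) * \<beta>\<^sub>k Y X f)))"
proof (cases "odd_order G E")
  case False
  then show ?thesis
    using mu_alpha not_odd_order by blast
next
  case True
  have "s = -2" if "s + 2 = 0"
    using that by (simp add: eq_neg_iff_add_eq_0)
  moreover have "s = -1" if "s + 2 = 1"
    using that by (simp add: eq_neg_iff_add_eq_0 algebra_simps)
  ultimately have "is_alpha_k G E \<Omega> \<mu> \<or> is_beta_k G E \<Omega> \<mu>" if "\<forall>e::'k. e * e = e \<longrightarrow> e = 0 \<or> e = 1"
    using that s_idempotent mu_alpha mu_beta True by blast
  moreover have "measure_eq H C \<mu> (\<lambda>Y X f. (s + 2) * extend_scalars (power_measure (-1)) Y X f +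
      (1 - (s + 2)) * extend_scalars (power_measure (-2)) Y X f)"
    unfolding measure_eq_def extend_scalars_def power_measure_def
    using mu_power s_power by simp
  ultimately show ?thesis
    using alpha_k beta_k[OF True] s_idempotent by blast
qed

end

theorem proposition8p11:
  fixes G :: "('g, 'm) monoid_scheme"
    and T :: "'g topology"
    and E :: "('g, 'g univ) gset set"
    and \<Omega> :: "('i, 'g, 'g univ) pro_obj"
    and \<mu> :: "(('i, 'g univ) pro_endo, ('i, 'g univ) pro_endo univ, 'k::comm_ring_1) gmeasure"
  assumes "pro_oligomorphic G T"
    and "is_order G T E"
    and "is_pro_object G E \<Omega>"
    and "universal_pro G E \<Omega>"
    and "homogeneous_pro G E \<Omega>"
    and "regular_measure (pro_Aut G \<Omega>) (assoc_order G E \<Omega>) \<mu>"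
  shows
    "((\<forall>e::'k. e * e = e \<longrightarrow> e = 0 \<or> e = 1) \<longrightarrow>
        is_alpha_k G E \<Omega> \<mu> \<or> is_beta_k G E \<Omega> \<mu>)
     \<and>
     (is_alpha_k G E \<Omega> \<mu> \<or>
        (\<exists>\<alpha>\<^sub>k \<beta>\<^sub>k (e::'k). is_alpha_k G E \<Omega> \<alpha>\<^sub>k \<and> is_beta_k G E \<Omega> \<beta>\<^sub>k \<and> e * e = e \<and>
           measure_eq (pro_Aut G \<Omega>) (assoc_order G E \<Omega>) \<mu>
             (\<lambda>Y X f. e * \<alpha>\<^sub>k Y X f + (1 - e) * \<beta>\<^sub>k Y X f)))"
proof -
  interpret regular_pro G T E \<Omega> \<mu>
    using assms by unfold_locales
  show ?thesis
    by (rule regular_classification)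
qed

end
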